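(* Let $p$ be a prime. There exist a link complement $X$ (the complement of a link in $\mathbb{S}^3$), with fundamental group $\Gamma$, and a sequence of $p$-covers $X_i$ of $X$, with corresponding subgroups $\Gamma_i\le\Gamma$, arising from a homomorphism $\phi:\Gamma\to\mathrm{GL}_n(\mathbb{Z}_p)$ for some positive integer $n$, such that $$\lim_{i\to+\infty}\frac{\dim_{\mathbb{F}_p} H_1(X_i,\mathbb{F}_p)}{[\Gamma:\Gamma_i]}\neq\lim_{i\to+\infty}\frac{\dim_{\mathbb{Q}} H_1(X_i,\mathbb{Q})}{[\Gamma:\Gamma_i]}.$$
   Context: Given a homomorphism $\phi:\Gamma\to\mathrm{GL}_n(\mathbb{Z}_p)$, let $G$ be the closure of $\phi(\Gamma)$, $G_i=\ker(G\to\mathrm{GL}_n(\mathbb{Z}/p^i\mathbb{Z}))$ and $\Gamma_i=\phi^{-1}(G_i)$; the sequence of covers arising from $\phi$ consists of the finite covers $X_i$ of $X$ corresponding to $\Gamma_i$. A $p$-cover is a finite regular cover whose deck transformation group is a $p$-group. A link complement may be replaced by the compact exterior of the link (complement of an open tubular neighbourhood), which is homotopy equivalent to it. *)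

theory Defs
  imports
    "HOL-Analysis.Analysis"
    "HOL-Homology.Homology"
    "HOL-Number_Theory.Residues"
    "Jordan_Normal_Form.Missing_VectorSpace"
begin

section \<open>Links in the three-sphere\<close>

definition smooth_curve :: "(real \<Rightarrow> 'a::real_normed_vector) \<Rightarrow> bool" where
  "smooth_curve \<gamma> \<longleftrightarrow>
     (\<exists>D :: nat \<Rightarrow> real \<Rightarrow> 'a. D 0 = \<gamma> \<and>
        (\<forall>k t. (D k has_vector_derivative D (Suc k) t) (at t)))"

text \<open>
  A smooth embedding of the circle, written as a map on \<open>\<real>\<close> of period 1.
\<close>

definition smooth_knot_param :: "(real \<Rightarrow> 'a::real_normed_vector) \<Rightarrow> bool" where
  "smooth_knot_param \<gamma> \<longleftrightarrow>
     smooth_curve \<gamma> \<and> (\<forall>t. \<gamma> (t + 1) = \<gamma> t) \<and> inj_on \<gamma> {0..<1} \<and>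
     (\<forall>t. vector_derivative \<gamma> (at t) \<noteq> 0)"

text \<open>
  The norm on \<open>complex \<times> complex\<close> is the Euclidean one, so this is the unit sphere of a
  four-dimensional Euclidean space.
\<close>

definition S3 :: "(complex \<times> complex) set" where
  "S3 = sphere 0 1"

definition is_link :: "(complex \<times> complex) set \<Rightarrow> bool" where
  "is_link L \<longleftrightarrow>
     (\<exists>(m::nat) \<gamma>. m > 0 \<and>
        (\<forall>k<m. smooth_knot_param (\<gamma> k) \<and> range (\<gamma> k) \<subseteq> S3) \<and>
        (\<forall>j<m. \<forall>k<m. j \<noteq> k \<longrightarrow> range (\<gamma> j) \<inter> range (\<gamma> k) = {}) \<and>
        L = (\<Union>k<m. range (\<gamma> k)))"

definition is_link_complement :: "(complex \<times> complex) set \<Rightarrow> bool" where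
  "is_link_complement X \<longleftrightarrow> (\<exists>L. is_link L \<and> X = S3 - L)"


section \<open>Fundamental groups and covers\<close>

definition path_class :: "'a::topological_space set \<Rightarrow> (real \<Rightarrow> 'a) \<Rightarrow> (real \<Rightarrow> 'a) set" where
  "path_class S f = {g. homotopic_paths S f g}"

definition fundamental_group ::
    "'a::topological_space set \<Rightarrow> 'a \<Rightarrow> (real \<Rightarrow> 'a) set monoid" where
  "fundamental_group S a =
     \<lparr>carrier = {path_class S f | f.
        path f \<and> path_image f \<subseteq> S \<and> pathstart f = a \<and> pathfinish f = a},
      monoid.mult = (\<lambda>A B. \<Union>f\<in>A. \<Union>g\<in>B. path_class S (f +++ g)),
      one = path_class S (\<lambda>t. a)\<rparr>"

definition pi1_map ::
    "'b::topological_space set \<Rightarrow> ('a \<Rightarrow> 'b) \<Rightarrow> (real \<Rightarrow> 'a) set \<Rightarrow> (real \<Rightarrow> 'b) set" where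
  "pi1_map S h A = (\<Union>f\<in>A. path_class S (h \<circ> f))"

text \<open>
  A connected cover is determined up to isomorphism by this relation. Covers may be taken as
  subsets of \<open>\<complex>\<^sup>3\<close>: a cover of a link complement is a smooth 3-manifold, hence embeds in
  \<open>\<real>\<^sup>6\<close>.
\<close>

definition corresponds_to_subgroup ::
    "'a::topological_space set \<Rightarrow> ('a \<Rightarrow> 'b) \<Rightarrow> 'b::topological_space set \<Rightarrow> 'b
      \<Rightarrow> (real \<Rightarrow> 'b) set set \<Rightarrow> bool" where
  "corresponds_to_subgroup E q X a H \<longleftrightarrow>
     (\<exists>e\<in>E. q e = a \<and> pi1_map X q ` carrier (fundamental_group E e) = H)"

definition deck_group :: "'a::topological_space set \<Rightarrow> ('a \<Rightarrow> 'b) \<Rightarrow> ('a \<Rightarrow> 'a) monoid" where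
  "deck_group E q =
     \<lparr>carrier = {f \<in> extensional E. (\<exists>g. homeomorphism E E f g) \<and> (\<forall>x\<in>E. q (f x) = q x)},
      monoid.mult = (\<lambda>f g. compose E f g),
      one = restrict id E\<rparr>"

text \<open>
  \<open>order\<close> is 0 on infinite groups, so the last condition includes finiteness of the deck group.
\<close>

definition p_cover ::
    "nat \<Rightarrow> 'a::topological_space set \<Rightarrow> ('a \<Rightarrow> 'b) \<Rightarrow> 'b::topological_space set \<Rightarrow> bool" where
  "p_cover p E q X \<longleftrightarrow>
     covering_space E q X \<and> path_connected E \<and>
     (\<forall>x\<in>X. finite {e\<in>E. q e = x}) \<and>
     (\<forall>e\<in>E. \<forall>e'\<in>E. q e = q e' \<longrightarrow> (\<exists>f\<in>carrier (deck_group E q). f e = e')) \<and>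
     (\<exists>k. order (deck_group E q) = p ^ k)"


section \<open>The \<open>p\<close>-adic integers and their general linear groups\<close>

text \<open>
  \<open>\<int>\<^sub>p\<close> is the inverse limit of the rings \<open>\<int>/p\<^sup>i\<close>: a \<open>p\<close>-adic integer is the
  sequence of its residues, the \<open>i\<close>-th taken in \<open>{0..<p\<^sup>i}\<close>.
\<close>

definition padic_int :: "nat \<Rightarrow> (nat \<Rightarrow> int) ring" where
  "padic_int p =
     \<lparr>carrier = {x. \<forall>i. x i \<in> {0..<int p ^ i} \<and> x (Suc i) mod int p ^ i = x i},
      monoid.mult = (\<lambda>x y i. (x i * y i) mod int p ^ i),
      one = (\<lambda>i. 1 mod int p ^ i),
      zero = (\<lambda>i. 0),
      add = (\<lambda>x y i. (x i + y i) mod int p ^ i)\<rparr>"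

definition padic_topology :: "nat \<Rightarrow> (nat \<Rightarrow> int) topology" where
  "padic_topology p =
     subtopology (product_topology (\<lambda>i. discrete_topology UNIV) UNIV) (carrier (padic_int p))"

text \<open>
  Square matrices of size \<open>n\<close> are extensional functions on pairs of indices below \<open>n\<close>.
\<close>

definition matrix_monoid :: "nat \<Rightarrow> ('r, 'm) ring_scheme \<Rightarrow> (nat \<times> nat \<Rightarrow> 'r) monoid" where
  "matrix_monoid n R =
     \<lparr>carrier = ({..<n} \<times> {..<n}) \<rightarrow>\<^sub>E carrier R,
      monoid.mult = (\<lambda>A B. \<lambda>(i, j)\<in>{..<n} \<times> {..<n}.
        \<Oplus>\<^bsub>R\<^esub>k\<in>{..<n}. A (i, k) \<otimes>\<^bsub>R\<^esub> B (k, j)),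
      one = (\<lambda>(i, j)\<in>{..<n} \<times> {..<n}. if i = j then \<one>\<^bsub>R\<^esub> else \<zero>\<^bsub>R\<^esub>)\<rparr>"

definition GL :: "nat \<Rightarrow> ('r, 'm) ring_scheme \<Rightarrow> (nat \<times> nat \<Rightarrow> 'r) monoid" where
  "GL n R = units_of (matrix_monoid n R)"

text \<open>
  The topology of entrywise convergence; inversion is continuous for it because \<open>\<int>\<^sub>p\<close> is a
  topological ring in which inversion of units is continuous.
\<close>

definition GL_padic_topology :: "nat \<Rightarrow> nat \<Rightarrow> (nat \<times> nat \<Rightarrow> nat \<Rightarrow> int) topology" where
  "GL_padic_topology n p =
     subtopology (product_topology (\<lambda>_. padic_topology p) ({..<n} \<times> {..<n}))
       (carrier (GL n (padic_int p)))"

definition reduce_mat :: "nat \<Rightarrow> nat \<Rightarrow> (nat \<times> nat \<Rightarrow> nat \<Rightarrow> int) \<Rightarrow> nat \<times> nat \<Rightarrow> int" where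
  "reduce_mat n i A = (\<lambda>rs\<in>{..<n} \<times> {..<n}. A rs i)"

definition image_closure ::
    "nat \<Rightarrow> nat \<Rightarrow> ('g, 'm) monoid_scheme \<Rightarrow> ('g \<Rightarrow> nat \<times> nat \<Rightarrow> nat \<Rightarrow> int)
      \<Rightarrow> (nat \<times> nat \<Rightarrow> nat \<Rightarrow> int) monoid" where
  "image_closure n p \<Gamma> \<phi> =
     (GL n (padic_int p)) \<lparr>carrier := GL_padic_topology n p closure_of (\<phi> ` carrier \<Gamma>)\<rparr>"

text \<open>
  To be used for \<open>i \<ge> 1\<close> only: \<open>residue_ring 1\<close> is not the zero ring, since its unit 1 lies
  outside its carrier \<open>{0}\<close>.
\<close>

definition congruence_subgroup ::
    "nat \<Rightarrow> nat \<Rightarrow> ('g, 'm) monoid_scheme \<Rightarrow> ('g \<Rightarrow> nat \<times> nat \<Rightarrow> nat \<Rightarrow> int)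
      \<Rightarrow> nat \<Rightarrow> 'g set" where
  "congruence_subgroup n p \<Gamma> \<phi> i =
     {g \<in> carrier \<Gamma>.
        \<phi> g \<in> kernel (image_closure n p \<Gamma> \<phi>) (GL n (residue_ring (int p ^ i))) (reduce_mat n i)}"


section \<open>Singular homology with coefficients in a field\<close>

text \<open>
  HOL-Homology has integral chains only. Here a chain with coefficients in \<open>R\<close> is a finitely
  supported function on singular simplices. Modules extend the ring record, whose
  multiplicative part plays no role and is left unspecified.
\<close>

definition chain_module ::
    "('r, 'm) ring_scheme \<Rightarrow> nat \<Rightarrow> 'a topology \<Rightarrow> ('r, ((nat \<Rightarrow> real) \<Rightarrow> 'a) \<Rightarrow> 'r) module" where
  "chain_module R n X =
     \<lparr>carrier = {c. (\<forall>s. c s \<in> carrier R) \<and> finite {s. c s \<noteq> \<zero>\<^bsub>R\<^esub>} \<and>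
        {s. c s \<noteq> \<zero>\<^bsub>R\<^esub>} \<subseteq> singular_simplex_set n X},
      monoid.mult = undefined,
      one = undefined,
      zero = (\<lambda>s. \<zero>\<^bsub>R\<^esub>),
      add = (\<lambda>c d s. c s \<oplus>\<^bsub>R\<^esub> d s),
      smult = (\<lambda>r c s. r \<otimes>\<^bsub>R\<^esub> c s)\<rparr>"

text \<open>
  The coefficient at \<open>t\<close> of \<open>\<Sum>\<^sub>s \<Sum>\<^sub>k (-1)\<^sup>k c(s) (k-th face of s)\<close>.
\<close>

definition chain_bd ::
    "('r, 'm) ring_scheme \<Rightarrow> nat \<Rightarrow> (((nat \<Rightarrow> real) \<Rightarrow> 'a) \<Rightarrow> 'r) \<Rightarrow> ((nat \<Rightarrow> real) \<Rightarrow> 'a) \<Rightarrow> 'r" where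
  "chain_bd R n c =
     (if n = 0 then (\<lambda>t. \<zero>\<^bsub>R\<^esub>)
      else (\<lambda>t. \<Oplus>\<^bsub>R\<^esub>sk\<in>{(s, k). c s \<noteq> \<zero>\<^bsub>R\<^esub> \<and> k \<le> n \<and> singular_face n k s = t}.
                  if even (snd sk) then c (fst sk) else \<ominus>\<^bsub>R\<^esub> c (fst sk)))"

definition cycles ::
    "('r, 'm) ring_scheme \<Rightarrow> nat \<Rightarrow> 'a topology \<Rightarrow> (((nat \<Rightarrow> real) \<Rightarrow> 'a) \<Rightarrow> 'r) set" where
  "cycles R n X = {c \<in> carrier (chain_module R n X). chain_bd R n c = (\<lambda>t. \<zero>\<^bsub>R\<^esub>)}"

definition boundaries ::
    "('r, 'm) ring_scheme \<Rightarrow> nat \<Rightarrow> 'a topology \<Rightarrow> (((nat \<Rightarrow> real) \<Rightarrow> 'a) \<Rightarrow> 'r) set" where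
  "boundaries R n X = chain_bd R (Suc n) ` carrier (chain_module R (Suc n) X)"

definition homology ::
    "('r, 'm) ring_scheme \<Rightarrow> nat \<Rightarrow> 'a topology \<Rightarrow> ('r, (((nat \<Rightarrow> real) \<Rightarrow> 'a) \<Rightarrow> 'r) set) module" where
  "homology R n X =
     (let C = chain_module R n X; B = boundaries R n X in
      \<lparr>carrier = a_rcosets\<^bsub>C\<lparr>carrier := cycles R n X\<rparr>\<^esub> B,
       monoid.mult = undefined,
       one = undefined,
       zero = B,
       add = (\<lambda>U V. U <+>\<^bsub>C\<^esub> V),
       smult = (\<lambda>r U. \<Union>c\<in>U. B +>\<^bsub>C\<^esub> (r \<odot>\<^bsub>C\<^esub> c))\<rparr>)"

definition rat_field :: "rat ring" where
  "rat_field =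
     \<lparr>carrier = UNIV, monoid.mult = (*), one = 1, zero = 0, add = (+)\<rparr>"

text \<open>
  Meaningful for finite-dimensional homology, as is the case for finite covers of link
  complements; \<open>vectorspace.dim\<close> is unspecified on other spaces.
\<close>

definition homology_dim :: "('r, 'm) ring_scheme \<Rightarrow> nat \<Rightarrow> 'a topology \<Rightarrow> nat" where
  "homology_dim K n X = vectorspace.dim K (homology K n X)"

end

(*
The link is the torus link T(2,2p), formed by the axis w = 0 and a (1,p) torus knot. With
u = z/|w| and v = w/|w| its complement becomes {(u,v) : |v| = 1, u^p ~= v}, and the function
u^p/v - 1 sends loops to integers (its winding numbers). Taking for phi the winding number k,
placed in the unipotent matrix ((1,k),(0,1)), gives Gamma_i = {p^i | k}, and with N = p^i the covers are

  X_i = {(u,v,y) : |v| = 1, y ~= 0, u^p = v (1 + y^N)}.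

The circle action (s u, s^p v, y) makes X_i a Seifert fibration over y in the punctured plane with
N exceptional fibres c_j of multiplicity p, lying over the roots y_j of y^N = -1. Its first
homology is generated by the c_j together with one loop a around y = 0, and all multiples p c_j are
homologous to the regular fibre. Over Q this leaves at most two dimensions. Over F_p the
c_j are independent: the covering given by a p-th root of y - y_j (which, with a p-th root of
v (1 + y^N)/(y - y_j), is pulled back from (r,t) |-> (r^p, r t, t^p)) defines a class in
H^1(X_i, F_p) that detects c_j and vanishes on the other c_k. Hence N <= dim <= N + 1, and the
two limits are 1 and 0.

For the generators, sectors of the y-plane around y_j cover the punctured plane; over such a sector X_i
deformation retracts to c_j, and over the overlap of two neighbouring sectors X_i is connected.
*)

theory Submission
  imports Defs "HOL-Complex_Analysis.Riemann_Mapping" "HOL-Algebra.Elementary_Groups"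
begin

section \<open>Chains with coefficients: transfer from integral chains, evaluation of cochains,
  linearity of the boundary\<close>

section \<open>Singular chains with coefficients in a ring\<close>

text \<open>The exceptional fibres come from the circle z = 0 of the link complement: there u = 0
  and u^p/v - 1 is constantly -1, so the circle has winding number 0 and lifts to N closed loops.
  The differences c_j - c_k are p-torsion; this torsion grows linearly in N and is seen by F_p only.

  Both bounds are obtained on the level of chains. For the upper bound, W is any subspace of chains
  containing the boundaries and the proposed generators, and paths are compared modulo W. That W
  contains all loops follows from a potential that is well defined modulo W where sectors overlap;
  it plays the part of a Mayer-Vietoris sequence. For the lower bound, the classes become explicit
  cocycles, defined on every path by choosing a base point in each fibre of a p-fold covering,
  without any continuity.

  This covering is unramified along c_j because y - y_j vanishes there to order p in the chart
  coordinate r. On c_j itself the root of y - y_j is 0 and cannot tell the sheets apart; the second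
  root, whose product with the first is u, takes over.\<close>

lemma chain_module_simps [simp]:
  "\<zero>\<^bsub>chain_module R n X\<^esub> = (\<lambda>s. \<zero>\<^bsub>R\<^esub>)"
  "c \<oplus>\<^bsub>chain_module R n X\<^esub> d = (\<lambda>s. c s \<oplus>\<^bsub>R\<^esub> d s)"
  "r \<odot>\<^bsub>chain_module R n X\<^esub> c = (\<lambda>s. r \<otimes>\<^bsub>R\<^esub> c s)"
  by (simp_all add: chain_module_def)

lemma chain_carrier_iff:
  "c \<in> carrier (chain_module R n X) \<longleftrightarrow>
     (\<forall>s. c s \<in> carrier R) \<and> finite {s. c s \<noteq> \<zero>\<^bsub>R\<^esub>} \<and>
     {s. c s \<noteq> \<zero>\<^bsub>R\<^esub>} \<subseteq> singular_simplex_set n X"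
  by (simp add: chain_module_def)

context cring
begin

lemma chain_add_closed:
  assumes "c \<in> carrier (chain_module R n X)" "d \<in> carrier (chain_module R n X)"
  shows "(\<lambda>s. c s \<oplus> d s) \<in> carrier (chain_module R n X)"
proof -
  have "{s. c s \<oplus> d s \<noteq> \<zero>} \<subseteq> {s. c s \<noteq> \<zero>} \<union> {s. d s \<noteq> \<zero>}"
    using assms by (auto simp: chain_carrier_iff)
  then show ?thesis
    using assms unfolding chain_carrier_iff
    by (blast intro: finite_subset a_closed)
qed

lemma chain_smult_closed:
  assumes "c \<in> carrier (chain_module R n X)" "r \<in> carrier R"
  shows "(\<lambda>s. r \<otimes> c s) \<in> carrier (chain_module R n X)"
proof -
  have "{s. r \<otimes> c s \<noteq> \<zero>} \<subseteq> {s. c s \<noteq> \<zero>}"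
    using assms by (auto simp: chain_carrier_iff)
  then show ?thesis
    using assms unfolding chain_carrier_iff
    by (blast intro: finite_subset m_closed)
qed

lemma chain_zero_closed: "(\<lambda>s. \<zero>) \<in> carrier (chain_module R n X)"
  by (simp add: chain_carrier_iff)

lemma chain_module_module: "module R (chain_module R n X)"
proof (rule moduleI)
  show "cring R" by (rule is_cring)
  show "abelian_group (chain_module R n X)"
  proof (rule abelian_groupI)
    fix c assume c: "c \<in> carrier (chain_module R n X)"
    have "(\<lambda>s. \<ominus> c s) = (\<lambda>s. (\<ominus> \<one>) \<otimes> c s)"
      using c by (auto simp: chain_carrier_iff l_minus)
    then have "(\<lambda>s. \<ominus> c s) \<in> carrier (chain_module R n X)"
      using chain_smult_closed[OF c, of "\<ominus> \<one>"] by simp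
    then show "\<exists>d\<in>carrier (chain_module R n X). d \<oplus>\<^bsub>chain_module R n X\<^esub> c = \<zero>\<^bsub>chain_module R n X\<^esub>"
      using c by (intro bexI[of _ "\<lambda>s. \<ominus> c s"]) (auto simp: chain_carrier_iff l_neg)
  next
    fix c d e assume "c \<in> carrier (chain_module R n X)" "d \<in> carrier (chain_module R n X)"
      "e \<in> carrier (chain_module R n X)"
    then show "c \<oplus>\<^bsub>chain_module R n X\<^esub> d \<oplus>\<^bsub>chain_module R n X\<^esub> e =
        c \<oplus>\<^bsub>chain_module R n X\<^esub> (d \<oplus>\<^bsub>chain_module R n X\<^esub> e)"
      by (simp add: chain_carrier_iff a_assoc)
  qed (simp_all add: chain_add_closed chain_zero_closed, auto simp: chain_carrier_iff a_comm)
qed (simp_all add: chain_smult_closed, auto simp: l_distr r_distr m_assoc chain_carrier_iff)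

lemma chain_a_inv:
  assumes c: "c \<in> carrier (chain_module R n X)"
  shows "\<ominus>\<^bsub>chain_module R n X\<^esub> c = (\<lambda>s. \<ominus> c s)"
proof -
  interpret C: module R "chain_module R n X" by (rule chain_module_module)
  have e: "(\<lambda>s. \<ominus> c s) = (\<lambda>s. (\<ominus> \<one>) \<otimes> c s)"
    using c by (auto simp: chain_carrier_iff l_minus)
  then have m: "(\<lambda>s. \<ominus> c s) \<in> carrier (chain_module R n X)"
    using chain_smult_closed[OF c, of "\<ominus> \<one>"] by simp
  have "(\<lambda>s. \<ominus> c s) \<oplus>\<^bsub>chain_module R n X\<^esub> c = \<zero>\<^bsub>chain_module R n X\<^esub>"
    using c by (auto simp: chain_carrier_iff l_neg)
  then show ?thesis
    using C.minus_equality[OF _ c m] by simp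
qed

text \<open>Change of coefficients along the ring map from the integers to \<open>R\<close>. It
  carries the boundary identities of integral chains over to chains with coefficients in
  \<open>R\<close>.\<close>

definition frag_chain :: "('s \<Rightarrow>\<^sub>0 int) \<Rightarrow> 's \<Rightarrow> 'a" where
  "frag_chain c = (\<lambda>s. [Poly_Mapping.lookup c s] \<cdot> \<one>)"

lemma frag_chain_0 [simp]: "frag_chain 0 = (\<lambda>s. \<zero>)"
  by (auto simp: frag_chain_def add_pow_def)

lemma frag_chain_add: "frag_chain (c + d) = (\<lambda>s. frag_chain c s \<oplus> frag_chain d s)"
  by (auto simp: frag_chain_def lookup_add add.int_pow_mult)

lemma frag_chain_uminus: "frag_chain (- c) = (\<lambda>s. \<ominus> frag_chain c s)"
  by (auto simp: frag_chain_def add.int_pow_neg)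

lemma frag_chain_diff: "frag_chain (c - d) = (\<lambda>s. frag_chain c s \<ominus> frag_chain d s)"
  by (auto simp: frag_chain_def lookup_minus add.int_pow_diff a_minus_def)

lemma frag_chain_of: "frag_chain (frag_of s) = (\<lambda>t. if t = s then \<one> else \<zero>)"
proof -
  have "[(1::int)] \<cdot> \<one> = \<one>" "[(0::int)] \<cdot> \<one> = \<zero>"
    by (simp_all add: add_pow_def int_pow_def2)
  then show ?thesis
    by (auto simp: frag_chain_def)
qed

lemma frag_chain_carrier [simp]: "frag_chain c s \<in> carrier R"
  by (simp add: frag_chain_def)

lemma frag_chain_of_closed:
  assumes "singular_simplex n X s"
  shows "frag_chain (frag_of s) \<in> carrier (chain_module R n X)"
proof -
  have "{t. frag_chain (frag_of s) t \<noteq> \<zero>} \<subseteq> {s}"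
    by (auto simp: frag_chain_of)
  then show ?thesis
    using assms unfolding chain_carrier_iff by (auto intro: finite_subset)
qed

lemma frag_chain_closed:
  assumes "singular_chain n X c"
  shows "frag_chain c \<in> carrier (chain_module R n X)"
proof -
  have "{t. frag_chain c t \<noteq> \<zero>} \<subseteq> Poly_Mapping.keys c"
    by (auto simp: frag_chain_def in_keys_iff add_pow_def)
  then show ?thesis
    using assms unfolding chain_carrier_iff singular_chain_def
    by (auto intro: finite_subset)
qed

lemma frag_chain_finite: "finite {s. frag_chain c s \<noteq> \<zero>}"
proof (rule finite_subset)
  show "{s. frag_chain c s \<noteq> \<zero>} \<subseteq> Poly_Mapping.keys c"
    by (auto simp: frag_chain_def in_keys_iff add_pow_def)
qed simp

text \<open>Removing one simplex lowers the size of the support. As boundary and pairing are linear,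
  this reduces their properties to single simplices, hence to integral chains.\<close>

lemma chain_induct [consumes 1, case_names zero add]:
  assumes "c \<in> carrier (chain_module R n X)"
    and "P (\<lambda>s. \<zero>)"
    and "\<And>c r s. c \<in> carrier (chain_module R n X) \<Longrightarrow> P c \<Longrightarrow> r \<in> carrier R \<Longrightarrow>
           singular_simplex n X s \<Longrightarrow> P (\<lambda>t. c t \<oplus> r \<otimes> frag_chain (frag_of s) t)"
  shows "P c"
  using assms(1)
proof (induction "card {s. c s \<noteq> \<zero>}" arbitrary: c)
  case 0
  then have "{s. c s \<noteq> \<zero>} = {}"
    by (simp add: chain_carrier_iff)
  then have "c = (\<lambda>s. \<zero>)" by auto
  then show ?case using assms(2) by simp
next
  case (Suc m)
  then obtain s where s: "c s \<noteq> \<zero>"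
    by (metis (mono_tags, lifting) card_eq_0_iff empty_Collect_eq nat.distinct(1))
  define d where "d = c(s := \<zero>)"
  have dd: "{t. d t \<noteq> \<zero>} = {t. c t \<noteq> \<zero>} - {s}"
    by (auto simp: d_def)
  have fin: "finite {t. c t \<noteq> \<zero>}" and car: "\<And>t. c t \<in> carrier R"
    and sx: "{t. c t \<noteq> \<zero>} \<subseteq> singular_simplex_set n X"
    using Suc.prems by (auto simp: chain_carrier_iff)
  have "m = card {t. d t \<noteq> \<zero>}"
    using Suc.hyps(2) s fin unfolding dd by (subst card_Diff_singleton) auto
  moreover have dC: "d \<in> carrier (chain_module R n X)"
    using fin car sx dd by (auto simp: chain_carrier_iff d_def)
  ultimately have "P d" using Suc.hyps(1) by blast
  then have "P (\<lambda>t. d t \<oplus> c s \<otimes> frag_chain (frag_of s) t)"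
    using assms(3)[OF dC _ car] s sx by blast
  moreover have "(\<lambda>t. d t \<oplus> c s \<otimes> frag_chain (frag_of s) t) = c"
    using car by (auto simp: d_def frag_chain_of)
  ultimately show ?case by simp
qed

text \<open>The Kronecker pairing of the cochain \<open>\<delta>\<close> with the chain
  \<open>c\<close>.\<close>

definition chain_pair :: "('s \<Rightarrow> 'a) \<Rightarrow> ('s \<Rightarrow> 'a) \<Rightarrow> 'a" where
  "chain_pair \<delta> c = (\<Oplus>s\<in>{s. c s \<noteq> \<zero>}. c s \<otimes> \<delta> s)"

lemma chain_pair_superset:
  assumes "finite A" "{s. c s \<noteq> \<zero>} \<subseteq> A" "\<And>s. c s \<in> carrier R" "\<And>s. \<delta> s \<in> carrier R"
  shows "chain_pair \<delta> c = (\<Oplus>s\<in>A. c s \<otimes> \<delta> s)"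
  unfolding chain_pair_def
  by (rule add.finprod_mono_neutral_cong_left) (use assms in auto)

lemma chain_pair_closed:
  assumes "\<And>s. c s \<in> carrier R" "\<And>s. \<delta> s \<in> carrier R"
  shows "chain_pair \<delta> c \<in> carrier R"
  unfolding chain_pair_def using assms by (auto intro!: finsum_closed)

lemma chain_pair_zero [simp]: "chain_pair \<delta> (\<lambda>s. \<zero>) = \<zero>"
  by (simp add: chain_pair_def)

lemma chain_pair_add:
  assumes c: "\<And>s. c s \<in> carrier R" "finite {s. c s \<noteq> \<zero>}"
    and d: "\<And>s. d s \<in> carrier R" "finite {s. d s \<noteq> \<zero>}" and e: "\<And>s. \<delta> s \<in> carrier R"
  shows "chain_pair \<delta> (\<lambda>s. c s \<oplus> d s) = chain_pair \<delta> c \<oplus> chain_pair \<delta> d"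
proof -
  let ?A = "{s. c s \<noteq> \<zero>} \<union> {s. d s \<noteq> \<zero>}"
  have f: "finite ?A" using assms by auto
  have "chain_pair \<delta> (\<lambda>s. c s \<oplus> d s) = (\<Oplus>s\<in>?A. (c s \<oplus> d s) \<otimes> \<delta> s)"
    by (rule chain_pair_superset) (use assms in auto)
  also have "\<dots> = (\<Oplus>s\<in>?A. c s \<otimes> \<delta> s \<oplus> d s \<otimes> \<delta> s)"
    by (rule finsum_cong') (use c d e in \<open>auto simp: l_distr\<close>)
  also have "\<dots> = (\<Oplus>s\<in>?A. c s \<otimes> \<delta> s) \<oplus> (\<Oplus>s\<in>?A. d s \<otimes> \<delta> s)"
    by (rule finsum_addf) (use c d e in auto)
  also have "(\<Oplus>s\<in>?A. c s \<otimes> \<delta> s) = chain_pair \<delta> c"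
    by (rule chain_pair_superset[symmetric]) (use assms in auto)
  also have "(\<Oplus>s\<in>?A. d s \<otimes> \<delta> s) = chain_pair \<delta> d"
    by (rule chain_pair_superset[symmetric]) (use assms in auto)
  finally show ?thesis .
qed

lemma chain_pair_smult:
  assumes c: "\<And>s. c s \<in> carrier R" "finite {s. c s \<noteq> \<zero>}"
    and e: "\<And>s. \<delta> s \<in> carrier R" and r: "r \<in> carrier R"
  shows "chain_pair \<delta> (\<lambda>s. r \<otimes> c s) = r \<otimes> chain_pair \<delta> c"
proof -
  let ?A = "{s. c s \<noteq> \<zero>}"
  have "chain_pair \<delta> (\<lambda>s. r \<otimes> c s) = (\<Oplus>s\<in>?A. (r \<otimes> c s) \<otimes> \<delta> s)"
    by (rule chain_pair_superset) (use assms in auto)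
  also have "\<dots> = (\<Oplus>s\<in>?A. r \<otimes> (c s \<otimes> \<delta> s))"
    by (rule finsum_cong') (use c r e in \<open>auto simp: m_assoc\<close>)
  also have "\<dots> = r \<otimes> (\<Oplus>s\<in>?A. c s \<otimes> \<delta> s)"
    by (rule finsum_rdistr[symmetric]) (use c r e in auto)
  finally show ?thesis by (simp add: chain_pair_def)
qed

lemma chain_pair_of:
  assumes "\<And>s. \<delta> s \<in> carrier R" "\<one> \<noteq> \<zero>"
  shows "chain_pair \<delta> (frag_chain (frag_of s)) = \<delta> s"
proof -
  have "{t. frag_chain (frag_of s) t \<noteq> \<zero>} = {s}"
    using assms by (auto simp: frag_chain_of)
  then show ?thesis
    using assms by (simp add: chain_pair_def frag_chain_of)
qed

text \<open>Linear extension of a map \<open>g\<close> from simplices to chains, taken one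
  coefficient at a time.\<close>

definition chain_ext :: "('s \<Rightarrow> 't \<Rightarrow> 'a) \<Rightarrow> ('s \<Rightarrow> 'a) \<Rightarrow> 't \<Rightarrow> 'a" where
  "chain_ext g c = (\<lambda>t. chain_pair (\<lambda>s. g s t) c)"

text \<open>In \<open>chain_bd\<close> the index set depends on the support of \<open>c\<close> and
  on \<open>t\<close>. Over a fixed finite index set the summands are linear in \<open>c\<close>;
  additivity and scaling of the boundary rest on this.\<close>

lemma chain_bd_superset:
  assumes "n > 0" "finite A" "{s. c s \<noteq> \<zero>} \<subseteq> A" "\<And>s. c s \<in> carrier R"
  shows "chain_bd R n c t =
    finsum R (\<lambda>(s, k). if singular_face n k s = t then (if even k then c s else \<ominus> c s) else \<zero>) (A \<times> {..n})"
proof -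
  have "chain_bd R n c t = (\<Oplus>sk\<in>{(s, k). c s \<noteq> \<zero> \<and> k \<le> n \<and> singular_face n k s = t}.
                  if even (snd sk) then c (fst sk) else \<ominus> c (fst sk))"
    using assms(1) by (simp add: chain_bd_def)
  also have "\<dots> = finsum R (\<lambda>(s, k). if singular_face n k s = t then (if even k then c s else \<ominus> c s) else \<zero>) (A \<times> {..n})"
    by (rule add.finprod_mono_neutral_cong_left) (use assms in \<open>auto split: if_splits\<close>)
  finally show ?thesis .
qed

lemma chain_bd_carrier:
  assumes "\<And>s. c s \<in> carrier R"
  shows "chain_bd R n c t \<in> carrier R"
  using assms by (auto simp: chain_bd_def intro!: finsum_closed)

lemma chain_bd_zero: "chain_bd R n (\<lambda>s. \<zero>) = (\<lambda>t. \<zero>)"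
  by (auto simp: chain_bd_def)

lemma chain_bd_add:
  fixes c d :: "((nat \<Rightarrow> real) \<Rightarrow> 'z) \<Rightarrow> 'a"
  assumes c: "\<And>s. c s \<in> carrier R" "finite {s. c s \<noteq> \<zero>}"
    and d: "\<And>s. d s \<in> carrier R" "finite {s. d s \<noteq> \<zero>}"
  shows "chain_bd R n (\<lambda>s. c s \<oplus> d s) = (\<lambda>t. chain_bd R n c t \<oplus> chain_bd R n d t)"
proof (cases "n = 0")
  case True
  then show ?thesis by (auto simp: chain_bd_def)
next
  case False
  show ?thesis
  proof
    fix t :: "(nat \<Rightarrow> real) \<Rightarrow> 'z"
    let ?A = "{s. c s \<noteq> \<zero>} \<union> {s. d s \<noteq> \<zero>}"
    let ?h = "\<lambda>c (s, k). if singular_face n k s = t then (if even k then c s else \<ominus> c s) else \<zero>"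
    have f: "finite ?A" using assms by auto
    have "chain_bd R n (\<lambda>s. c s \<oplus> d s) t = (\<Oplus>x\<in>?A \<times> {..n}. ?h (\<lambda>s. c s \<oplus> d s) x)"
      by (rule chain_bd_superset) (use False assms in auto)
    also have "\<dots> = (\<Oplus>x\<in>?A \<times> {..n}. ?h c x \<oplus> ?h d x)"
      by (rule finsum_cong') (use c d in \<open>auto simp: minus_add\<close>)
    also have "\<dots> = (\<Oplus>x\<in>?A \<times> {..n}. ?h c x) \<oplus> (\<Oplus>x\<in>?A \<times> {..n}. ?h d x)"
      by (rule finsum_addf) (use c d in auto)
    also have "(\<Oplus>x\<in>?A \<times> {..n}. ?h c x) = chain_bd R n c t"
      by (rule chain_bd_superset[symmetric]) (use False assms in auto)
    also have "(\<Oplus>x\<in>?A \<times> {..n}. ?h d x) = chain_bd R n d t"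
      by (rule chain_bd_superset[symmetric]) (use False assms in auto)
    finally show "chain_bd R n (\<lambda>s. c s \<oplus> d s) t = chain_bd R n c t \<oplus> chain_bd R n d t" .
  qed
qed

lemma chain_bd_smult:
  fixes c :: "((nat \<Rightarrow> real) \<Rightarrow> 'z) \<Rightarrow> 'a"
  assumes c: "\<And>s. c s \<in> carrier R" "finite {s. c s \<noteq> \<zero>}" and r: "r \<in> carrier R"
  shows "chain_bd R n (\<lambda>s. r \<otimes> c s) = (\<lambda>t. r \<otimes> chain_bd R n c t)"
proof (cases "n = 0")
  case True
  then show ?thesis using r by (auto simp: chain_bd_def)
next
  case False
  show ?thesis
  proof
    fix t :: "(nat \<Rightarrow> real) \<Rightarrow> 'z"
    let ?A = "{s. c s \<noteq> \<zero>}"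
    let ?h = "\<lambda>c (s, k). if singular_face n k s = t then (if even k then c s else \<ominus> c s) else \<zero>"
    have "chain_bd R n (\<lambda>s. r \<otimes> c s) t = (\<Oplus>x\<in>?A \<times> {..n}. ?h (\<lambda>s. r \<otimes> c s) x)"
      by (rule chain_bd_superset) (use False assms in auto)
    also have "\<dots> = (\<Oplus>x\<in>?A \<times> {..n}. r \<otimes> ?h c x)"
      by (rule finsum_cong') (use c r in \<open>auto simp: r_minus\<close>)
    also have "\<dots> = r \<otimes> (\<Oplus>x\<in>?A \<times> {..n}. ?h c x)"
      by (rule finsum_rdistr[symmetric]) (use c r in auto)
    also have "(\<Oplus>x\<in>?A \<times> {..n}. ?h c x) = chain_bd R n c t"
      by (rule chain_bd_superset[symmetric]) (use False assms in auto)
    finally show "chain_bd R n (\<lambda>s. r \<otimes> c s) t = r \<otimes> chain_bd R n c t" .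
  qed
qed

end

section \<open>Homology as a quotient vector space, and an upper bound for its dimension\<close>

section \<open>Homology as a vector space\<close>

text \<open>\<open>Q\<close> is pinned down through its additive and scalar parts only, since the
  multiplication of \<open>homology\<close> is unspecified. The operations descend to cosets because
  \<open>B\<close> is an additive subgroup stable under scalars; the rules for representatives are
  exported along with the module structure.\<close>

lemma (in module) quotient_module:
  fixes B and Q :: "('a, 'c set) module"
  assumes sub: "subgroup B (add_monoid M)"
    and smB: "\<And>r b. r \<in> carrier R \<Longrightarrow> b \<in> B \<Longrightarrow> r \<odot>\<^bsub>M\<^esub> b \<in> B"
    and Q: "carrier Q = A_RCOSETS M B" "zero Q = B" "add Q = set_add M"
      "smult Q = (\<lambda>r U. \<Union>c\<in>U. a_r_coset M B (r \<odot>\<^bsub>M\<^esub> c))"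
  shows "module R Q"
    and "carrier Q = (\<lambda>c. a_r_coset M B c) ` carrier M"
    and "\<And>c d. c \<in> carrier M \<Longrightarrow> d \<in> carrier M \<Longrightarrow> (a_r_coset M B c) \<oplus>\<^bsub>Q\<^esub> (a_r_coset M B d) = a_r_coset M B (c \<oplus>\<^bsub>M\<^esub> d)"
    and "\<And>r c. r \<in> carrier R \<Longrightarrow> c \<in> carrier M \<Longrightarrow> r \<odot>\<^bsub>Q\<^esub> (a_r_coset M B c) = a_r_coset M B (r \<odot>\<^bsub>M\<^esub> c)"
    and "a_r_coset M B \<zero>\<^bsub>M\<^esub> = \<zero>\<^bsub>Q\<^esub>"
    and "\<And>c d. c \<in> carrier M \<Longrightarrow> d \<in> a_r_coset M B c \<Longrightarrow> \<exists>b\<in>B. d = b \<oplus>\<^bsub>M\<^esub> c"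
    and "\<And>c. c \<in> carrier M \<Longrightarrow> c \<in> a_r_coset M B c"
    and "\<And>c. c \<in> B \<Longrightarrow> a_r_coset M B c = \<zero>\<^bsub>Q\<^esub>"
proof -
  have "additive_subgroup B M"
    using sub by (rule additive_subgroup.intro)
  then have "abelian_subgroup B M"
    by (rule abelian_subgroupI3) (rule M.abelian_group_axioms)
  then interpret S: abelian_subgroup B M .
  have BM: "B \<subseteq> carrier M" by (rule S.a_subset)
  have el: "\<exists>b\<in>B. d = b \<oplus>\<^bsub>M\<^esub> c" if "d \<in> a_r_coset M B c" for c d
    using that by (auto simp: a_r_coset_def')
  show el': "\<exists>b\<in>B. d = b \<oplus>\<^bsub>M\<^esub> c" if "c \<in> carrier M" "d \<in> a_r_coset M B c" for c d
    using that(2) by (rule el)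
  show self: "c \<in> a_r_coset M B c" if "c \<in> carrier M" for c
    using that by (rule S.a_rcos_self)
  have eqI: "a_r_coset M B (b \<oplus>\<^bsub>M\<^esub> c) = a_r_coset M B c" if "b \<in> B" "c \<in> carrier M" for b c
    using that S.a_repr_independence'[of "b \<oplus>\<^bsub>M\<^esub> c" c] BM by (auto simp: a_r_coset_def')
  show car: "carrier Q = (\<lambda>c. a_r_coset M B c) ` carrier M"
    unfolding Q by (auto simp: A_RCOSETS_def')
  show add: "(a_r_coset M B c) \<oplus>\<^bsub>Q\<^esub> (a_r_coset M B d) = a_r_coset M B (c \<oplus>\<^bsub>M\<^esub> d)" if "c \<in> carrier M" "d \<in> carrier M" for c d
    unfolding Q using that by (rule S.a_rcos_sum)
  show sm: "r \<odot>\<^bsub>Q\<^esub> (a_r_coset M B c) = a_r_coset M B (r \<odot>\<^bsub>M\<^esub> c)" if r: "r \<in> carrier R" and c: "c \<in> carrier M" for r c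
  proof -
    \<comment> \<open>The scalar action is a union over all representatives. By stability of
      \<open>B\<close> each of them contributes the same coset, so the union is that coset.\<close>
    have "a_r_coset M B (r \<odot>\<^bsub>M\<^esub> d) = a_r_coset M B (r \<odot>\<^bsub>M\<^esub> c)" if dd: "d \<in> a_r_coset M B c" for d
    proof -
      obtain b where b: "b \<in> B" "d = b \<oplus>\<^bsub>M\<^esub> c" using el[OF dd] by blast
      then have bM: "b \<in> carrier M" using BM by blast
      have "r \<odot>\<^bsub>M\<^esub> d = r \<odot>\<^bsub>M\<^esub> b \<oplus>\<^bsub>M\<^esub> r \<odot>\<^bsub>M\<^esub> c"
        unfolding b(2) by (rule smult_r_distr[OF r bM c])
      then show ?thesis
        using eqI[OF smB[OF r b(1)] smult_closed[OF r c]] by (simp only:)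
    qed
    then have "(\<Union>d\<in>a_r_coset M B c. a_r_coset M B (r \<odot>\<^bsub>M\<^esub> d)) =
        (\<Union>d\<in>a_r_coset M B c. a_r_coset M B (r \<odot>\<^bsub>M\<^esub> c))"
      by (rule SUP_cong[OF refl])
    also have "\<dots> = a_r_coset M B (r \<odot>\<^bsub>M\<^esub> c)"
      using self[OF c] by (subst cSUP_const) auto
    finally show ?thesis unfolding Q .
  qed
  show z: "a_r_coset M B \<zero>\<^bsub>M\<^esub> = \<zero>\<^bsub>Q\<^esub>"
    unfolding Q using BM by (rule M.a_coset_add_zero)
  show "a_r_coset M B c = \<zero>\<^bsub>Q\<^esub>" if "c \<in> B" for c
    using eqI[of c "\<zero>\<^bsub>M\<^esub>"] that z BM by auto
  show "module R Q"
  proof (rule moduleI)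
    show "cring R" by (rule R.is_cring)
    show "abelian_group Q"
    proof (rule abelian_groupI)
      show "\<zero>\<^bsub>Q\<^esub> \<in> carrier Q" using z car by (metis M.zero_closed image_eqI)
    next
      fix x assume "x \<in> carrier Q"
      then obtain c where c: "c \<in> carrier M" "x = a_r_coset M B c" using car by auto
      have ic: "\<ominus>\<^bsub>M\<^esub> c \<in> carrier M" using c(1) by (rule M.a_inv_closed)
      have "a_r_coset M B (\<ominus>\<^bsub>M\<^esub> c) \<oplus>\<^bsub>Q\<^esub> x = \<zero>\<^bsub>Q\<^esub>"
        unfolding c(2) add[OF ic c(1)] M.l_neg[OF c(1)] by (rule z)
      moreover have "a_r_coset M B (\<ominus>\<^bsub>M\<^esub> c) \<in> carrier Q"
        unfolding car using ic by (rule imageI)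
      ultimately show "\<exists>y\<in>carrier Q. y \<oplus>\<^bsub>Q\<^esub> x = \<zero>\<^bsub>Q\<^esub>" by (rule bexI)
      show "\<zero>\<^bsub>Q\<^esub> \<oplus>\<^bsub>Q\<^esub> x = x"
        using c add[of "\<zero>\<^bsub>M\<^esub>" c] z by simp
    next
      fix x y assume "x \<in> carrier Q" "y \<in> carrier Q"
      then obtain c d where cd: "c \<in> carrier M" "x = a_r_coset M B c" "d \<in> carrier M" "y = a_r_coset M B d"
        using car by auto
      then show "x \<oplus>\<^bsub>Q\<^esub> y \<in> carrier Q" "x \<oplus>\<^bsub>Q\<^esub> y = y \<oplus>\<^bsub>Q\<^esub> x"
        using M.a_comm[of c d] by (auto simp: add car)
      fix z assume "z \<in> carrier Q"
      then obtain e where e: "e \<in> carrier M" "z = a_r_coset M B e"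
        using car by auto
      show "x \<oplus>\<^bsub>Q\<^esub> y \<oplus>\<^bsub>Q\<^esub> z = x \<oplus>\<^bsub>Q\<^esub> (y \<oplus>\<^bsub>Q\<^esub> z)"
        using cd e by (simp add: add M.a_assoc)
    qed
  qed (auto simp: car add sm smult_l_distr smult_r_distr smult_assoc1)
qed

context field
begin

lemma frag_chain_sum:
  assumes "finite A"
  shows "frag_chain (sum f A) t = (\<Oplus>a\<in>A. frag_chain (f a) t)"
  using assms
  by (induction A) (auto simp: frag_chain_add)

text \<open>Both boundaries sum over the same faces; the signs (-1)^k of the integral one become
  \<open>\<one>\<close> and \<open>\<ominus> \<one>\<close> in \<open>R\<close>.\<close>

lemma chain_bd_of:
  assumes "n > 0"
  shows "chain_bd R n (frag_chain (frag_of s)) = frag_chain (chain_boundary n (frag_of s))"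
proof
  fix t
  have e: "frag_chain (frag_cmul ((-1) ^ k) (frag_of (singular_face n k s))) t =
     (if singular_face n k s = t then if even k then \<one> else \<ominus> \<one> else \<zero>)" for k
    by (cases "even k") (auto simp: frag_chain_of frag_chain_uminus)
  have "chain_bd R n (frag_chain (frag_of s)) t =
     finsum R (\<lambda>(s', k). if singular_face n k s' = t then (if even k then frag_chain (frag_of s) s'
        else \<ominus> frag_chain (frag_of s) s') else \<zero>) ({s} \<times> {..n})"
    by (rule chain_bd_superset) (use assms in \<open>auto simp: frag_chain_of\<close>)
  also have "{s} \<times> {..n} = Pair s ` {..n}" by auto
  also have "finsum R (\<lambda>(s', k). if singular_face n k s' = t then (if even k then frag_chain (frag_of s) s'
        else \<ominus> frag_chain (frag_of s) s') else \<zero>) (Pair s ` {..n}) =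
     (\<Oplus>k\<in>{..n}. if singular_face n k s = t then if even k then \<one> else \<ominus> \<one> else \<zero>)"
    by (subst finsum_reindex) (auto simp: inj_on_def frag_chain_of intro!: finsum_cong')
  also have "\<dots> = (\<Oplus>k\<in>{..n}. frag_chain (frag_cmul ((-1) ^ k) (frag_of (singular_face n k s))) t)"
    by (simp only: e)
  also have "\<dots> = frag_chain (chain_boundary n (frag_of s)) t"
    using assms by (simp add: chain_boundary_of frag_chain_sum del: sum.atMost_Suc)
  finally show "chain_bd R n (frag_chain (frag_of s)) t = frag_chain (chain_boundary n (frag_of s)) t" .
qed

lemma chain_carrierD:
  assumes "c \<in> carrier (chain_module R n X)"
  shows "c s \<in> carrier R" "finite {s. c s \<noteq> \<zero>}"
  using assms by (auto simp: chain_carrier_iff)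

lemma chain_bd_add_smult:
  assumes "c \<in> carrier (chain_module R n X)" "d \<in> carrier (chain_module R n X)" "r \<in> carrier R"
  shows "chain_bd R n (\<lambda>s. c s \<oplus> r \<otimes> d s) = (\<lambda>t. chain_bd R n c t \<oplus> r \<otimes> chain_bd R n d t)"
proof -
  have "(\<lambda>s. r \<otimes> d s) \<in> carrier (chain_module R n X)"
    using assms chain_smult_closed by blast
  then show ?thesis
    using assms by (simp add: chain_bd_add chain_bd_smult chain_carrierD)
qed

lemma chain_bd_closed:
  assumes "c \<in> carrier (chain_module R (Suc n) X)"
  shows "chain_bd R (Suc n) c \<in> carrier (chain_module R n X)"
  using assms
proof (induction rule: chain_induct)
  case zero
  then show ?case by (simp add: chain_bd_zero chain_zero_closed)
next
  case (add c r s)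
  have "singular_chain n X (chain_boundary (Suc n) (frag_of s))"
    using singular_chain_boundary[of "Suc n" X "frag_of s"] add by (simp add: singular_chain_of)
  then show ?case
    using add frag_chain_of_closed[OF add(3)]
    by (simp add: chain_bd_add_smult chain_add_closed chain_smult_closed chain_bd_of frag_chain_closed)
qed

lemma chain_bd_frag_chain:
  assumes "singular_chain n X c" "n > 0"
  shows "chain_bd R n (frag_chain c) = frag_chain (chain_boundary n c)"
  using assms(1) unfolding singular_chain_def
proof (induction rule: frag_induction)
  case zero
  then show ?case by (simp add: chain_bd_zero)
next
  case (one s)
  then show ?case using assms by (simp add: chain_bd_of)
next
  case (diff a b)
  have fm: "finite {s. \<ominus> frag_chain b s \<noteq> \<zero>}"
    by (rule finite_subset[OF _ frag_chain_finite[of b]]) auto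
  have m: "(\<lambda>s. \<ominus> frag_chain b s) = (\<lambda>s. (\<ominus> \<one>) \<otimes> frag_chain b s)"
    by (auto simp: l_minus)
  have "chain_bd R n (\<lambda>s. \<ominus> frag_chain b s) = (\<lambda>t. \<ominus> chain_bd R n (frag_chain b) t)"
    unfolding m by (subst chain_bd_smult) (auto simp: l_minus frag_chain_finite chain_bd_carrier)
  then have "chain_bd R n (\<lambda>s. frag_chain a s \<oplus> \<ominus> frag_chain b s) =
      (\<lambda>t. chain_bd R n (frag_chain a) t \<oplus> \<ominus> chain_bd R n (frag_chain b) t)"
    by (subst chain_bd_add) (use frag_chain_finite fm in auto)
  then show ?case
    using diff
    by (simp add: frag_chain_diff a_minus_def chain_boundary_diff)
qed

text \<open>On a single simplex this is the integral identity seen through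
  \<open>frag_chain\<close>; linearity does the rest.\<close>

lemma chain_bd_bd:
  assumes "c \<in> carrier (chain_module R (Suc n) X)"
  shows "chain_bd R n (chain_bd R (Suc n) c) = (\<lambda>t. \<zero>)"
proof (cases "n = 0")
  case True
  then show ?thesis by (simp add: chain_bd_def)
next
  case False
  show ?thesis
    using assms
  proof (induction rule: chain_induct)
    case zero
    then show ?case by (simp add: chain_bd_zero)
  next
    case (add c r s)
    have sc: "singular_chain (Suc n) X (frag_of s)"
      using add by (simp add: singular_chain_of)
    then have s: "singular_chain n X (chain_boundary (Suc n) (frag_of s))"
      using singular_chain_boundary[of "Suc n" X "frag_of s"] by simp
    have "chain_bd R n (frag_chain (chain_boundary (Suc n) (frag_of s))) = (\<lambda>t. \<zero>)"
      using chain_bd_frag_chain[OF s] False chain_boundary_boundary_alt[OF sc] by simp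
    then show ?case
      using add frag_chain_of_closed[OF add(3)] frag_chain_closed[OF s]
      by (simp add: chain_bd_add_smult[where X = X] chain_bd_closed chain_bd_of)
  qed
qed

text \<open>Such subspaces serve as test objects: whether given cycles span homology is decided by
  whether the subspaces through them contain all cycles. Negation is scaling by
  \<open>\<ominus> \<one>\<close>.\<close>

definition chain_subspace :: "nat \<Rightarrow> 'e topology \<Rightarrow> (((nat \<Rightarrow> real) \<Rightarrow> 'e) \<Rightarrow> 'a) set \<Rightarrow> bool" where
  "chain_subspace n X W \<longleftrightarrow> W \<subseteq> carrier (chain_module R n X) \<and> (\<lambda>s. \<zero>) \<in> W \<and>
     (\<forall>c\<in>W. \<forall>d\<in>W. (\<lambda>s. c s \<oplus> d s) \<in> W) \<and> (\<forall>r\<in>carrier R. \<forall>c\<in>W. (\<lambda>s. r \<otimes> c s) \<in> W)"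

lemma chain_subspace_submodule:
  assumes "chain_subspace n X W"
  shows "Module.submodule W R (chain_module R n X)"
proof -
  interpret C: module R "chain_module R n X" by (rule chain_module_module)
  show ?thesis
  proof (rule C.submoduleI)
    fix c assume c: "c \<in> W"
    then have cC: "c \<in> carrier (chain_module R n X)" using assms by (auto simp: chain_subspace_def)
    have "(\<lambda>s. \<ominus> c s) = (\<lambda>s. (\<ominus> \<one>) \<otimes> c s)"
      using cC by (auto simp: chain_carrier_iff l_minus)
    then show "\<ominus>\<^bsub>chain_module R n X\<^esub> c \<in> W"
      using c assms chain_a_inv[OF cC] by (auto simp: chain_subspace_def)
  qed (use assms in \<open>auto simp: chain_subspace_def\<close>)
qed

lemma cycles_subspace: "chain_subspace n X (cycles R n X)"
  by (auto simp: chain_subspace_def cycles_def chain_zero_closed chain_bd_zero chain_add_closed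
      chain_smult_closed chain_bd_add chain_bd_smult chain_carrierD)

lemma boundaries_subspace: "chain_subspace n X (boundaries R n X)"
  unfolding chain_subspace_def
proof (intro conjI ballI)
  show "boundaries R n X \<subseteq> carrier (chain_module R n X)"
    by (auto simp: boundaries_def chain_bd_closed)
  show "(\<lambda>s. \<zero>) \<in> boundaries R n X"
    unfolding boundaries_def
    by (rule image_eqI[OF _ chain_zero_closed]) (simp add: chain_bd_zero)
next
  fix c d assume "c \<in> boundaries R n X" "d \<in> boundaries R n X"
  then obtain c' d' where *: "c' \<in> carrier (chain_module R (Suc n) X)" "c = chain_bd R (Suc n) c'"
     "d' \<in> carrier (chain_module R (Suc n) X)" "d = chain_bd R (Suc n) d'"
    by (auto simp: boundaries_def)
  show "(\<lambda>s. c s \<oplus> d s) \<in> boundaries R n X"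
    unfolding boundaries_def
    by (rule image_eqI[of _ _ "\<lambda>s. c' s \<oplus> d' s"])
      (use * in \<open>auto simp: chain_bd_add chain_carrierD chain_add_closed\<close>)
next
  fix r c assume r: "r \<in> carrier R" and "c \<in> boundaries R n X"
  then obtain c' where *: "c' \<in> carrier (chain_module R (Suc n) X)" "c = chain_bd R (Suc n) c'"
    by (auto simp: boundaries_def)
  show "(\<lambda>s. r \<otimes> c s) \<in> boundaries R n X"
    unfolding boundaries_def
    by (rule image_eqI[of _ _ "\<lambda>s. r \<otimes> c' s"])
      (use * r in \<open>auto simp: chain_bd_smult chain_carrierD chain_smult_closed\<close>)
qed

lemma boundaries_subset_cycles: "boundaries R n X \<subseteq> cycles R n X"
  by (auto simp: boundaries_def cycles_def chain_bd_closed chain_bd_bd)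

definition hom_class :: "nat \<Rightarrow> 'e topology \<Rightarrow> (((nat \<Rightarrow> real) \<Rightarrow> 'e) \<Rightarrow> 'a)
    \<Rightarrow> (((nat \<Rightarrow> real) \<Rightarrow> 'e) \<Rightarrow> 'a) set" where
  "hom_class n X c = boundaries R n X +>\<^bsub>chain_module R n X\<^esub> c"

lemma
  shows homology_vectorspace: "vectorspace R (homology R n X)"
    and homology_carrier: "carrier (homology R n X) = hom_class n X ` cycles R n X"
    and hom_class_add: "\<And>c d. c \<in> cycles R n X \<Longrightarrow> d \<in> cycles R n X \<Longrightarrow>
       hom_class n X c \<oplus>\<^bsub>homology R n X\<^esub> hom_class n X d = hom_class n X (\<lambda>s. c s \<oplus> d s)"
    and hom_class_smult: "\<And>r c. r \<in> carrier R \<Longrightarrow> c \<in> cycles R n X \<Longrightarrow>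
       r \<odot>\<^bsub>homology R n X\<^esub> hom_class n X c = hom_class n X (\<lambda>s. r \<otimes> c s)"
    and hom_class_zero: "hom_class n X (\<lambda>s. \<zero>) = \<zero>\<^bsub>homology R n X\<^esub>"
    and hom_class_boundary: "\<And>c. c \<in> boundaries R n X \<Longrightarrow> hom_class n X c = \<zero>\<^bsub>homology R n X\<^esub>"
    and hom_class_elem: "\<And>c d. c \<in> cycles R n X \<Longrightarrow> d \<in> hom_class n X c \<Longrightarrow>
       \<exists>b\<in>boundaries R n X. d = (\<lambda>s. b s \<oplus> c s)"
    and hom_class_self: "\<And>c. c \<in> cycles R n X \<Longrightarrow> c \<in> hom_class n X c"
proof -
  let ?C = "chain_module R n X"
  let ?Z = "cycles R n X"
  let ?B = "boundaries R n X"
  let ?M = "?C\<lparr>carrier := ?Z\<rparr>"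
  interpret C: module R ?C by (rule chain_module_module)
  interpret M: module R ?M
    by (rule submodule.submodule_is_module[OF chain_subspace_submodule[OF cycles_subspace]])
      (rule chain_module_module)
  \<comment> \<open>The additive inverse is defined relative to a carrier, so restricting the
    carrier to the cycles requires an argument.\<close>
  have minv: "\<ominus>\<^bsub>?M\<^esub> c = \<ominus>\<^bsub>?C\<^esub> c" if "c \<in> ?Z" for c
  proof (rule M.minus_equality)
    have s: "Module.submodule ?Z R ?C" by (rule chain_subspace_submodule[OF cycles_subspace])
    have cC: "c \<in> carrier ?C" using that by (simp add: cycles_def)
    show "\<ominus>\<^bsub>?C\<^esub> c \<oplus>\<^bsub>?M\<^esub> c = \<zero>\<^bsub>?M\<^esub>"
      using C.l_neg[OF cC] by simp
    show "c \<in> carrier ?M" using that by simp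
    show "\<ominus>\<^bsub>?C\<^esub> c \<in> carrier ?M" using C.submoduleE(3)[OF s] that by simp
  qed
  have subg: "subgroup ?B (add_monoid ?M)"
  proof -
    have s: "Module.submodule ?B R ?C" by (rule chain_subspace_submodule[OF boundaries_subspace])
    have "Module.submodule ?B R ?M"
    proof (rule M.submoduleI)
      show "?B \<subseteq> carrier ?M" using boundaries_subset_cycles by simp
      show "\<zero>\<^bsub>?M\<^esub> \<in> ?B" using boundaries_subspace[of n X] by (simp add: chain_subspace_def)
      show "\<ominus>\<^bsub>?M\<^esub> a \<in> ?B" if "a \<in> ?B" for a
      proof -
        have "a \<in> cycles R n X" using that boundaries_subset_cycles by (rule subsetD[rotated])
        then show ?thesis using minv[of a] C.submoduleE(3)[OF s that] by simp
      qed
    qed (use boundaries_subspace[of n X] in \<open>auto simp: chain_subspace_def\<close>)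
    then show ?thesis by (rule Module.submodule.axioms(1))
  qed
  have rc: "a_r_coset ?M = a_r_coset ?C"
    by (intro ext) (simp add: a_r_coset_def r_coset_def)
  have sa: "set_add ?M = set_add ?C"
    by (intro ext) (simp add: set_add_def set_mult_def)
  have Q: "carrier (homology R n X) = a_rcosets\<^bsub>?M\<^esub> ?B" "zero (homology R n X) = ?B"
     "add (homology R n X) = (\<lambda>U V. U <+>\<^bsub>?M\<^esub> V)"
     "smult (homology R n X) = (\<lambda>r U. \<Union>c\<in>U. ?B +>\<^bsub>?M\<^esub> (r \<odot>\<^bsub>?M\<^esub> c))"
    by (simp_all add: homology_def Let_def rc sa)
  have smB: "\<And>r b. r \<in> carrier R \<Longrightarrow> b \<in> ?B \<Longrightarrow> r \<odot>\<^bsub>?M\<^esub> b \<in> ?B"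
    using boundaries_subspace[of n X] by (auto simp: chain_subspace_def)
  note q = M.quotient_module[OF subg smB Q]
  show "vectorspace R (homology R n X)"
    using q(1) field_axioms by (simp add: vectorspace_def)
  show "carrier (homology R n X) = hom_class n X ` ?Z"
    using q(2) by (simp add: hom_class_def rc image_def)
  show "hom_class n X c \<oplus>\<^bsub>homology R n X\<^esub> hom_class n X d = hom_class n X (\<lambda>s. c s \<oplus> d s)"
    if "c \<in> ?Z" "d \<in> ?Z" for c d
    using q(3)[of c d] that by (simp add: hom_class_def rc)
  show "r \<odot>\<^bsub>homology R n X\<^esub> hom_class n X c = hom_class n X (\<lambda>s. r \<otimes> c s)"
    if "r \<in> carrier R" "c \<in> ?Z" for r c
    using q(4)[of r c] that by (simp add: hom_class_def rc)
  show "hom_class n X (\<lambda>s. \<zero>) = \<zero>\<^bsub>homology R n X\<^esub>"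
    using q(5) by (simp add: hom_class_def rc)
  show "\<exists>b\<in>?B. d = (\<lambda>s. b s \<oplus> c s)" if "c \<in> ?Z" "d \<in> hom_class n X c" for c d
    using q(6)[of c d] that by (simp add: hom_class_def rc)
  show "c \<in> hom_class n X c" if "c \<in> ?Z" for c
    using q(7)[of c] that by (simp add: hom_class_def rc)
  show "hom_class n X c = \<zero>\<^bsub>homology R n X\<^esub>" if "c \<in> ?B" for c
    using q(8)[of c] that by (simp add: hom_class_def rc)
qed

text \<open>Generation is phrased without classes: every subspace that contains the boundaries and
  \<open>S\<close> contains all cycles. It is applied to the set \<open>W\<close> of cycles whose
  class lies in the span of the classes of \<open>S\<close>. Finite dimension is recorded because
  the lower bound depends on it.\<close>

lemma homology_dim_le:
  assumes fin: "finite S" and S: "S \<subseteq> cycles R n X"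
    and span: "\<And>W. chain_subspace n X W \<Longrightarrow> boundaries R n X \<subseteq> W \<Longrightarrow> S \<subseteq> W \<Longrightarrow> cycles R n X \<subseteq> W"
  shows "vectorspace.fin_dim R (homology R n X)" "homology_dim R n X \<le> card S"
proof -
  interpret V: vectorspace R "homology R n X" by (rule homology_vectorspace)
  let ?T = "hom_class n X ` S"
  have T: "?T \<subseteq> carrier (homology R n X)" "finite ?T"
    using fin S by (auto simp: homology_carrier)
  interpret sp: LinearCombinations.submodule R "V.span ?T" "homology R n X"
    by (rule V.span_is_submodule[OF T(1)])
  define W where "W = {c \<in> cycles R n X. hom_class n X c \<in> V.span ?T}"
  have Z: "chain_subspace n X (cycles R n X)" by (rule cycles_subspace)
  have zz: "\<zero>\<^bsub>homology R n X\<^esub> \<in> V.span ?T"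
    using sp.module by (metis LinearCombinations.submodule.zero_closed sp.submodule_axioms)
  have "chain_subspace n X W"
    unfolding chain_subspace_def
  proof (intro conjI ballI)
    show "W \<subseteq> carrier (chain_module R n X)" by (auto simp: W_def cycles_def)
    show "(\<lambda>s. \<zero>) \<in> W"
      using Z zz by (simp add: W_def hom_class_zero chain_subspace_def)
    show "(\<lambda>s. c s \<oplus> d s) \<in> W" if "c \<in> W" "d \<in> W" for c d
      using that Z sp.m_closed[of "hom_class n X c" "hom_class n X d"]
      by (auto simp: W_def hom_class_add chain_subspace_def)
    show "(\<lambda>s. r \<otimes> c s) \<in> W" if "r \<in> carrier R" "c \<in> W" for c r
      using that Z sp.smult_closed[of r "hom_class n X c"]
      by (auto simp: W_def hom_class_smult chain_subspace_def)
  qed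
  moreover have "boundaries R n X \<subseteq> W"
    using boundaries_subset_cycles zz by (auto simp: W_def hom_class_boundary)
  moreover have "S \<subseteq> W"
    using S V.in_own_span[OF T(1)] by (auto simp: W_def)
  ultimately have "cycles R n X \<subseteq> W" by (rule span)
  then have "carrier (homology R n X) \<subseteq> V.span ?T"
    by (auto simp: homology_carrier W_def)
  then have sp: "V.span ?T = carrier (homology R n X)"
    using V.span_is_subset2[OF T(1)] by blast
  then show "V.fin_dim" unfolding V.fin_dim_def using T by blast
  have "V.dim \<le> card ?T" using V.gen_ge_dim[OF T(2) T(1) sp] .
  also have "\<dots> \<le> card S" using fin by (rule card_image_le)
  finally show "homology_dim R n X \<le> card S" by (simp add: homology_dim_def)
qed

end

section \<open>A calculus of paths modulo boundaries of triangles\<close>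

section \<open>Relations between paths\<close>

definition triangle :: "(real \<times> real) set" where
  "triangle = {(s, t). 0 \<le> s \<and> 0 \<le> t \<and> s + t \<le> 1}"

text \<open>
  \<open>lam f\<close> stands for the path \<open>f\<close> as a 1-chain, \<open>W\<close> for a subgroup of chains containing the
  boundaries of triangles; all statements hold modulo \<open>W\<close>.
\<close>

locale path_relation =
  fixes E :: "'a::real_normed_vector set" and W :: "'g::ab_group_add set"
    and lam :: "(real \<Rightarrow> 'a) \<Rightarrow> 'g"
  assumes W_zero: "0 \<in> W"
    and W_diff: "x \<in> W \<Longrightarrow> y \<in> W \<Longrightarrow> x - y \<in> W"
    and lam_cong: "(\<And>t. t \<in> {0..1} \<Longrightarrow> f t = g t) \<Longrightarrow> lam f = lam g"
    and lam_triangle: "continuous_on triangle \<tau> \<Longrightarrow> \<tau> ` triangle \<subseteq> E \<Longrightarrow>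
        lam (\<lambda>t. \<tau> (t, 0)) + lam (\<lambda>t. \<tau> (1 - t, t)) - lam (\<lambda>t. \<tau> (0, t)) \<in> W"
begin

lemma W_uminus: "x \<in> W \<Longrightarrow> - x \<in> W"
  using W_diff[OF W_zero] by simp

lemma W_add: "x \<in> W \<Longrightarrow> y \<in> W \<Longrightarrow> x + y \<in> W"
  using W_diff[OF _ W_uminus, of x y] by simp

lemma W_trans: "x - y \<in> W \<Longrightarrow> y - z \<in> W \<Longrightarrow> x - z \<in> W"
  using W_add[of "x - y" "y - z"] by simp

lemma W_sym: "x - y \<in> W \<Longrightarrow> y - x \<in> W"
  using W_uminus[of "x - y"] by simp

lemma W_sub_left: "x - y \<in> W \<Longrightarrow> x \<in> W \<longleftrightarrow> y \<in> W"
  using W_diff[of x "x - y"] W_add[of "x - y" y] by auto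

text \<open>The affine image of the triangle with vertices x, y, z stays in the convex set
  \<open>S\<close>, so \<open>\<kappa>\<close> turns it into a triangle in \<open>E\<close>.
  Coinciding vertices are allowed, and most relations below are special choices of x, y, z.\<close>

lemma lam_affine:
  fixes \<kappa> :: "'b::real_normed_vector \<Rightarrow> 'a"
  assumes S: "convex S" and \<kappa>: "continuous_on S \<kappa>" "\<kappa> ` S \<subseteq> E"
    and xyz: "x \<in> S" "y \<in> S" "z \<in> S"
  shows "lam (\<kappa> \<circ> linepath x y) + lam (\<kappa> \<circ> linepath y z) - lam (\<kappa> \<circ> linepath x z) \<in> W"
proof -
  define a where "a = (\<lambda>(s::real, t::real). (1 - s - t) *\<^sub>R x + s *\<^sub>R y + t *\<^sub>R z)"
  have a: "a ` triangle \<subseteq> S"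
  proof
    fix w assume "w \<in> a ` triangle"
    then obtain s t where st: "0 \<le> s" "0 \<le> t" "s + t \<le> 1" "w = (1 - s - t) *\<^sub>R x + s *\<^sub>R y + t *\<^sub>R z"
      by (auto simp: a_def triangle_def)
    then have "w \<in> convex hull {x, y, z}"
      unfolding convex_hull_3 by (intro CollectI exI[of _ "1 - s - t"] exI[of _ s] exI[of _ t]) auto
    moreover have "convex hull {x, y, z} \<subseteq> S"
      using S xyz by (intro hull_minimal) auto
    ultimately show "w \<in> S" by blast
  qed
  have "continuous_on triangle (\<kappa> \<circ> a)"
  proof (rule continuous_on_compose)
    show "continuous_on triangle a"
      unfolding a_def case_prod_unfold by (intro continuous_intros)
    show "continuous_on (a ` triangle) \<kappa>"
      using \<kappa>(1) a by (rule continuous_on_subset)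
  qed
  moreover have "(\<kappa> \<circ> a) ` triangle \<subseteq> E" using a \<kappa>(2) by (auto simp: image_subset_iff)
  ultimately have "lam (\<lambda>t. (\<kappa> \<circ> a) (t, 0)) + lam (\<lambda>t. (\<kappa> \<circ> a) (1 - t, t)) - lam (\<lambda>t. (\<kappa> \<circ> a) (0, t)) \<in> W"
    by (rule lam_triangle)
  moreover have "(\<lambda>t. (\<kappa> \<circ> a) (t, 0)) = \<kappa> \<circ> linepath x y" "(\<lambda>t. (\<kappa> \<circ> a) (1 - t, t)) = \<kappa> \<circ> linepath y z"
    "(\<lambda>t. (\<kappa> \<circ> a) (0, t)) = \<kappa> \<circ> linepath x z"
    by (auto simp: a_def linepath_def fun_eq_iff)
  ultimately show ?thesis by simp
qed

text \<open>With all three vertices equal, the triangle relation reads lam + lam - lam.\<close>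

lemma lam_affine_const:
  fixes \<kappa> :: "'b::real_normed_vector \<Rightarrow> 'a"
  assumes "convex S" "continuous_on S \<kappa>" "\<kappa> ` S \<subseteq> E" "x \<in> S"
  shows "lam (\<kappa> \<circ> linepath x x) \<in> W"
  using lam_affine[OF assms(1-3) assms(4) assms(4) assms(4)] by simp

lemma lam_affine_reverse:
  fixes \<kappa> :: "'b::real_normed_vector \<Rightarrow> 'a"
  assumes "convex S" "continuous_on S \<kappa>" "\<kappa> ` S \<subseteq> E" "x \<in> S" "y \<in> S"
  shows "lam (\<kappa> \<circ> linepath x y) + lam (\<kappa> \<circ> linepath y x) \<in> W"
  using W_add[OF lam_affine[OF assms(1-3) assms(4,5,4)] lam_affine_const[OF assms(1-4)]] by simp

lemma lam_subpath:
  assumes "path f" "path_image f \<subseteq> E" "a \<in> {0..1}" "b \<in> {0..1}" "c \<in> {0..1}"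
  shows "lam (subpath a b f) + lam (subpath b c f) - lam (subpath a c f) \<in> W"
proof -
  have "subpath a b f = f \<circ> linepath a b" for a b
    by (auto simp: subpath_def linepath_def fun_eq_iff algebra_simps)
  then show ?thesis
    using lam_affine[of "{0..1}" f a b c] assms by (simp add: path_def path_image_def)
qed

lemma lam_subpath_refl:
  assumes "path f" "path_image f \<subseteq> E" "a \<in> {0..1}"
  shows "lam (subpath a a f) \<in> W"
  using lam_subpath[OF assms(1,2) assms(3) assms(3) assms(3)] by simp

text \<open>Both pieces are halves of the joined path, so the relation for subpaths applies.\<close>

lemma lam_join:
  assumes "path f" "path_image f \<subseteq> E" "path g" "path_image g \<subseteq> E" "pathfinish f = pathstart g"
  shows "lam f + lam g - lam (f +++ g) \<in> W"
proof -
  let ?k = "f +++ g"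
  have "path ?k" "path_image ?k \<subseteq> E"
    using assms by (auto simp: path_image_join)
  then have "lam (subpath 0 (1/2) ?k) + lam (subpath (1/2) 1 ?k) - lam (subpath 0 1 ?k) \<in> W"
    by (rule lam_subpath) auto
  moreover have "lam (subpath 0 (1/2) ?k) = lam f"
    by (rule lam_cong) (auto simp: subpath_def joinpaths_def)
  moreover have "lam (subpath (1/2) 1 ?k) = lam g"
    by (rule lam_cong) (use assms(5) in \<open>auto simp: subpath_def joinpaths_def pathfinish_def pathstart_def field_simps\<close>)
  ultimately show ?thesis by simp
qed

lemma lam_reversepath:
  assumes "path f" "path_image f \<subseteq> E"
  shows "lam f + lam (reversepath f) \<in> W"
proof -
  have "lam (subpath 0 1 f) + lam (subpath 1 0 f) - lam (subpath 0 0 f) \<in> W"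
    by (rule lam_subpath[OF assms]) auto
  note W_add[OF this lam_subpath_refl[OF assms, of 0]]
  then  have "lam f + lam (subpath 1 0 f) \<in> W" by simp
  moreover have "subpath 1 0 f = reversepath f" by (auto simp: reversepath_def subpath_def fun_eq_iff)
  ultimately show ?thesis by simp
qed

text \<open>The homotopy square is cut along its diagonal into two triangles. Every stage is a loop,
  so the tracks of the two end points coincide and cancel.\<close>

lemma lam_homotopic_loops:
  assumes "homotopic_loops E f g"
  shows "lam f - lam g \<in> W"
proof -
  obtain h where h: "continuous_on ({0..1} \<times> {0..1::real}) h" "h ` ({0..1} \<times> {0..1}) \<subseteq> E"
    "\<And>x. x \<in> {0..1} \<Longrightarrow> h (0, x) = f x" "\<And>x. x \<in> {0..1} \<Longrightarrow> h (1, x) = g x"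
    "\<And>t. t \<in> {0..1} \<Longrightarrow> pathfinish (h \<circ> Pair t) = pathstart (h \<circ> Pair (t::real))"
    using assms unfolding homotopic_loops image_subset_iff_funcset by blast
  let ?S = "{0..1::real} \<times> {0..1::real}"
  have S: "convex ?S" by (intro convex_Times) auto
  have 1: "lam (h \<circ> linepath (0,0) (0,1)) + lam (h \<circ> linepath (0,1) (1,1)) - lam (h \<circ> linepath (0,0) (1,1)) \<in> W"
    by (rule lam_affine[OF S h(1,2)]) auto
  have 2: "lam (h \<circ> linepath (0,0) (1,0)) + lam (h \<circ> linepath (1,0) (1,1)) - lam (h \<circ> linepath (0,0) (1,1)) \<in> W"
    by (rule lam_affine[OF S h(1,2)]) auto
  have e: "lam (h \<circ> linepath (0,0) (0,1)) = lam f" "lam (h \<circ> linepath (1,0) (1,1)) = lam g"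
    "lam (h \<circ> linepath (0,1) (1,1)) = lam (h \<circ> linepath (0,0) (1,0))"
    using h(3-5) by (auto intro!: lam_cong simp: linepath_def pathfinish_def pathstart_def)
  show ?thesis
    using W_diff[OF 1 2] unfolding e by (simp add: algebra_simps)
qed

text \<open>f followed by the reversed g is a loop in \<open>U\<close>.\<close>

lemma lam_same_ends:
  assumes U: "U \<subseteq> E" and loops: "\<And>f. path f \<Longrightarrow> path_image f \<subseteq> U \<Longrightarrow> pathfinish f = pathstart f \<Longrightarrow> lam f \<in> W"
    and f: "path f" "path_image f \<subseteq> U" and g: "path g" "path_image g \<subseteq> U"
    and ends: "pathstart f = pathstart g" "pathfinish f = pathfinish g"
  shows "lam f - lam g \<in> W"
proof -
  have fE: "path_image f \<subseteq> E" and gE: "path_image g \<subseteq> E" using f g U by auto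
  have "path (f +++ reversepath g)" "path_image (f +++ reversepath g) \<subseteq> U"
    using f g ends by (auto simp: path_image_join)
  then have "lam (f +++ reversepath g) \<in> W"
    by (rule loops) (use ends in simp)
  moreover have "lam f + lam (reversepath g) - lam (f +++ reversepath g) \<in> W"
    by (rule lam_join) (use f g fE gE ends in auto)
  ultimately have "lam f + lam (reversepath g) \<in> W"
    using W_sub_left by blast
  from W_diff[OF this lam_reversepath[OF g(1) gE]] show ?thesis by simp
qed

text \<open>Local primitives given by one function \<open>\<theta>\<close> add up along a path,
  since the values at intermediate points cancel. \<open>\<theta>\<close> is arbitrary; no
  continuity enters.\<close>

lemma lam_exact_local:
  assumes loc: "\<And>e. e \<in> E \<Longrightarrow> \<exists>U. openin (top_of_set E) U \<and> e \<in> U \<and>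
      (\<forall>f. path f \<and> path_image f \<subseteq> U \<longrightarrow> lam f - \<theta> (pathfinish f) + \<theta> (pathstart f) \<in> W)"
    and f: "path f" "path_image f \<subseteq> E"
  shows "lam f - \<theta> (pathfinish f) + \<theta> (pathstart f) \<in> W"
proof -
  define R where "R = (\<lambda>a b. lam (subpath a b f) - \<theta> (f b) + \<theta> (f a) \<in> W)"
  have Rtrans: "R a c" if "R a b" "R b c" "a \<in> {0..1}" "b \<in> {0..1}" "c \<in> {0..1}" for a b c
  proof -
    have 1: "lam (subpath a b f) + lam (subpath b c f) - lam (subpath a c f) \<in> W"
      by (rule lam_subpath) (use that f in auto)
    have 2: "lam (subpath a b f) - \<theta> (f b) + \<theta> (f a) + (lam (subpath b c f) - \<theta> (f c) + \<theta> (f b)) \<in> W"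
      using W_add[OF that(1,2)[unfolded R_def]] .
    from W_diff[OF 2 1] show ?thesis unfolding R_def by (simp add: algebra_simps)
  qed
  have Rsym: "R b a" if "R a b" "a \<in> {0..1}" "b \<in> {0..1}" for a b
  proof -
    have 1: "lam (subpath a b f) + lam (subpath b a f) - lam (subpath a a f) \<in> W"
      by (rule lam_subpath) (use that f in auto)
    have 2: "lam (subpath a a f) \<in> W"
      by (rule lam_subpath_refl) (use that f in auto)
    have "lam (subpath a b f) + lam (subpath b a f) \<in> W"
      using W_add[OF 1 2] by simp
    from W_diff[OF this that(1)[unfolded R_def]] show ?thesis
      unfolding R_def by (simp add: algebra_simps)
  qed
  \<comment> \<open>\<open>R\<close> is transitive and symmetric, and each parameter has a
    neighbourhood of related ones. Connectedness of the interval takes the place of a subdivision of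
    the path.\<close>
  have "R 0 1"
  proof (rule connected_equivalence_relation[of "{0..1}"])
    fix a :: real assume a: "a \<in> {0..1}"
    then obtain U where U: "openin (top_of_set E) U" "f a \<in> U"
      "\<And>g. path g \<Longrightarrow> path_image g \<subseteq> U \<Longrightarrow> lam g - \<theta> (pathfinish g) + \<theta> (pathstart g) \<in> W"
      using loc[of "f a"] f(2) unfolding path_image_def by (metis image_subset_iff)
    have "openin (top_of_set {0..1}) ({0..1} \<inter> f -` U)"
      using f U(1) by (intro continuous_openin_preimage[of _ _ E]) (auto simp: path_def path_image_def)
    then obtain d where d: "d > 0" "ball a d \<inter> {0..1} \<subseteq> {0..1} \<inter> f -` U"
      using a U(2) unfolding openin_contains_ball by blast
    have "R a x" if x: "x \<in> ball a d \<inter> {0..1}" for x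
    proof -
      have "path (subpath a x f)"
        using f a x by auto
      moreover have "path_image (subpath a x f) \<subseteq> U"
      proof -
        have "convex (ball a d \<inter> {0..1})" by (intro convex_Int) auto
        then have "closed_segment a x \<subseteq> ball a d \<inter> {0..1}"
          using x a d(1) by (intro closed_segment_subset) auto
        then have "f ` closed_segment a x \<subseteq> U" using d(2) by blast
        then show ?thesis by (simp add: path_image_subpath_gen)
      qed
      ultimately show ?thesis using U(3)[of "subpath a x f"] unfolding R_def by simp
    qed
    then show "\<exists>T. openin (top_of_set {0..1}) T \<and> a \<in> T \<and> (\<forall>x\<in>T. R a x)"
      using a d(1) by (intro exI[of _ "ball a d \<inter> {0..1}"]) (auto simp: Int_commute[of "ball a d"] intro!: openin_open_Int)
  next
    show "R y x" if "R x y" "x \<in> {0..1}" "y \<in> {0..1}" for x y using Rsym[OF that] .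
    show "R x z" if "R x y" "R y z" "x \<in> {0..1}" "y \<in> {0..1}" "z \<in> {0..1}" for x y z using Rtrans[OF that] .
  qed simp_all
  then show ?thesis
    unfolding R_def by (simp add: pathfinish_def pathstart_def)
qed

end

section \<open>Singular simplices of dimension one and two as paths and triangles, with their
  boundaries\<close>

section \<open>Paths, triangles and one-dimensional cycles\<close>

text \<open>Barycentric coordinates: the parameter of a path is coordinate 1, so the path starts at
  vertex 0.\<close>

definition simplex_point1 :: "real \<Rightarrow> nat \<Rightarrow> real" where
  "simplex_point1 t = (\<lambda>i. if i = 0 then 1 - t else if i = 1 then t else 0)"

definition simplex_point2 :: "real \<times> real \<Rightarrow> nat \<Rightarrow> real" where
  "simplex_point2 = (\<lambda>(s, t) i. if i = 0 then 1 - s - t else if i = 1 then s else if i = 2 then t else 0)"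

lemma simplex_point1_in:
  assumes "t \<in> {0..1}"
  shows "simplex_point1 t \<in> standard_simplex 1"
proof -
  have "{..1::nat} = {0, 1}" by auto
  then show ?thesis
    using assms unfolding standard_simplex_def simplex_point1_def by simp
qed

lemma simplex_point2_in:
  assumes "st \<in> triangle"
  shows "simplex_point2 st \<in> standard_simplex 2"
proof -
  obtain s t where st: "st = (s, t)" "0 \<le> s" "0 \<le> t" "s + t \<le> 1"
    using assms by (auto simp: triangle_def)
  have "{..2::nat} = {0, 1, 2}" by auto
  then show ?thesis
    using st unfolding standard_simplex_def simplex_point2_def by simp
qed

lemma standard_simplex1D:
  assumes "x \<in> standard_simplex 1"
  shows "x 1 \<in> {0..1}" "x = simplex_point1 (x 1)"
proof -
  note d = assms[unfolded standard_simplex_def mem_Collect_eq]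
  show "x 1 \<in> {0..1}" using conjunct1[OF d] by simp
  have "{..1::nat} = {0, 1}" by auto
  then have "x 0 + x 1 = 1" using conjunct2[OF conjunct2[OF d]] by simp
  moreover have "\<And>i. i > 1 \<Longrightarrow> x i = 0" using conjunct1[OF conjunct2[OF d]] by blast
  ultimately have "x i = simplex_point1 (x 1) i" for i
  proof (cases "i > 1")
    case False
    then have "i = 0 \<or> i = 1" by auto
    then show ?thesis using \<open>x 0 + x 1 = 1\<close> by (auto simp: simplex_point1_def)
  qed (simp add: simplex_point1_def)
  then show "x = simplex_point1 (x 1)" by blast
qed

lemma standard_simplex2D:
  assumes "x \<in> standard_simplex 2"
  shows "(x 1, x 2) \<in> triangle" "x = simplex_point2 (x 1, x 2)"
proof -
  note d = assms[unfolded standard_simplex_def mem_Collect_eq]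
  have "{..2::nat} = {0, 1, 2}" by auto
  then have s: "x 0 + x 1 + x 2 = 1" using conjunct2[OF conjunct2[OF d]] by (simp add: add.assoc)
  have z: "\<And>i. i > 2 \<Longrightarrow> x i = 0" using conjunct1[OF conjunct2[OF d]] by blast
  have p: "\<And>i. x i \<ge> 0" using conjunct1[OF d] by blast
  show "(x 1, x 2) \<in> triangle"
    using s p[of 0] p[of 1] p[of 2] by (auto simp: triangle_def)
  show "x = simplex_point2 (x 1, x 2)"
  proof
    fix i show "x i = simplex_point2 (x 1, x 2) i"
    proof (cases "i > 2")
      case True then show ?thesis using z by (simp add: simplex_point2_def)
    next
      case False
      then have "i = 0 \<or> i = 1 \<or> i = 2" by auto
      then show ?thesis using s by (auto simp: simplex_point2_def)
    qed
  qed
qed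

text \<open>Singular simplices are extensional, hence the restriction; only the values of
  \<open>f\<close> on the unit interval survive.\<close>

definition path_simplex :: "(real \<Rightarrow> 'a) \<Rightarrow> (nat \<Rightarrow> real) \<Rightarrow> 'a" where
  "path_simplex f = restrict (\<lambda>x. f (x 1)) (standard_simplex 1)"

definition triangle_simplex :: "(real \<times> real \<Rightarrow> 'a) \<Rightarrow> (nat \<Rightarrow> real) \<Rightarrow> 'a" where
  "triangle_simplex \<tau> = restrict (\<lambda>x. \<tau> (x 1, x 2)) (standard_simplex 2)"

definition point_simplex :: "'a \<Rightarrow> (nat \<Rightarrow> real) \<Rightarrow> 'a" where
  "point_simplex e = restrict (\<lambda>x. e) (standard_simplex 0)"

lemma path_simplex_cong:
  assumes "\<And>t. t \<in> {0..1} \<Longrightarrow> f t = g t"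
  shows "path_simplex f = path_simplex g"
  using assms standard_simplex1D(1) by (auto simp: path_simplex_def fun_eq_iff restrict_def)

lemma continuous_map_coordinate:
  "continuous_map (subtopology (powertop_real UNIV) S) euclideanreal (\<lambda>x. x i)"
  by (intro continuous_map_from_subtopology continuous_map_product_projection) simp

lemma singular_path_simplex:
  assumes "path f" "path_image f \<subseteq> E"
  shows "singular_simplex 1 (top_of_set E) (path_simplex f)"
proof -
  have "continuous_map (subtopology (powertop_real UNIV) (standard_simplex 1)) (top_of_set {0..1}) (\<lambda>x. x 1)"
    using standard_simplex1D(1)
    by (auto simp: continuous_map_in_subtopology continuous_map_coordinate)
  moreover have "continuous_map (top_of_set {0..1}) (top_of_set E) f"
    using assms by (auto simp: path_def path_image_def)
  ultimately have "continuous_map (subtopology (powertop_real UNIV) (standard_simplex 1)) (top_of_set E) (f \<circ> (\<lambda>x. x 1))"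
    by (rule continuous_map_compose)
  then show ?thesis
    unfolding singular_simplex_def path_simplex_def
    by (auto simp: continuous_map_in_subtopology restrict_continuous_map o_def
        elim!: continuous_map_eq)
qed

lemma singular_triangle_simplex:
  assumes "continuous_on triangle \<tau>" "\<tau> ` triangle \<subseteq> E"
  shows "singular_simplex 2 (top_of_set E) (triangle_simplex \<tau>)"
proof -
  have "continuous_map (subtopology (powertop_real UNIV) (standard_simplex 2))
      (prod_topology euclideanreal euclideanreal) (\<lambda>x. (x 1, x 2))"
    by (intro continuous_map_pairedI continuous_map_coordinate)
  then have "continuous_map (subtopology (powertop_real UNIV) (standard_simplex 2)) (top_of_set triangle) (\<lambda>x. (x 1, x 2))"
    using standard_simplex2D(1) by (auto simp: continuous_map_in_subtopology)
  moreover have "continuous_map (top_of_set triangle) (top_of_set E) \<tau>"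
    using assms by auto
  ultimately have "continuous_map (subtopology (powertop_real UNIV) (standard_simplex 2)) (top_of_set E) (\<tau> \<circ> (\<lambda>x. (x 1, x 2)))"
    by (rule continuous_map_compose)
  then show ?thesis
    unfolding singular_simplex_def triangle_simplex_def
    by (auto simp: o_def elim!: continuous_map_eq)
qed

lemma singular_simplex1E:
  assumes "singular_simplex 1 (top_of_set E) s"
  obtains f where "path f" "path_image f \<subseteq> E" "s = path_simplex f"
proof
  let ?f = "s \<circ> simplex_point1"
  have "continuous_map (top_of_set {0..1}) (powertop_real UNIV) simplex_point1"
    unfolding continuous_map_componentwise_UNIV
  proof
    fix i :: nat
    have "i = 0 \<or> i = 1 \<or> i > 1" by auto
    then show "continuous_map (top_of_set {0..1}) euclideanreal (\<lambda>t. simplex_point1 t i)"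
      by (auto simp: simplex_point1_def intro!: continuous_intros)
  qed
  then have "continuous_map (top_of_set {0..1}) (subtopology (powertop_real UNIV) (standard_simplex 1)) simplex_point1"
    using simplex_point1_in by (auto simp: continuous_map_in_subtopology)
  moreover have "continuous_map (subtopology (powertop_real UNIV) (standard_simplex 1)) (top_of_set E) s"
    using assms by (simp add: singular_simplex_def)
  ultimately have "continuous_map (top_of_set {0..1}) (top_of_set E) ?f"
    by (rule continuous_map_compose)
  then show "path ?f" "path_image ?f \<subseteq> E"
    by (auto simp: path_def path_image_def)
  have "s x = path_simplex ?f x" for x
  proof (cases "x \<in> standard_simplex 1")
    case True
    then show ?thesis using standard_simplex1D(2)[OF True] by (simp add: path_simplex_def)
  next
    case False
    then show ?thesis using assms by (auto simp: path_simplex_def singular_simplex_def extensional_def)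
  qed
  then show "s = path_simplex ?f" by auto
qed

lemma singular_simplex2E:
  assumes "singular_simplex 2 (top_of_set E) s"
  obtains \<tau> where "continuous_on triangle \<tau>" "\<tau> ` triangle \<subseteq> E" "s = triangle_simplex \<tau>"
proof
  let ?f = "s \<circ> simplex_point2"
  have "continuous_on triangle (\<lambda>x. simplex_point2 x i)" for i
  proof -
    have "i = 0 \<or> i = 1 \<or> i = 2 \<or> i > 2" by auto
    then show ?thesis
      by (auto simp: simplex_point2_def case_prod_unfold intro!: continuous_intros)
  qed
  then have "continuous_map (top_of_set triangle) (powertop_real UNIV) simplex_point2"
    unfolding continuous_map_componentwise_UNIV by auto
  then have "continuous_map (top_of_set triangle) (subtopology (powertop_real UNIV) (standard_simplex 2)) simplex_point2"
    using simplex_point2_in by (auto simp: continuous_map_in_subtopology)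
  moreover have "continuous_map (subtopology (powertop_real UNIV) (standard_simplex 2)) (top_of_set E) s"
    using assms by (simp add: singular_simplex_def)
  ultimately have "continuous_map (top_of_set triangle) (top_of_set E) ?f"
    by (rule continuous_map_compose)
  then show "continuous_on triangle ?f" "?f ` triangle \<subseteq> E"
    by auto
  have "s x = triangle_simplex ?f x" for x
  proof (cases "x \<in> standard_simplex 2")
    case True
    then show ?thesis using standard_simplex2D(2)[OF True] by (simp add: triangle_simplex_def)
  next
    case False
    then show ?thesis using assms by (auto simp: triangle_simplex_def singular_simplex_def extensional_def)
  qed
  then show "s = triangle_simplex ?f" by auto
qed

lemma chain_boundary_path_simplex:
  "chain_boundary 1 (frag_of (path_simplex f)) =
     frag_of (point_simplex (pathfinish f)) - frag_of (point_simplex (pathstart f))"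
proof -
  have face: "singular_face 1 k (path_simplex f) = point_simplex e"
    if "k \<le> 1" and *: "\<And>x. x \<in> standard_simplex 0 \<Longrightarrow> f (simplical_face k x 1) = e" for k e
  proof -
    have "(path_simplex f \<circ> simplical_face k) x = e" if x: "x \<in> standard_simplex 0" for x
    proof -
      have "simplical_face k x \<in> standard_simplex 1"
        using simplical_face_in_standard_simplex[of 1 k x] that \<open>k \<le> 1\<close> by simp
      then show ?thesis using *[OF x] by (simp add: path_simplex_def)
    qed
    then show ?thesis
      unfolding singular_face_def point_simplex_def by (auto intro!: restrict_ext)
  qed
  have 0: "singular_face 1 0 (path_simplex f) = point_simplex (f 1)"
    by (rule face) (auto simp: standard_simplex_0 simplical_face_def)
  have 1: "singular_face 1 1 (path_simplex f) = point_simplex (f 0)"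
    by (rule face) (auto simp: standard_simplex_0 simplical_face_def)
  show ?thesis
    using 0 1 by (simp add: chain_boundary_of pathfinish_def pathstart_def)
qed

text \<open>Faces 0, 1, 2 omit the vertices 0, 1, 2 and are the hypotenuse, the vertical leg and the
  horizontal leg. The alternating signs are those of the relation
  \<open>lam_triangle\<close>.\<close>

lemma chain_boundary_triangle_simplex:
  "chain_boundary 2 (frag_of (triangle_simplex \<tau>)) =
     frag_of (path_simplex (\<lambda>t. \<tau> (1 - t, t))) - frag_of (path_simplex (\<lambda>t. \<tau> (0, t)))
     + frag_of (path_simplex (\<lambda>t. \<tau> (t, 0)))"
proof -
  have f: "simplical_face k x \<in> standard_simplex 2" if "k \<le> 2" "x \<in> standard_simplex 1" for k and x :: "nat \<Rightarrow> real"
    using simplical_face_in_standard_simplex[of 2 k x] that by simp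
  have c: "x 0 = 1 - x 1" if "x \<in> standard_simplex 1" for x :: "nat \<Rightarrow> real"
    using standard_simplex1D(2)[OF that] by (metis simplex_point1_def)
  have face: "singular_face 2 k (triangle_simplex \<tau>) = path_simplex g"
    if k: "k \<le> 2" and *: "\<And>x. x \<in> standard_simplex 1 \<Longrightarrow> \<tau> (simplical_face k x 1, simplical_face k x 2) = g (x 1)" for k g
  proof -
    have "(triangle_simplex \<tau> \<circ> simplical_face k) x = g (x 1)" if x: "x \<in> standard_simplex 1" for x
      using f[OF k x] *[OF x] by (simp add: triangle_simplex_def)
    then show ?thesis
      unfolding singular_face_def path_simplex_def by (auto intro!: restrict_ext)
  qed
  have 0: "singular_face 2 0 (triangle_simplex \<tau>) = path_simplex (\<lambda>t. \<tau> (1 - t, t))"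
    by (rule face) (auto simp: c simplical_face_def)
  have 1: "singular_face 2 1 (triangle_simplex \<tau>) = path_simplex (\<lambda>t. \<tau> (0, t))"
    by (rule face) (auto simp: simplical_face_def)
  have 2: "singular_face 2 2 (triangle_simplex \<tau>) = path_simplex (\<lambda>t. \<tau> (t, 0))"
    by (rule face) (auto simp: simplical_face_def)
  have "{..2::nat} = {0, 1, 2}" by auto
  then show ?thesis
    using 0 1 2 by (simp add: chain_boundary_of)
qed

section \<open>Cocycles and lower bounds for homology; generation of cycles by loops\<close>

context field
begin

lemma chain_pair_diff:
  assumes c: "\<And>s. c s \<in> carrier R" "finite {s. c s \<noteq> \<zero>}"
    and d: "\<And>s. d s \<in> carrier R" "finite {s. d s \<noteq> \<zero>}" and e: "\<And>s. \<delta> s \<in> carrier R"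
  shows "chain_pair \<delta> (\<lambda>s. c s \<ominus> d s) = chain_pair \<delta> c \<ominus> chain_pair \<delta> d"
proof -
  have "(\<lambda>s. c s \<ominus> d s) = (\<lambda>s. c s \<oplus> (\<ominus> \<one>) \<otimes> d s)"
    using c d by (auto simp: a_minus_def l_minus)
  moreover have "chain_pair \<delta> (\<lambda>s. c s \<oplus> (\<ominus> \<one>) \<otimes> d s) = chain_pair \<delta> c \<oplus> chain_pair \<delta> (\<lambda>s. (\<ominus> \<one>) \<otimes> d s)"
  proof (rule chain_pair_add)
    show "finite {s. (\<ominus> \<one>) \<otimes> d s \<noteq> \<zero>}"
      by (rule finite_subset[OF _ d(2)]) auto
  qed (use assms in auto)
  moreover have "chain_pair \<delta> (\<lambda>s. (\<ominus> \<one>) \<otimes> d s) = (\<ominus> \<one>) \<otimes> chain_pair \<delta> d"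
    by (rule chain_pair_smult) (use assms in auto)
  ultimately show ?thesis
    using assms by (simp add: a_minus_def l_minus chain_pair_closed)
qed

lemma chain_pair_frag_diff:
  assumes "\<And>s. \<delta> s \<in> carrier R"
  shows "chain_pair \<delta> (frag_chain (a - b)) = chain_pair \<delta> (frag_chain a) \<ominus> chain_pair \<delta> (frag_chain b)"
  unfolding frag_chain_diff by (rule chain_pair_diff) (use assms frag_chain_finite in auto)

lemma chain_pair_frag_add:
  assumes "\<And>s. \<delta> s \<in> carrier R"
  shows "chain_pair \<delta> (frag_chain (a + b)) = chain_pair \<delta> (frag_chain a) \<oplus> chain_pair \<delta> (frag_chain b)"
  unfolding frag_chain_add by (rule chain_pair_add) (use assms frag_chain_finite in auto)

text \<open>A boundary is a combination of boundaries of single simplices, to which the cocycle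
  condition applies.\<close>

lemma chain_pair_boundary:
  assumes \<delta>: "\<And>s. \<delta> s \<in> carrier R"
    and cocycle: "\<And>s. singular_simplex (Suc n) X s \<Longrightarrow>
      chain_pair \<delta> (frag_chain (chain_boundary (Suc n) (frag_of s))) = \<zero>"
    and b: "b \<in> boundaries R n X"
  shows "chain_pair \<delta> b = \<zero>"
proof -
  obtain c where c: "c \<in> carrier (chain_module R (Suc n) X)" "b = chain_bd R (Suc n) c"
    using b by (auto simp: boundaries_def)
  from c(1) have "chain_pair \<delta> (chain_bd R (Suc n) c) = \<zero>"
  proof (induction rule: chain_induct)
    case zero
    then show ?case by (simp add: chain_bd_zero)
  next
    case (add c r s)
    have s: "singular_chain n X (chain_boundary (Suc n) (frag_of s))"
      using singular_chain_boundary[of "Suc n" X "frag_of s"] add by (simp add: singular_chain_of)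
    have e: "chain_bd R (Suc n) (\<lambda>t. c t \<oplus> r \<otimes> frag_chain (frag_of s) t) =
      (\<lambda>t. chain_bd R (Suc n) c t \<oplus> r \<otimes> frag_chain (chain_boundary (Suc n) (frag_of s)) t)"
      using add frag_chain_of_closed[OF add(3)]
      by (simp add: chain_bd_add_smult[where X = X] chain_bd_of)
    have cl: "chain_bd R (Suc n) c \<in> carrier (chain_module R n X)"
      using add by (simp add: chain_bd_closed)
    have cl2: "(\<lambda>t. r \<otimes> frag_chain (chain_boundary (Suc n) (frag_of s)) t) \<in> carrier (chain_module R n X)"
      using add s by (simp add: chain_smult_closed frag_chain_closed)
    have "chain_pair \<delta> (\<lambda>t. chain_bd R (Suc n) c t \<oplus> r \<otimes> frag_chain (chain_boundary (Suc n) (frag_of s)) t) =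
       chain_pair \<delta> (chain_bd R (Suc n) c) \<oplus> chain_pair \<delta> (\<lambda>t. r \<otimes> frag_chain (chain_boundary (Suc n) (frag_of s)) t)"
      by (rule chain_pair_add) (use chain_carrierD[OF cl] chain_carrierD[OF cl2] \<delta> in auto)
    also have "chain_pair \<delta> (\<lambda>t. r \<otimes> frag_chain (chain_boundary (Suc n) (frag_of s)) t) =
        r \<otimes> chain_pair \<delta> (frag_chain (chain_boundary (Suc n) (frag_of s)))"
      by (rule chain_pair_smult) (use add \<delta> frag_chain_finite in auto)
    finally show ?case
      unfolding e using add cocycle by simp
  qed
  then show ?thesis using c by simp
qed

text \<open>The cocycles \<open>\<delta> j\<close> induce functionals on homology. Their matrix on
  the classes of the \<open>b k\<close> is diagonal with nonzero entries, so these classes are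
  independent. The dimension bounds independent sets once it is known to be finite, whence the first
  hypothesis.\<close>

lemma homology_dim_ge:
  fixes b :: "'j \<Rightarrow> ((nat \<Rightarrow> real) \<Rightarrow> 'e) \<Rightarrow> 'a"
  assumes fd: "vectorspace.fin_dim R (homology R n X)" and J: "finite J"
    and b: "\<And>j. j \<in> J \<Longrightarrow> b j \<in> cycles R n X"
    and \<delta>: "\<And>j s. j \<in> J \<Longrightarrow> \<delta> j s \<in> carrier R"
    and cocycle: "\<And>j s. j \<in> J \<Longrightarrow> singular_simplex (Suc n) X s \<Longrightarrow>
      chain_pair (\<delta> j) (frag_chain (chain_boundary (Suc n) (frag_of s))) = \<zero>"
    and off: "\<And>j k. j \<in> J \<Longrightarrow> k \<in> J \<Longrightarrow> j \<noteq> k \<Longrightarrow> chain_pair (\<delta> j) (b k) = \<zero>"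
    and diag: "\<And>j. j \<in> J \<Longrightarrow> chain_pair (\<delta> j) (b j) \<noteq> \<zero>"
  shows "card J \<le> homology_dim R n X"
proof -
  interpret V: vectorspace R "homology R n X" by (rule homology_vectorspace)
  let ?V = "homology R n X"
  \<comment> \<open>A class is evaluated at an arbitrary representative. Boundaries pair to zero, so
    the choice does not matter.\<close>
  define \<Phi> where "\<Phi> = (\<lambda>j U. chain_pair (\<delta> j) (SOME c. c \<in> U))"
  have \<Phi>: "\<Phi> j (hom_class n X c) = chain_pair (\<delta> j) c" if jj: "j \<in> J" and cc: "c \<in> cycles R n X" for j c
  proof -
    have "(SOME d. d \<in> hom_class n X c) \<in> hom_class n X c"
      using hom_class_self[OF cc] by (rule someI[where P = "\<lambda>d. d \<in> hom_class n X c"])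
    then obtain x where x: "x \<in> boundaries R n X" "(SOME d. d \<in> hom_class n X c) = (\<lambda>s. x s \<oplus> c s)"
      using hom_class_elem[OF cc] by blast
    have xC: "x \<in> carrier (chain_module R n X)"
      using x boundaries_subspace[of n X] unfolding chain_subspace_def by blast
    have cC: "c \<in> carrier (chain_module R n X)"
      using  jj cc by (auto simp: cycles_def)
    have "\<Phi> j (hom_class n X c) = chain_pair (\<delta> j) x \<oplus> chain_pair (\<delta> j) c"
      unfolding \<Phi>_def x(2)
      by (rule chain_pair_add) (use chain_carrierD[OF xC] chain_carrierD[OF cC] \<delta>  jj cc in auto)
    also have "chain_pair (\<delta> j) x = \<zero>"
      by (rule chain_pair_boundary) (use \<delta> cocycle x  jj cc in auto)
    finally show ?thesis
      using chain_carrierD[OF cC] \<delta>  jj cc by (simp add: chain_pair_closed)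
  qed
  have Z: "chain_subspace n X (cycles R n X)" by (rule cycles_subspace)
  have cyD: "c s \<in> carrier R" "finite {s. c s \<noteq> \<zero>}" if "c \<in> cycles R n X" for c s
    using chain_carrierD[of c n X] that by (auto simp: cycles_def)
  have \<Phi>R: "\<Phi> j v \<in> carrier R" if "j \<in> J" "v \<in> carrier ?V" for j v
    using that \<Phi> \<delta> cyD by (auto simp: homology_carrier chain_pair_closed)
  have \<Phi>add: "\<Phi> j (v \<oplus>\<^bsub>?V\<^esub> w) = \<Phi> j v \<oplus> \<Phi> j w" if j: "j \<in> J" and vw: "v \<in> carrier ?V" "w \<in> carrier ?V" for j v w
  proof -
    obtain c d where cd: "c \<in> cycles R n X" "v = hom_class n X c" "d \<in> cycles R n X" "w = hom_class n X d"
      using vw by (auto simp: homology_carrier)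
    have "(\<lambda>s. c s \<oplus> d s) \<in> cycles R n X" using Z cd by (auto simp: chain_subspace_def)
    moreover have "chain_pair (\<delta> j) (\<lambda>s. c s \<oplus> d s) = chain_pair (\<delta> j) c \<oplus> chain_pair (\<delta> j) d"
      by (rule chain_pair_add) (use cyD cd \<delta> j in auto)
    ultimately show ?thesis using cd j by (simp add: hom_class_add \<Phi>)
  qed
  have \<Phi>smult: "\<Phi> j (r \<odot>\<^bsub>?V\<^esub> v) = r \<otimes> \<Phi> j v" if j: "j \<in> J" and vw: "v \<in> carrier ?V" "r \<in> carrier R" for j v r
  proof -
    obtain c where cd: "c \<in> cycles R n X" "v = hom_class n X c"
      using vw by (auto simp: homology_carrier)
    have "(\<lambda>s. r \<otimes> c s) \<in> cycles R n X" using Z cd j vw by (auto simp: chain_subspace_def)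
    moreover have "chain_pair (\<delta> j) (\<lambda>s. r \<otimes> c s) = r \<otimes> chain_pair (\<delta> j) c"
      by (rule chain_pair_smult) (use cyD cd \<delta> j vw in auto)
    ultimately show ?thesis using cd j vw by (simp add: hom_class_smult \<Phi>)
  qed
  have \<Phi>zero: "\<Phi> j \<zero>\<^bsub>?V\<^esub> = \<zero>" if j: "j \<in> J" for j
  proof -
    have "(\<lambda>s. \<zero>) \<in> cycles R n X" using Z by (auto simp: chain_subspace_def)
    from \<Phi>[OF j this] show ?thesis by (simp add: hom_class_zero)
  qed
  have \<Phi>sum: "\<Phi> j (finsum ?V (\<lambda>v. a v \<odot>\<^bsub>?V\<^esub> v) A) = (\<Oplus>v\<in>A. a v \<otimes> \<Phi> j v)"
    if j: "j \<in> J" and A: "finite A" "A \<subseteq> carrier ?V" "a \<in> A \<rightarrow> carrier R" for j a A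
    using A
  proof (induction A)
    case empty
    then show ?case using \<Phi>zero[OF j] by simp
  next
    case (insert v A)
    have AV: "\<And>x. x \<in> A \<Longrightarrow> x \<in> carrier ?V" "\<And>x. x \<in> A \<Longrightarrow> a x \<in> carrier R"
      "v \<in> carrier ?V" "a v \<in> carrier R" using insert.prems by auto
    have "finsum ?V (\<lambda>v. a v \<odot>\<^bsub>?V\<^esub> v) (insert v A) = a v \<odot>\<^bsub>?V\<^esub> v \<oplus>\<^bsub>?V\<^esub> finsum ?V (\<lambda>v. a v \<odot>\<^bsub>?V\<^esub> v) A"
      by (rule V.M.finsum_insert) (use insert.hyps AV in auto)
    moreover have "finsum ?V (\<lambda>v. a v \<odot>\<^bsub>?V\<^esub> v) A \<in> carrier ?V"
      by (rule V.M.finsum_closed) (use AV in auto)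
    moreover have "(\<Oplus>v\<in>insert v A. a v \<otimes> \<Phi> j v) = a v \<otimes> \<Phi> j v \<oplus> (\<Oplus>v\<in>A. a v \<otimes> \<Phi> j v)"
      by (rule finsum_insert) (use insert.hyps AV \<Phi>R[OF j] in auto)
    ultimately show ?case
      using insert.IH insert.prems AV j by (simp add: \<Phi>add \<Phi>smult)
  qed
  let ?B = "(\<lambda>j. hom_class n X (b j)) ` J"
  have BV: "?B \<subseteq> carrier ?V" using b by (auto simp: homology_carrier)
  have \<Phi>B: "\<Phi> j (hom_class n X (b k)) = chain_pair (\<delta> j) (b k)" if "j \<in> J" "k \<in> J" for j k
    using \<Phi> b that by blast
  have inj: "inj_on (\<lambda>j. hom_class n X (b j)) J"
  proof (rule inj_onI, rule ccontr)
    fix j k assume "j \<in> J" "k \<in> J" "hom_class n X (b j) = hom_class n X (b k)" "j \<noteq> k"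
    then show False using \<Phi>B[of j j] \<Phi>B[of j k] off[of j k] diag[of j] by simp
  qed
  have "\<not> V.lin_dep ?B"
  proof
    assume "V.lin_dep ?B"
    then obtain A a v where A: "finite A" "A \<subseteq> ?B" "a \<in> A \<rightarrow> carrier R"
      "V.lincomb a A = \<zero>\<^bsub>?V\<^esub>" "v \<in> A" "a v \<noteq> \<zero>"
      unfolding V.lin_dep_def by blast
    then obtain j where j: "j \<in> J" "v = hom_class n X (b j)" by blast
    have AV: "\<And>x. x \<in> A \<Longrightarrow> x \<in> carrier ?V" "\<And>x. x \<in> A \<Longrightarrow> a x \<in> carrier R"
      using A(2,3) BV by auto
    note AR = m_closed[OF AV(2) \<Phi>R[OF j(1) AV(1)]]
    have "(\<Oplus>w\<in>A. a w \<otimes> \<Phi> j w) = \<zero>"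
      using \<Phi>sum[OF j(1) A(1) _ A(3)] A(2,4) BV \<Phi>zero[OF j(1)] by (auto simp: V.lincomb_def)
    moreover have "(\<Oplus>w\<in>A. a w \<otimes> \<Phi> j w) = (\<Oplus>w\<in>A. if w = v then a w \<otimes> \<Phi> j w else \<zero>)"
    proof (rule finsum_cong')
      fix w assume w: "w \<in> A"
      then obtain k where k: "k \<in> J" "w = hom_class n X (b k)" using A(2) by blast
      have aw: "a w \<in> carrier R" using w A(3) by blast
      show "a w \<otimes> \<Phi> j w = (if w = v then a w \<otimes> \<Phi> j w else \<zero>)"
      proof (cases "w = v")
        case False
        then have "j \<noteq> k" using j k by blast
        then show ?thesis using False aw \<Phi>B[OF j(1) k(1)] off[of j k] j k by simp
      qed simp
    qed (use AR in auto)
    moreover have "(\<Oplus>w\<in>A. if w = v then a w \<otimes> \<Phi> j w else \<zero>) = a v \<otimes> \<Phi> j v"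
      by (rule add.finprod_singleton_swap) (use A AR in auto)
    moreover have "\<Phi> j v \<noteq> \<zero>" "\<Phi> j v \<in> carrier R" "a v \<in> carrier R"
      using j \<Phi>B[of j j] diag[of j] \<Phi>R[of j v] A BV by auto
    ultimately show False using A(6) integral by metis
  qed
  then have "card ?B \<le> V.dim"
    using V.li_le_dim(2)[OF fd BV] by blast
  then show ?thesis
    using card_image[OF inj] by (simp add: homology_dim_def)
qed

text \<open>\<open>path_relation\<close> takes values in a type of class
  \<open>ab_group_add\<close>, whereas coefficients in \<open>R\<close> live on a carrier. Hence
  paths are read as integral chains, and \<open>W\<close> is pulled back along
  \<open>frag_chain\<close>.\<close>

lemma path_relation_chains:
  fixes E :: "'e::real_normed_vector set"
  assumes W: "chain_subspace 1 (top_of_set E) W" "boundaries R 1 (top_of_set E) \<subseteq> W"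
  shows "path_relation E {c. frag_chain c \<in> W} (\<lambda>f. frag_of (path_simplex f))"
proof
  show "0 \<in> {c. frag_chain c \<in> W}" using W(1) by (simp add: chain_subspace_def)
  show "x - y \<in> {c. frag_chain c \<in> W}" if xy: "x \<in> {c. frag_chain c \<in> W}" "y \<in> {c. frag_chain c \<in> W}" for x y
  proof -
    have "frag_chain (x - y) = (\<lambda>s. frag_chain x s \<oplus> (\<ominus> \<one>) \<otimes> frag_chain y s)"
      by (auto simp: frag_chain_diff a_minus_def l_minus)
    moreover have "(\<lambda>s. (\<ominus> \<one>) \<otimes> frag_chain y s) \<in> W"
      using W(1) xy(2) by (simp add: chain_subspace_def)
    ultimately show ?thesis using W(1) xy(1) by (simp add: chain_subspace_def)
  qed
  show "frag_of (path_simplex f) = frag_of (path_simplex g)" if "\<And>t. t \<in> {0..1} \<Longrightarrow> f t = g t"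
    for f g :: "real \<Rightarrow> 'e"
    using path_simplex_cong[OF that] by simp
  fix \<tau> :: "real \<times> real \<Rightarrow> 'e" assume \<tau>: "continuous_on triangle \<tau>" "\<tau> ` triangle \<subseteq> E"
  have s: "singular_simplex 2 (top_of_set E) (triangle_simplex \<tau>)"
    using \<tau> by (rule singular_triangle_simplex)
  have "chain_bd R 2 (frag_chain (frag_of (triangle_simplex \<tau>))) \<in> boundaries R 1 (top_of_set E)"
    using frag_chain_of_closed[OF s] by (auto simp: boundaries_def numeral_2_eq_2)
  then have "frag_chain (chain_boundary 2 (frag_of (triangle_simplex \<tau>))) \<in> W"
    using W(2) by (auto simp: chain_bd_of)
  then show "frag_of (path_simplex (\<lambda>t. \<tau> (t, 0))) + frag_of (path_simplex (\<lambda>t. \<tau> (1 - t, t)))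
      - frag_of (path_simplex (\<lambda>t. \<tau> (0, t))) \<in> {c. frag_chain c \<in> W}"
    by (simp add: chain_boundary_triangle_simplex algebra_simps)
qed

lemma minus_smult_regroup:
  assumes "a \<in> carrier R" "b \<in> carrier R" "r \<in> carrier R" "x \<in> carrier R" "y \<in> carrier R" "z \<in> carrier R"
  shows "(a \<ominus> b) \<oplus> r \<otimes> ((x \<ominus> y) \<oplus> z) = (a \<oplus> r \<otimes> x) \<ominus> (b \<oplus> r \<otimes> (y \<ominus> z))"
  using assms by (simp add: a_minus_def r_distr r_minus minus_add a_ac)

text \<open>With a chosen path from \<open>e0\<close> to every point, each 1-simplex closes up to a
  loop. So modulo \<open>W\<close> a chain equals what its boundary becomes when points are replaced
  by their chosen paths, and for a cycle this is 0.\<close>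

lemma cycles_subset_if_loops:
  fixes E :: "'e::real_normed_vector set"
  assumes E: "path_connected E" "E \<noteq> {}"
    and W: "chain_subspace 1 (top_of_set E) W" "boundaries R 1 (top_of_set E) \<subseteq> W"
    and loops: "\<And>f. path f \<Longrightarrow> path_image f \<subseteq> E \<Longrightarrow> pathfinish f = pathstart f \<Longrightarrow>
      frag_chain (frag_of (path_simplex f)) \<in> W"
  shows "cycles R 1 (top_of_set E) \<subseteq> W"
proof
  fix z assume z: "z \<in> cycles R 1 (top_of_set E)"
  interpret path_relation E "{c. frag_chain c \<in> W}" "\<lambda>f. frag_of (path_simplex f)"
    by (rule path_relation_chains[OF W])
  obtain e0 where e0: "e0 \<in> E" using E(2) by blast
  define \<gamma> where "\<gamma> = (\<lambda>x. SOME g. path g \<and> path_image g \<subseteq> E \<and> pathstart g = e0 \<and> pathfinish g = x)"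
  have \<gamma>: "path (\<gamma> x)" "path_image (\<gamma> x) \<subseteq> E" "pathstart (\<gamma> x) = e0" "pathfinish (\<gamma> x) = x" if "x \<in> E" for x
  proof -
    have "\<exists>g. path g \<and> path_image g \<subseteq> E \<and> pathstart g = e0 \<and> pathfinish g = x"
      using E(1) e0 that by (auto simp: path_connected_def)
    from someI_ex[OF this] show "path (\<gamma> x)" "path_image (\<gamma> x) \<subseteq> E" "pathstart (\<gamma> x) = e0" "pathfinish (\<gamma> x) = x"
      by (auto simp: \<gamma>_def)
  qed
  \<comment> \<open>The only point of the standard 0-simplex; evaluation there recovers the point
    that a 0-simplex represents.\<close>
  define v0 :: "nat \<Rightarrow> real" where "v0 = (\<lambda>j. if j = 0 then 1 else 0)"
  define L where "L = (\<lambda>x. frag_of (path_simplex (\<gamma> x)))"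
  define g where "g = (\<lambda>s :: (nat \<Rightarrow> real) \<Rightarrow> 'e. frag_chain (L (s v0)))"
  have gR: "g s t \<in> carrier R" for s t by (simp add: g_def)
  have Wadd: "(\<lambda>s. c s \<oplus> d s) \<in> W" if "c \<in> W" "d \<in> W" for c d
    using W(1) that unfolding chain_subspace_def by blast
  have Wsm: "(\<lambda>s. r \<otimes> c s) \<in> W" if "r \<in> carrier R" "c \<in> W" for r c
    using W(1) that unfolding chain_subspace_def by blast
  have gp: "g (point_simplex x) = frag_chain (L x)" for x
    by (simp add: g_def point_simplex_def v0_def standard_simplex_0)
  \<comment> \<open>The loop goes from \<open>e0\<close> to the start of f, along f, and back from
    its end to \<open>e0\<close>.\<close>
  have key: "frag_chain (frag_of (path_simplex f) - L (pathfinish f) + L (pathstart f)) \<in> W"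
    if f: "path f" "path_image f \<subseteq> E" for f
  proof -
    let ?x = "pathstart f" and ?y = "pathfinish f"
    have xy: "?x \<in> E" "?y \<in> E" using f by (auto simp: path_image_def pathstart_def pathfinish_def image_subset_iff)
    let ?h = "\<gamma> ?x +++ f"
    have h: "path ?h" "path_image ?h \<subseteq> E" using \<gamma>[OF xy(1)] f by (auto simp: path_image_join)
    let ?l = "?h +++ reversepath (\<gamma> ?y)"
    have l: "path ?l" "path_image ?l \<subseteq> E" "pathfinish ?l = pathstart ?l"
      using \<gamma>[OF xy(1)] \<gamma>[OF xy(2)] f h by (auto simp: path_image_join)
    have 1: "L ?x + frag_of (path_simplex f) - frag_of (path_simplex ?h) \<in> {c. frag_chain c \<in> W}"
      unfolding L_def by (rule lam_join) (use \<gamma>[OF xy(1)] f in auto)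
    have 2: "frag_of (path_simplex ?h) + frag_of (path_simplex (reversepath (\<gamma> ?y))) - frag_of (path_simplex ?l) \<in> {c. frag_chain c \<in> W}"
      by (rule lam_join) (use \<gamma>[OF xy(2)] h f in auto)
    have 3: "L ?y + frag_of (path_simplex (reversepath (\<gamma> ?y))) \<in> {c. frag_chain c \<in> W}"
      unfolding L_def by (rule lam_reversepath) (use \<gamma>[OF xy(2)] in auto)
    have 4: "frag_of (path_simplex ?l) \<in> {c. frag_chain c \<in> W}" using loops[OF l] by simp
    have "L ?x + frag_of (path_simplex f) - frag_of (path_simplex ?h)
       + (frag_of (path_simplex ?h) + frag_of (path_simplex (reversepath (\<gamma> ?y))) - frag_of (path_simplex ?l)
       + frag_of (path_simplex ?l)) - (L ?y + frag_of (path_simplex (reversepath (\<gamma> ?y)))) \<in> {c. frag_chain c \<in> W}"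
      by (rule W_diff[OF W_add[OF 1 W_add[OF 2 4]] 3])
    then show ?thesis by (simp add: algebra_simps)
  qed
  have zC: "z \<in> carrier (chain_module R 1 (top_of_set E))" using z by (simp add: cycles_def)
  \<comment> \<open>The claim is made for all chains, because the partial sums of a cycle need not
    be cycles.\<close>
  then have "(\<lambda>t. z t \<ominus> chain_ext g (chain_bd R 1 z) t) \<in> W"
  proof (induction rule: chain_induct)
    case zero
    then show ?case using W(1) by (simp add: chain_bd_zero chain_ext_def a_minus_def chain_subspace_def)
  next
    case (add c r s)
    obtain f where f: "path f" "path_image f \<subseteq> E" "s = path_simplex f"
      using add(3) by (rule singular_simplex1E)
    have cC: "c t \<in> carrier R" for t using chain_carrierD(1)[OF add(1)] .
    have bc: "chain_bd R 1 c \<in> carrier (chain_module R 0 (top_of_set E))"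
      using chain_bd_closed[of c 0] add(1) by simp
    have bs: "chain_bd R 1 (frag_chain (frag_of s)) =
        frag_chain (frag_of (point_simplex (pathfinish f)) - frag_of (point_simplex (pathstart f)))"
      using chain_boundary_path_simplex[of f] by (simp add: chain_bd_of f(3))
    have b: "chain_bd R 1 (\<lambda>t. c t \<oplus> r \<otimes> frag_chain (frag_of s) t) =
        (\<lambda>t. chain_bd R 1 c t \<oplus> r \<otimes> chain_bd R 1 (frag_chain (frag_of s)) t)"
      using add frag_chain_of_closed[OF add(3)] by (simp add: chain_bd_add_smult[where X = "top_of_set E"])
    have e: "chain_ext g (chain_bd R 1 (\<lambda>t. c t \<oplus> r \<otimes> frag_chain (frag_of s) t)) t =
        chain_ext g (chain_bd R 1 c) t \<oplus> r \<otimes> (frag_chain (L (pathfinish f)) t \<ominus> frag_chain (L (pathstart f)) t)" for t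
    proof -
      have "chain_ext g (chain_bd R 1 (\<lambda>t. c t \<oplus> r \<otimes> frag_chain (frag_of s) t)) t =
         chain_ext g (chain_bd R 1 c) t \<oplus>
         chain_pair (\<lambda>s. g s t) (\<lambda>t. r \<otimes> chain_bd R 1 (frag_chain (frag_of s)) t)"
        unfolding b chain_ext_def
      proof (rule chain_pair_add)
        show "finite {t. r \<otimes> chain_bd R 1 (frag_chain (frag_of s)) t \<noteq> \<zero>}"
          unfolding bs
          by (rule finite_subset[OF _ frag_chain_finite[of "frag_of (point_simplex (pathfinish f)) - frag_of (point_simplex (pathstart f))"]])
            (use add(2) in auto)
        show "r \<otimes> chain_bd R 1 (frag_chain (frag_of s)) t \<in> carrier R" for t
          unfolding bs using add(2) by simp
      qed (use chain_carrierD[OF bc] gR in auto)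
      also have "chain_pair (\<lambda>s. g s t) (\<lambda>t. r \<otimes> chain_bd R 1 (frag_chain (frag_of s)) t) =
          r \<otimes> chain_pair (\<lambda>s. g s t) (chain_bd R 1 (frag_chain (frag_of s)))"
        unfolding bs by (rule chain_pair_smult) (use add(2) frag_chain_finite gR in auto)
      also have "chain_pair (\<lambda>s. g s t) (chain_bd R 1 (frag_chain (frag_of s))) =
          frag_chain (L (pathfinish f)) t \<ominus> frag_chain (L (pathstart f)) t"
        unfolding bs using gR by (simp add: chain_pair_frag_diff chain_pair_of gp)
      finally show ?thesis .
    qed
    have extR: "chain_ext g (chain_bd R 1 c) t \<in> carrier R" for t
      unfolding chain_ext_def using chain_carrierD[OF bc] gR by (simp add: chain_pair_closed)
    have "(\<lambda>t. (c t \<ominus> chain_ext g (chain_bd R 1 c) t) \<oplus>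
        r \<otimes> frag_chain (frag_of (path_simplex f) - L (pathfinish f) + L (pathstart f)) t) \<in> W"
      by (rule Wadd[OF add.IH Wsm[OF add(2) key[OF f(1,2)]]])
    moreover have "(c t \<ominus> chain_ext g (chain_bd R 1 c) t) \<oplus>
        r \<otimes> frag_chain (frag_of (path_simplex f) - L (pathfinish f) + L (pathstart f)) t =
        (c t \<oplus> r \<otimes> frag_chain (frag_of s) t) \<ominus> chain_ext g (chain_bd R 1 (\<lambda>t. c t \<oplus> r \<otimes> frag_chain (frag_of s) t)) t" for t
      unfolding e unfolding f(3) frag_chain_add frag_chain_diff
      by (rule minus_smult_regroup[OF cC extR add(2)]) (rule frag_chain_carrier)+
    ultimately show ?case by simp
  qed
  moreover have "chain_bd R 1 z = (\<lambda>t. \<zero>)" using z by (simp add: cycles_def)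
  moreover have "(\<lambda>t. z t \<ominus> \<zero>) = z" using chain_carrierD(1)[OF zC] by (auto simp: a_minus_def)
  ultimately show "z \<in> W" by (simp add: chain_ext_def)
qed

end

section \<open>Seifert fibred covers: solid torus charts around the exceptional fibres\<close>

section \<open>The Seifert fibred covers\<close>

context path_relation
begin

text \<open>The square is cut as for loops; here the tracks of the end points are constant, and each
  of them lies in \<open>W\<close>.\<close>

lemma lam_homotopic_paths:
  assumes "homotopic_paths E f g"
  shows "lam f - lam g \<in> W"
proof -
  obtain h where h: "continuous_on ({0..1} \<times> {0..1::real}) h" "h ` ({0..1} \<times> {0..1}) \<subseteq> E"
    "\<And>x. x \<in> {0..1} \<Longrightarrow> h (0, x) = f x" "\<And>x. x \<in> {0..1} \<Longrightarrow> h (1, x) = g x"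
    "\<And>t. t \<in> {0..1::real} \<Longrightarrow> h (t, 0) = pathstart f \<and> h (t, 1) = pathfinish f"
    using assms unfolding homotopic_paths image_subset_iff_funcset[symmetric]
    by (auto simp: pathstart_def pathfinish_def)
  let ?S = "{0..1::real} \<times> {0..1::real}"
  have S: "convex ?S" by (intro convex_Times) auto
  have 1: "lam (h \<circ> linepath (0,0) (0,1)) + lam (h \<circ> linepath (0,1) (1,1)) - lam (h \<circ> linepath (0,0) (1,1)) \<in> W"
    by (rule lam_affine[OF S h(1,2)]) auto
  have 2: "lam (h \<circ> linepath (0,0) (1,0)) + lam (h \<circ> linepath (1,0) (1,1)) - lam (h \<circ> linepath (0,0) (1,1)) \<in> W"
    by (rule lam_affine[OF S h(1,2)]) auto
  have e: "lam (h \<circ> linepath (0,0) (0,1)) = lam f" "lam (h \<circ> linepath (1,0) (1,1)) = lam g"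
    "lam (h \<circ> linepath (0,1) (1,1)) = lam (h \<circ> linepath (0,1) (0,1))"
    "lam (h \<circ> linepath (0,0) (1,0)) = lam (h \<circ> linepath (0,0) (0,0))"
    using h(3-5) by (auto intro!: lam_cong simp: linepath_def)
  have c: "lam (h \<circ> linepath (0,1) (0,1)) \<in> W" "lam (h \<circ> linepath (0,0) (0,0)) \<in> W"
    by (rule lam_affine_const[OF S h(1,2)]; simp)+
  show ?thesis
    using W_diff[OF W_diff[OF 1 2] W_diff[OF c]] unfolding e by (simp add: algebra_simps)
qed

text \<open>In a convex set a path can be moved linearly to the segment between its ends.\<close>

lemma lam_convex_path:
  fixes \<kappa> :: "'b::real_normed_vector \<Rightarrow> 'a"
  assumes S: "convex S" and \<kappa>: "continuous_on S \<kappa>" "\<kappa> ` S \<subseteq> E"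
    and g: "path g" "path_image g \<subseteq> S"
  shows "lam (\<kappa> \<circ> g) - lam (\<kappa> \<circ> linepath (pathstart g) (pathfinish g)) \<in> W"
proof (rule lam_homotopic_paths)
  have "homotopic_paths S g (linepath (pathstart g) (pathfinish g))"
  proof (rule homotopic_paths_linear)
    fix t :: real assume t: "t \<in> {0..1}"
    have "g t \<in> S" "pathstart g \<in> S" "pathfinish g \<in> S"
      using g t by (auto simp: path_image_def pathstart_def pathfinish_def)
    moreover from this have "linepath (pathstart g) (pathfinish g) t \<in> S"
      using t S by (metis closed_segment_subset linepath_in_path path_image_linepath subsetD)
    ultimately show "closed_segment (g t) (linepath (pathstart g) (pathfinish g) t) \<subseteq> S"
      using S closed_segment_subset by blast
  qed (use g in auto)
  then show "homotopic_paths E (\<kappa> \<circ> g) (\<kappa> \<circ> linepath (pathstart g) (pathfinish g))"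
    by (rule homotopic_paths_continuous_image[OF _ \<kappa>(1)]) (use \<kappa>(2) in auto)
qed

text \<open>The starting point can be moved because the segments from 0 to x and from
  \<open>P\<close> to x + \<open>P\<close> have the same composite with \<open>\<kappa>\<close>.
  Then periods are added up, and negative multiples are reversed.\<close>

lemma lam_periodic:
  fixes \<kappa> :: "real \<Rightarrow> 'a"
  assumes \<kappa>: "continuous_on UNIV \<kappa>" "range \<kappa> \<subseteq> E" and P: "\<And>x. \<kappa> (x + P) = \<kappa> x"
    and W: "lam (\<kappa> \<circ> linepath 0 P) \<in> W"
  shows "lam (\<kappa> \<circ> linepath x (x + of_int k * P)) \<in> W"
proof -
  have a: "lam (\<kappa> \<circ> linepath x y) + lam (\<kappa> \<circ> linepath y z) - lam (\<kappa> \<circ> linepath x z) \<in> W" for x y z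
    by (rule lam_affine[OF convex_UNIV \<kappa>]) auto
  have r: "lam (\<kappa> \<circ> linepath x y) + lam (\<kappa> \<circ> linepath y x) \<in> W" for x y
    by (rule lam_affine_reverse[OF convex_UNIV \<kappa>]) auto
  have one: "lam (\<kappa> \<circ> linepath x (x + P)) \<in> W" for x
  proof -
    have "\<kappa> \<circ> linepath P (x + P) = \<kappa> \<circ> linepath 0 x"
      using P by (auto simp: fun_eq_iff linepath_def algebra_simps) (metis add.commute)
    then have "lam (\<kappa> \<circ> linepath 0 P) + lam (\<kappa> \<circ> linepath 0 x) - lam (\<kappa> \<circ> linepath 0 (x + P)) \<in> W"
      using a[of 0 P "x + P"] by simp
    from W_add[OF W_diff[OF a[of 0 x "x + P"] this] W]
    show ?thesis by (simp add: algebra_simps)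
  qed
  have nat: "lam (\<kappa> \<circ> linepath x (x + of_nat m * P)) \<in> W" for x m
  proof (induction m)
    case 0
    have "x + of_nat 0 * P = x" by simp
    then show ?case using lam_affine_const[OF convex_UNIV \<kappa> UNIV_I] by (simp only:)
  next
    case (Suc m)
    have "lam (\<kappa> \<circ> linepath (x + of_nat m * P) (x + of_nat (Suc m) * P)) \<in> W"
      using one[of "x + of_nat m * P"] by (simp add: algebra_simps)
    from W_diff[OF W_add[OF Suc this] a[of x "x + of_nat m * P" "x + of_nat (Suc m) * P"]]
    show ?case by (simp only: diff_diff_eq2 add_diff_cancel_left')
  qed
  show ?thesis
  proof (cases "k \<ge> 0")
    case True
    then show ?thesis using nat[of x "nat k"] by simp
  next
    case False
    then have "lam (\<kappa> \<circ> linepath (x + of_int k * P) x) \<in> W"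
      using nat[of "x + of_int k * P" "nat (- k)"] by simp
    from W_diff[OF r[of x "x + of_int k * P"] this] show ?thesis by simp
  qed
qed

end

definition seifert_space :: "nat \<Rightarrow> nat \<Rightarrow> (complex \<times> complex \<times> complex) set" where
  "seifert_space p N = {(u, v, y). cmod v = 1 \<and> y \<noteq> 0 \<and> u ^ p = v * (1 + y ^ N)}"

text \<open>The roots of y^N = -1, indexed by all integers with period \<open>N\<close>, so that
  neighbouring indices differ by one all the way round.\<close>

definition cone_point :: "nat \<Rightarrow> int \<Rightarrow> complex" where
  "cone_point N j = cis (pi * (2 * of_int j + 1) / N)"

definition core_loop :: "nat \<Rightarrow> int \<Rightarrow> real \<Rightarrow> complex \<times> complex \<times> complex" where
  "core_loop N j t = (0, cis (2 * pi * t), cone_point N j)"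

text \<open>A lift of the circle of radius 1/2 around y = 0. There y^N is too small for 1 + y^N to
  reach the cut of \<open>Ln\<close>, so the principal p-th root is continuous and closes
  up.\<close>

definition base_section :: "nat \<Rightarrow> nat \<Rightarrow> real \<Rightarrow> complex \<times> complex \<times> complex" where
  "base_section p N \<beta> = (exp (Ln (1 + (cis \<beta> / 2) ^ N) / p), 1, cis \<beta> / 2)"

locale seifert =
  fixes p N :: nat
  assumes p_pos: "p > 0" and N_ge: "N \<ge> 2"
begin

abbreviation "E \<equiv> seifert_space p N"

text \<open>The range of the logarithmic coordinate \<open>\<xi>\<close> of y relative to a cone
  point. Cone points are 2 pi / N apart in angle: the half-width 3 pi / (2 N) excludes the
  neighbours but exceeds half that distance, so adjacent sectors overlap. Since
  \<open>N \<ge> 2\<close> it is below pi, where the principal logarithm inverts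
  \<open>exp\<close>.\<close>

definition strip :: "complex set" where
  "strip = {\<xi>. \<bar>Im \<xi>\<bar> < 3 * pi / (2 * N)}"

lemma strip_convex: "convex strip"
proof -
  have "strip = {\<xi>. Im \<xi> < 3 * pi / (2 * N)} \<inter> {\<xi>. Im \<xi> > - (3 * pi / (2 * N))}"
    by (auto simp: strip_def)
  then show ?thesis
    by (simp add: convex_Int convex_halfspace_Im_lt convex_halfspace_Im_gt)
qed

lemma strip_open: "open strip"
  unfolding strip_def by (intro open_Collect_less continuous_intros)

lemma strip_less_pi: "\<xi> \<in> strip \<Longrightarrow> \<bar>Im \<xi>\<bar> < pi"
proof -
  have "3 * pi / (2 * N) \<le> 3 * pi / 4"
    using N_ge by (intro divide_left_mono) auto
  then show "\<xi> \<in> strip \<Longrightarrow> \<bar>Im \<xi>\<bar> < pi" using pi_gt_zero by (auto simp: strip_def)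
qed

lemma Ln_exp_strip: "\<xi> \<in> strip \<Longrightarrow> Ln (exp \<xi>) = \<xi>"
  using strip_less_pi[of \<xi>] by (intro Ln_exp) auto

lemma cone_point_power: "cone_point N j ^ N = -1"
proof -
  have "cone_point N j ^ N = cis (pi + 2 * pi * of_int j)"
  proof -
    have "real N * (pi * (2 * of_int j + 1) / N) = pi + 2 * pi * of_int j"
      using N_ge by (simp add: field_simps)
    then show ?thesis unfolding cone_point_def Complex.DeMoivre by (simp only:)
  qed
  also have "\<dots> = cis pi" by (simp add: cis_mult[symmetric] cis_multiple_2pi)
  finally show ?thesis by simp
qed

lemma cone_point_nz [simp]: "cone_point N j \<noteq> 0"
  by (simp add: cone_point_def)

lemma one_plus_power: "1 + (cone_point N j * exp \<xi>) ^ N = 1 - exp (of_nat N * \<xi> :: complex)"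
  by (simp add: power_mult_distrib cone_point_power exp_of_nat_mult)

text \<open>The zeros of 1 - exp (N \<open>\<xi>\<close>) are the integer multiples of 2 pi i / N,
  and those other than 0 lie outside the strip.\<close>

lemma one_minus_exp_zero:
  assumes "\<xi> \<in> strip" "1 - exp (of_nat N * \<xi>) = 0"
  shows "\<xi> = 0"
proof -
  have "exp (of_nat N * \<xi>) = 1" using assms by simp
  then obtain n :: int where n: "N * Re \<xi> = 0" "N * Im \<xi> = of_int (2 * n) * pi"
    by (auto simp: exp_eq_1)
  have Np: "real N > 0" using N_ge by simp
  have "\<bar>N * Im \<xi>\<bar> < 3 * pi / 2"
    using assms(1) Np by (simp add: strip_def abs_mult field_simps)
  then have "\<bar>of_int (2 * n)\<bar> * pi < (3/2) * pi"
    unfolding n(2) by (simp add: abs_mult)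
  then have "\<bar>real_of_int (2 * n)\<bar> < 3/2" using pi_gt_zero by (metis mult_less_cancel_right_pos)
  then have "n = 0" by linarith
  then show ?thesis using n Np by (simp add: complex_eq_iff)
qed

text \<open>
  Writing \<open>y = cone_point N j * exp \<xi>\<close> and \<open>u = r * root_factor \<xi>\<close> turns the equation
  \<open>u ^ p = v * (1 + y ^ N)\<close> into \<open>r ^ p = v * \<xi>\<close>, which is invariant under scaling \<open>r\<close> to 0.
\<close>

lemma root_factor_exists:
  "\<exists>G. continuous_on strip G \<and> (\<forall>\<xi>\<in>strip. G \<xi> \<noteq> 0 \<and> \<xi> * G \<xi> ^ p = 1 - exp (of_nat N * \<xi>))"
proof -
  \<comment> \<open>The singularity of the quotient at 0 is removable and is filled with the
    derivative -N of the numerator. Having no zero on the contractible strip, \<open>g\<close> has a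
    logarithm and thus a p-th root.\<close>
  define g where "g = (\<lambda>\<xi> :: complex. if \<xi> = 0 then - of_nat N else (1 - exp (of_nat N * \<xi>)) / \<xi>)"
  have "isCont g \<xi>" for \<xi>
  proof (cases "\<xi> = 0")
    case True
    have "((\<lambda>\<xi>. 1 - exp (of_nat N * \<xi>)) has_field_derivative - of_nat N) (at (0::complex))"
      by (auto intro!: derivative_eq_intros)
    then have "((\<lambda>\<xi>. (1 - exp (of_nat N * \<xi>)) / \<xi>) \<longlongrightarrow> - of_nat N) (at (0::complex))"
      by (simp add: has_field_derivative_iff)
    moreover have "\<forall>\<^sub>F \<xi> in at 0. (1 - exp (of_nat N * \<xi>)) / \<xi> = g \<xi>"
      by (auto simp: g_def eventually_at_filter)
    ultimately have "(g \<longlongrightarrow> - of_nat N) (at 0)"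
      by (rule Lim_transform_eventually)
    then show ?thesis using True by (simp add: isCont_def g_def)
  next
    case False
    have "isCont (\<lambda>\<xi>. (1 - exp (of_nat N * \<xi>)) / \<xi>) \<xi>"
      using False by (intro continuous_intros) auto
    moreover have "\<forall>\<^sub>F x in nhds \<xi>. (1 - exp (of_nat N * x)) / x = g x"
      using t1_space_nhds[OF False] by eventually_elim (simp add: g_def)
    ultimately show ?thesis by (rule iffD1[OF isCont_cong, rotated])
  qed
  then have "continuous_on strip g" by (simp add: continuous_at_imp_continuous_on)
  moreover have nz: "g \<xi> \<noteq> 0" if "\<xi> \<in> strip" for \<xi>
    using one_minus_exp_zero[OF that] N_ge by (auto simp: g_def)
  ultimately obtain h where h: "continuous_on strip h" "\<And>\<xi>. \<xi> \<in> strip \<Longrightarrow> g \<xi> = exp (h \<xi>)"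
    using continuous_logarithm_on_contractible[of strip g] convex_imp_contractible[OF strip_convex] by metis
  show ?thesis
  proof (intro exI[of _ "\<lambda>\<xi>. exp (h \<xi> / p)"] conjI ballI)
    show "continuous_on strip (\<lambda>\<xi>. exp (h \<xi> / p))"
      using h(1) p_pos by (intro continuous_intros) auto
    fix \<xi> assume \<xi>: "\<xi> \<in> strip"
    have "exp (h \<xi> / p) ^ p = g \<xi>"
      using p_pos h(2)[OF \<xi>] by (simp flip: exp_of_nat_mult)
    then show "\<xi> * exp (h \<xi> / p) ^ p = 1 - exp (of_nat N * \<xi>)" by (simp add: g_def)
  qed simp
qed

definition root_factor :: "complex \<Rightarrow> complex" where
  "root_factor = (SOME G. continuous_on strip G \<and>
      (\<forall>\<xi>\<in>strip. G \<xi> \<noteq> 0 \<and> \<xi> * G \<xi> ^ p = 1 - exp (of_nat N * \<xi>)))"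

lemma root_factor:
  shows "continuous_on strip root_factor"
    and "\<xi> \<in> strip \<Longrightarrow> root_factor \<xi> \<noteq> 0"
    and "\<xi> \<in> strip \<Longrightarrow> \<xi> * root_factor \<xi> ^ p = 1 - exp (of_nat N * \<xi>)"
  using someI_ex[OF root_factor_exists] unfolding root_factor_def by blast+

text \<open>An open solid torus around an exceptional fibre, with \<open>\<xi>\<close> = r^p / v.
  Its core is r = 0.\<close>

definition chart :: "int \<Rightarrow> complex \<times> complex \<Rightarrow> complex \<times> complex \<times> complex" where
  "chart j = (\<lambda>(r, v). (r * root_factor (r ^ p / v), v, cone_point N j * exp (r ^ p / v)))"

definition chart_dom :: "(complex \<times> complex) set" where
  "chart_dom = {(r, v). cmod v = 1 \<and> r ^ p / v \<in> strip}"

definition sector :: "int \<Rightarrow> (complex \<times> complex \<times> complex) set" where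
  "sector j = {(u, v, y) \<in> E. y \<in> (\<lambda>\<xi>. cone_point N j * exp \<xi>) ` strip}"

lemma sector_subset: "sector j \<subseteq> E"
  by (auto simp: sector_def)

text \<open>On the strip \<open>Ln\<close> inverts \<open>exp\<close>. This description of the
  sector yields its openness and a continuous \<open>\<xi>\<close> along paths.\<close>

lemma sector_Ln:
  "y \<in> (\<lambda>\<xi>. cone_point N j * exp \<xi>) ` strip \<longleftrightarrow>
     y / cone_point N j \<notin> \<real>\<^sub>\<le>\<^sub>0 \<and> Ln (y / cone_point N j) \<in> strip"
proof
  assume "y \<in> (\<lambda>\<xi>. cone_point N j * exp \<xi>) ` strip"
  then obtain \<xi> where \<xi>: "\<xi> \<in> strip" "y = cone_point N j * exp \<xi>" by auto
  then have "y / cone_point N j = exp \<xi>" by simp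
  moreover have "exp \<xi> \<notin> \<real>\<^sub>\<le>\<^sub>0"
  proof
    assume "exp \<xi> \<in> \<real>\<^sub>\<le>\<^sub>0"
    then have "Re (exp \<xi>) \<le> 0" "Im (exp \<xi>) = 0"
      by (auto simp only: complex_nonpos_Reals_iff)
    moreover have "exp \<xi> \<noteq> 0" by simp
    ultimately have "Re (exp \<xi>) < 0"
      by (metis complex_eqI less_le zero_complex.simps)
    then have "Im (Ln (exp \<xi>)) = pi"
      using \<open>Im (exp \<xi>) = 0\<close> Im_Ln_eq_pi[of "exp \<xi>"] by simp
    then show False using Ln_exp_strip[OF \<xi>(1)] strip_less_pi[OF \<xi>(1)] by simp
  qed
  ultimately show "y / cone_point N j \<notin> \<real>\<^sub>\<le>\<^sub>0 \<and> Ln (y / cone_point N j) \<in> strip"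
    using Ln_exp_strip[OF \<xi>(1)] \<xi>(1) by simp
next
  assume a: "y / cone_point N j \<notin> \<real>\<^sub>\<le>\<^sub>0 \<and> Ln (y / cone_point N j) \<in> strip"
  then have "y / cone_point N j \<noteq> 0" by auto
  then have "y = cone_point N j * exp (Ln (y / cone_point N j))" by simp
  then show "y \<in> (\<lambda>\<xi>. cone_point N j * exp \<xi>) ` strip" using a by blast
qed

lemma sector_openin: "openin (top_of_set E) (sector j)"
proof -
  have o: "open ((\<lambda>\<xi>. cone_point N j * exp \<xi>) ` strip)"
  proof -
    have "open (- \<real>\<^sub>\<le>\<^sub>0 \<inter> Ln -` strip)"
      using strip_open by (intro continuous_open_preimage continuous_intros) auto
    then have "open ((\<lambda>y. y / cone_point N j) -` (- \<real>\<^sub>\<le>\<^sub>0 \<inter> Ln -` strip))"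
      by (intro open_vimage continuous_intros) auto
    moreover have "(\<lambda>y. y / cone_point N j) -` (- \<real>\<^sub>\<le>\<^sub>0 \<inter> Ln -` strip) = (\<lambda>\<xi>. cone_point N j * exp \<xi>) ` strip"
      using sector_Ln[of _ j] by auto
    ultimately show ?thesis by simp
  qed
  have "open ((\<lambda>x. snd (snd x)) -` ((\<lambda>\<xi>. cone_point N j * exp \<xi>) ` strip) :: (complex \<times> complex \<times> complex) set)"
    by (rule open_vimage[OF o]) (intro continuous_intros)
  moreover have "sector j = E \<inter> (\<lambda>x. snd (snd x)) -` ((\<lambda>\<xi>. cone_point N j * exp \<xi>) ` strip)"
    by (auto simp: sector_def)
  ultimately show ?thesis by (auto intro: openin_open_Int)
qed

lemma chart_continuous: "continuous_on chart_dom (chart j)"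
proof -
  have nz: "v \<noteq> 0" if "(r, v) \<in> chart_dom" for r v using that by (auto simp: chart_dom_def)
  have c: "continuous_on chart_dom (\<lambda>(r, v). r ^ p / v)"
    unfolding case_prod_unfold by (intro continuous_intros) (use nz in auto)
  have "continuous_on chart_dom (\<lambda>x. root_factor ((\<lambda>(r, v). r ^ p / v) x))"
    by (rule continuous_on_compose2[OF root_factor(1) c]) (auto simp: chart_dom_def)
  then show ?thesis
    using c unfolding chart_def case_prod_unfold by (intro continuous_intros) (use nz in auto)
qed

lemma chart_image: "chart j ` chart_dom = sector j"
proof (intro equalityI subsetI)
  fix x assume "x \<in> chart j ` chart_dom"
  then obtain r v where rv: "cmod v = 1" "r ^ p / v \<in> strip" "x = chart j (r, v)"
    by (auto simp: chart_dom_def)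
  let ?\<xi> = "r ^ p / v"
  have "v \<noteq> 0" using rv by auto
  then have "(r * root_factor ?\<xi>) ^ p = v * (?\<xi> * root_factor ?\<xi> ^ p)"
    by (simp add: power_mult_distrib)
  also have "\<dots> = v * (1 + (cone_point N j * exp ?\<xi>) ^ N)"
    using root_factor(3)[OF rv(2)] by (simp add: one_plus_power)
  finally show "x \<in> sector j"
    using rv by (auto simp: chart_def sector_def seifert_space_def)
next
  fix x assume "x \<in> sector j"
  then obtain u v \<xi> where x: "x = (u, v, cone_point N j * exp \<xi>)" "\<xi> \<in> strip" "cmod v = 1"
    "u ^ p = v * (1 + (cone_point N j * exp \<xi>) ^ N)"
    by (auto simp: sector_def seifert_space_def)
  define r where "r = u / root_factor \<xi>"
  have "v \<noteq> 0" using x by auto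
  have nz: "root_factor \<xi> \<noteq> 0" using root_factor(2)[OF x(2)] .
  have "u ^ p = v * (\<xi> * root_factor \<xi> ^ p)"
    using root_factor(3)[OF x(2)] x(4) by (simp add: one_plus_power)
  then have "r ^ p / v = \<xi>"
    using nz \<open>v \<noteq> 0\<close> by (simp add: r_def power_divide)
  then have "chart j (r, v) = x" "(r, v) \<in> chart_dom"
    using x root_factor(2)[OF x(2)] by (auto simp: chart_def r_def chart_dom_def)
  then show "x \<in> chart j ` chart_dom" by (metis image_eqI)
qed

text \<open>Scaling r by s multiplies r^p / v by s^p, which moves it towards 0 within the convex
  strip.\<close>

lemma chart_dom_scale:
  assumes "(r, v) \<in> chart_dom" "0 \<le> s" "s \<le> 1"
  shows "(of_real s * r, v) \<in> chart_dom"
proof -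
  have "(of_real s * r) ^ p / v = (s ^ p) *\<^sub>R (r ^ p / v)"
    by (simp add: power_mult_distrib scaleR_conv_of_real)
  moreover have "0 \<le> s ^ p" "s ^ p \<le> 1" using assms by (auto simp: power_le_one)
  moreover have "0 \<in> strip" using N_ge by (simp add: strip_def)
  ultimately show ?thesis
    using assms strip_convex convexD_alt[of strip 0 "r ^ p / v" "s ^ p"] by (simp add: chart_dom_def)
qed

text \<open>Scaling r to 0 in the chart, with v kept fixed, pushes the loop into the core.\<close>

lemma sector_loop_homotopic:
  assumes f: "path f" "path_image f \<subseteq> sector j" "pathfinish f = pathstart f"
  shows "\<exists>v. path v \<and> (\<forall>t\<in>{0..1}. cmod (v t) = 1) \<and> pathfinish v = pathstart v \<and>
     homotopic_loops (sector j) (\<lambda>t. (0, v t, cone_point N j)) f"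
proof -
  define v where "v = (\<lambda>t. fst (snd (f t)))"
  define \<xi> where "\<xi> = (\<lambda>t. Ln (snd (snd (f t)) / cone_point N j))"
  define r where "r = (\<lambda>t. fst (f t) / root_factor (\<xi> t))"
  have cf: "continuous_on {0..1} f" using f by (simp add: path_def)
  have fs: "f t \<in> sector j" if "t \<in> {0..1}" for t using f that by (auto simp: path_image_def)
  have s: "snd (snd (f t)) / cone_point N j \<notin> \<real>\<^sub>\<le>\<^sub>0" "\<xi> t \<in> strip" if "t \<in> {0..1}" for t
    using fs[OF that] sector_Ln by (auto simp: sector_def \<xi>_def)
  have cv: "continuous_on {0..1} v" unfolding v_def by (intro continuous_intros cf)
  have c\<xi>: "continuous_on {0..1} \<xi>" unfolding \<xi>_def using s by (intro continuous_intros cf) auto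
  have cr: "continuous_on {0..1} r" unfolding r_def
  proof (intro continuous_intros cf)
    show "continuous_on {0..1} (\<lambda>t. root_factor (\<xi> t))"
      by (rule continuous_on_compose2[OF root_factor(1) c\<xi>]) (use s in auto)
    show "\<forall>t\<in>{0..1}. root_factor (\<xi> t) \<noteq> 0" using s root_factor(2) by blast
  qed
  have rv: "(r t, v t) \<in> chart_dom \<and> chart j (r t, v t) = f t" if t: "t \<in> {0..1}" for t
  proof -
    obtain r' v' where x: "(r', v') \<in> chart_dom" "f t = chart j (r', v')"
      using fs[OF t] unfolding chart_image[symmetric] by auto
    then have "\<xi> t = r' ^ p / v'"
      unfolding \<xi>_def chart_def chart_dom_def using Ln_exp_strip by auto
    then have "r t = r'" "v t = v'"
      using x root_factor(2)[OF s(2)[OF t]] by (auto simp: r_def v_def chart_def)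
    then show ?thesis using x by simp
  qed
  have loop: "r 1 = r 0" "v 1 = v 0"
    using f(3) by (auto simp: r_def v_def \<xi>_def pathfinish_def pathstart_def)
  have c0: "chart j (0, v') = (0, v', cone_point N j)" for v'
    by (simp add: chart_def zero_power[OF p_pos])
  define H where "H = (\<lambda>(s, t). chart j (of_real s * r t, v t))"
  have "homotopic_loops (sector j) (\<lambda>t. (0, v t, cone_point N j)) f"
    unfolding homotopic_loops
  proof (intro exI[of _ H] conjI)
    have k: "continuous_on ({0..1::real} \<times> {0..1}) (\<lambda>x. (of_real (fst x) * r (snd x), v (snd x)))"
      by (intro continuous_intros continuous_on_compose2[OF cr] continuous_on_compose2[OF cv]) auto
    show "continuous_on ({0..1} \<times> {0..1}) H"
      unfolding H_def case_prod_unfold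
      by (rule continuous_on_compose2[OF chart_continuous k]) (use rv chart_dom_scale in auto)
    show "H \<in> {0..1} \<times> {0..1} \<rightarrow> sector j"
      unfolding H_def chart_image[symmetric] using rv chart_dom_scale by auto
    show "\<forall>x\<in>{0..1}. H (0, x) = (0, v x, cone_point N j)" by (simp add: H_def c0)
    show "\<forall>x\<in>{0..1}. H (1, x) = f x" using rv by (simp add: H_def)
    show "\<forall>t\<in>{0..1}. pathfinish (H \<circ> Pair t) = pathstart (H \<circ> Pair t)"
      by (simp add: H_def pathfinish_def pathstart_def loop)
  qed
  moreover have "cmod (v t) = 1" if "t \<in> {0..1}" for t
    using rv[OF that] by (auto simp: chart_dom_def)
  ultimately show ?thesis
    using cv loop by (intro exI[of _ v]) (auto simp: path_def pathfinish_def pathstart_def)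
qed

lemma sector_path_connected: "path_connected (sector j)"
proof -
  \<comment> \<open>The coordinate v is unrolled to an angle, so that points can be joined by
    straight segments: to r = 0, and from there along the core.\<close>
  define D where "D = {(r, \<tau> :: real). (r, cis \<tau>) \<in> chart_dom}"
  have "path_component D (r, \<tau>) (0, 0)" if x: "(r, \<tau>) \<in> D" for r \<tau>
  proof -
    have "closed_segment (r, \<tau>) (0, \<tau>) \<subseteq> D"
    proof
      fix z assume "z \<in> closed_segment (r, \<tau>) (0, \<tau>)"
      then obtain s where s: "0 \<le> s" "s \<le> 1" "z = (1 - s) *\<^sub>R (r, \<tau>) + s *\<^sub>R (0, \<tau>)"
        by (auto simp: closed_segment_def)
      then have "z = (of_real (1 - s) * r, \<tau>)" by (simp add: scaleR_conv_of_real algebra_simps)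
      then show "z \<in> D" using chart_dom_scale[of r "cis \<tau>" "1 - s"] x s by (simp add: D_def)
    qed
    moreover have "closed_segment (0, \<tau>) (0, 0) \<subseteq> D"
    proof
      fix z assume "z \<in> closed_segment (0 :: complex, \<tau>) (0, 0)"
      then obtain s where s: "0 \<le> s" "s \<le> 1" "z = (1 - s) *\<^sub>R (0, \<tau>) + s *\<^sub>R (0, 0)"
        by (auto simp: closed_segment_def)
      then show "z \<in> D" using N_ge by (simp add: D_def chart_dom_def strip_def zero_power[OF p_pos])
    qed
    ultimately have "path_component D (r, \<tau>) (0, \<tau>)" "path_component D (0, \<tau>) (0, 0)"
      unfolding path_component_def
      by (metis path_image_linepath path_linepath pathfinish_linepath pathstart_linepath)+
    then show ?thesis by (rule path_component_trans)
  qed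
  then have "path_connected D"
    unfolding path_connected_component
    by (metis (no_types) path_component_sym path_component_trans surj_pair)
  then have "path_connected ((\<lambda>(r, \<tau>). chart j (r, cis \<tau>)) ` D)"
  proof (rule path_connected_continuous_image[rotated])
    show "continuous_on D (\<lambda>(r, \<tau>). chart j (r, cis \<tau>))"
      unfolding case_prod_unfold
      by (rule continuous_on_compose2[OF chart_continuous]) (auto intro!: continuous_intros simp: D_def)
  qed
  moreover have "(\<lambda>(r, \<tau>). chart j (r, cis \<tau>)) ` D = sector j"
  proof -
    have "(\<lambda>(r, \<tau>). (r, cis \<tau>)) ` D = chart_dom"
    proof (intro equalityI subsetI)
      fix x assume x: "x \<in> chart_dom"
      then obtain r v where rv: "x = (r, v)" "cmod v = 1" by (auto simp: chart_dom_def)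
      then have "v = cis (Arg v)" using rcis_cmod_Arg[of v] by (simp add: rcis_def)
      then show "x \<in> (\<lambda>(r, \<tau>). (r, cis \<tau>)) ` D"
        using rv x by (intro image_eqI[of _ _ "(r, Arg v)"]) (auto simp: D_def)
    qed (auto simp: D_def)
    then show ?thesis
      unfolding chart_image[symmetric] by (force simp: image_iff)
  qed
  ultimately show ?thesis by simp
qed

end

section \<open>Overlaps of neighbouring sectors and connectedness of the cover\<close>

context seifert
begin

definition cone_angle :: "int \<Rightarrow> real" where
  "cone_angle j = pi * (2 * of_int j + 1) / N"

text \<open>The angle halfway between the cone points j and j + 1.\<close>

definition gap_angle :: "int \<Rightarrow> real" where
  "gap_angle j = 2 * pi * (of_int j + 1) / N"

lemma N_pos: "real N > 0"
  using N_ge by simp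

lemma cone_point_cis: "cone_point N j = cis (cone_angle j)"
  by (simp add: cone_point_def cone_angle_def)

lemma cone_angle_add: "cone_angle (j + m * int N) = cone_angle j + 2 * pi * of_int m"
  using N_pos by (simp add: cone_angle_def field_simps)

lemma cone_point_add: "cone_point N (j + m * int N) = cone_point N j"
  by (simp add: cone_point_cis cone_angle_add cis_mult[symmetric] cis_multiple_2pi)

lemma sector_add: "sector (j + m * int N) = sector j"
  by (simp add: sector_def cone_point_add)

lemma gap_angle_add: "gap_angle (j + m * int N) = gap_angle j + of_int m * (2 * pi)"
  using N_pos by (simp add: gap_angle_def field_simps)

lemma cone_point_succ: "cone_point N (j + 1) = cone_point N j * cis (2 * pi / N)"
proof -
  have "cone_angle (j + 1) = cone_angle j + 2 * pi / N"
    using N_pos by (simp add: cone_angle_def field_simps)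
  then show ?thesis by (simp add: cone_point_cis cis_mult)
qed

lemma exp_polar: "exp \<xi> = of_real (exp (Re \<xi>)) * cis (Im \<xi>)"
  by (simp add: exp_eq_polar)

lemma base_section_Re: "Re (1 + (cis \<beta> / 2) ^ N) > 0"
proof -
  have "cmod ((cis \<beta> / 2) ^ N) = (1/2) ^ N"
    by (simp add: norm_power norm_divide)
  also have "\<dots> \<le> (1/2) ^ 1" using N_ge by (intro power_decreasing) auto
  finally have "\<bar>Re ((cis \<beta> / 2) ^ N)\<bar> \<le> 1/2"
    using abs_Re_le_cmod[of "(cis \<beta> / 2) ^ N"] by simp
  then show ?thesis by simp
qed

lemma base_section_in: "base_section p N \<beta> \<in> E"
proof -
  let ?w = "1 + (cis \<beta> / 2) ^ N"
  have "?w \<noteq> 0" using base_section_Re[of \<beta>] by (metis less_irrefl zero_complex.sel(1))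
  then have "exp (Ln ?w / p) ^ p = ?w"
    using p_pos by (simp flip: exp_of_nat_mult)
  then show ?thesis by (simp add: base_section_def seifert_space_def)
qed

lemma base_section_continuous: "continuous_on UNIV (base_section p N)"
proof -
  have "1 + (cis \<beta> / 2) ^ N \<notin> \<real>\<^sub>\<le>\<^sub>0" for \<beta>
    using base_section_Re[of \<beta>] by (auto simp only: complex_nonpos_Reals_iff)
  then show ?thesis
    unfolding base_section_def using p_pos by (intro continuous_intros) auto
qed

lemma base_section_periodic: "base_section p N (\<beta> + 2 * pi) = base_section p N \<beta>"
  by (simp add: base_section_def cis_mult[symmetric])

lemma base_section_sector:
  assumes "\<bar>\<beta> - cone_angle j\<bar> < 3 * pi / (2 * N)"
  shows "base_section p N \<beta> \<in> sector j"
proof -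
  let ?\<xi> = "Complex (- ln 2) (\<beta> - cone_angle j)"
  have "cis \<beta> / 2 = cone_point N j * exp ?\<xi>"
    by (simp add: exp_polar cone_point_cis exp_minus cis_divide[symmetric] field_simps)
  moreover have "?\<xi> \<in> strip" using assms by (simp add: strip_def)
  ultimately show ?thesis
    using base_section_in[of \<beta>] by (auto simp: sector_def base_section_def)
qed

lemma gap_in_sector: "base_section p N (gap_angle j) \<in> sector j"
proof (rule base_section_sector)
  have "gap_angle j - cone_angle j = pi / N"
    using N_pos by (simp add: gap_angle_def cone_angle_def field_simps)
  then have "\<bar>gap_angle j - cone_angle j\<bar> = pi / N" using N_pos by simp
  also have "\<dots> < 3 * pi / (2 * N)" using N_pos by (simp add: field_simps)
  finally show "\<bar>gap_angle j - cone_angle j\<bar> < 3 * pi / (2 * N)" .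
qed

lemma arc_in_sector:
  assumes "\<beta> \<in> closed_segment (gap_angle (j + 1)) (gap_angle j)"
  shows "base_section p N \<beta> \<in> sector (j + 1)"
proof (rule base_section_sector)
  have "gap_angle j = cone_angle (j + 1) - pi / N" "gap_angle (j + 1) = cone_angle (j + 1) + pi / N"
    using N_pos by (simp_all add: gap_angle_def cone_angle_def field_simps)
  moreover have "pi / N > 0" using N_pos by simp
  ultimately have "\<bar>\<beta> - cone_angle (j + 1)\<bar> \<le> pi / N"
    using assms by (auto simp: closed_segment_eq_real_ivl split: if_splits)
  also have "\<dots> < 3 * pi / (2 * N)" using N_pos by (simp add: field_simps)
  finally show "\<bar>\<beta> - cone_angle (j + 1)\<bar> < 3 * pi / (2 * N)" .
qed

text \<open>The overlap of the sectors j and j + 1 on the side between their cone points, centred at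
  \<open>gap_angle j\<close>. Seen from cone point j + 1, its angles run from -3 pi / (2 N) to -pi /
  (2 N).\<close>

definition band :: "int \<Rightarrow> (complex \<times> complex \<times> complex) set" where
  "band j = {(u, v, y) \<in> E. \<exists>\<xi>. pi / (2 * N) < Im \<xi> \<and> Im \<xi> < 3 * pi / (2 * N) \<and> y = cone_point N j * exp \<xi>}"

lemma band_subset: "band j \<subseteq> sector j" "band j \<subseteq> sector (j + 1)"
proof -
  have pN: "pi / N > 0" using N_pos by simp
  show "band j \<subseteq> sector j"
  proof
    fix x assume "x \<in> band j"
    then obtain u v \<xi> where x: "x = (u, v, cone_point N j * exp \<xi>)" "x \<in> E"
      "pi / (2 * N) < Im \<xi>" "Im \<xi> < 3 * pi / (2 * N)"
      by (auto simp: band_def)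
    have "\<xi> \<in> strip" using x(3,4) pN by (simp add: strip_def abs_less_iff)
    then show "x \<in> sector j" using x by (auto simp: sector_def)
  qed
  show "band j \<subseteq> sector (j + 1)"
  proof
    fix x assume "x \<in> band j"
    then obtain u v \<xi> where x: "x = (u, v, cone_point N j * exp \<xi>)" "x \<in> E"
      "pi / (2 * N) < Im \<xi>" "Im \<xi> < 3 * pi / (2 * N)"
      by (auto simp: band_def)
    let ?\<eta> = "\<xi> - \<i> * of_real (2 * pi / N)"
    have "cone_point N (j + 1) * exp ?\<eta> = cone_point N j * exp \<xi>"
    proof -
      have "exp ?\<eta> = exp \<xi> / cis (2 * pi / N)" by (simp add: exp_diff cis_conv_exp)
      then show ?thesis unfolding cone_point_succ by simp
    qed
    moreover have "?\<eta> \<in> strip"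
    proof -
      have "Im ?\<eta> = Im \<xi> - 2 * (pi / N)" by simp
      moreover have "pi / (2 * N) = (pi / N) / 2" "3 * pi / (2 * N) = 3 * (pi / N) / 2" by simp_all
      ultimately show ?thesis using x(3,4) pN unfolding strip_def mem_Collect_eq by linarith
    qed
    ultimately show "x \<in> sector (j + 1)" using x by (force simp: sector_def image_iff)
  qed
qed

lemma gap_in_band: "base_section p N (gap_angle j) \<in> band j"
proof -
  let ?\<xi> = "Complex (- ln 2) (pi / N)"
  have "gap_angle j = cone_angle j + pi / N"
    using N_pos by (simp add: gap_angle_def cone_angle_def field_simps)
  then have "cis (gap_angle j) / 2 = cone_point N j * exp ?\<xi>"
    by (simp add: exp_polar cone_point_cis exp_minus cis_mult[symmetric] field_simps)
  moreover have "pi / (2 * N) < Im ?\<xi>" "Im ?\<xi> < 3 * pi / (2 * N)"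
    using N_pos by (simp_all add: field_simps)
  ultimately show ?thesis
    using base_section_in[of "gap_angle j"] unfolding band_def base_section_def by blast
qed

text \<open>No cone point lies over the band, so v is determined by u and y. With the argument of u
  as free parameter and v = u^p / w no p-th root has to be chosen, and the band becomes the image of
  a convex set.\<close>

lemma band_path_connected: "path_connected (band j)"
proof -
  let ?S = "{\<xi>. Im \<xi> > pi / (2 * N)} \<inter> {\<xi>. Im \<xi> < 3 * pi / (2 * N)}"
  define w where "w = (\<lambda>\<xi>. 1 - exp (of_nat N * \<xi> :: complex))"
  define m where "m = (\<lambda>(\<xi>, \<tau>). let u = cis \<tau> * of_real (root p (cmod (w \<xi>))) in
     (u, u ^ p / w \<xi>, cone_point N j * exp \<xi>))"
  have S: "convex (?S \<times> (UNIV :: real set))"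
    by (intro convex_Times convex_Int convex_halfspace_Im_gt convex_halfspace_Im_lt) simp
  have nz: "w \<xi> \<noteq> 0" if "\<xi> \<in> ?S" for \<xi>
  proof
    assume "w \<xi> = 0"
    moreover have "pi / (2 * N) > 0" using N_pos by simp
    moreover from this have "\<xi> \<in> strip" using that unfolding strip_def by auto
    ultimately have "\<xi> = 0" using one_minus_exp_zero unfolding w_def by blast
    then show False using that \<open>pi / (2 * N) > 0\<close> by simp
  qed
  have "continuous_on (?S \<times> UNIV) m"
    unfolding m_def Let_def case_prod_unfold w_def
    using nz by (intro continuous_intros) (auto simp: w_def)
  then have "path_connected (m ` (?S \<times> UNIV))"
    using convex_imp_path_connected[OF S] by (rule path_connected_continuous_image)
  moreover have "m ` (?S \<times> UNIV) = band j"
  proof (intro equalityI subsetI)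
    fix x assume "x \<in> m ` (?S \<times> UNIV)"
    then obtain \<xi> \<tau> where x: "\<xi> \<in> ?S" "x = m (\<xi>, \<tau>)" by auto
    define u where "u = cis \<tau> * of_real (root p (cmod (w \<xi>)))"
    have "cmod (u ^ p) = cmod (w \<xi>)"
      using p_pos by (simp add: u_def norm_mult norm_power real_root_ge_zero flip: power_abs)
    then have "cmod (u ^ p / w \<xi>) = 1" using nz[OF x(1)] by (simp add: norm_divide)
    moreover have "u ^ p = u ^ p / w \<xi> * w \<xi>" using nz[OF x(1)] by simp
    moreover have "w \<xi> = 1 + (cone_point N j * exp \<xi>) ^ N" by (simp add: one_plus_power w_def)
    ultimately have "(u, u ^ p / w \<xi>, cone_point N j * exp \<xi>) \<in> E"
      by (simp add: seifert_space_def)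
    then show "x \<in> band j" using x unfolding m_def band_def u_def by (auto simp: Let_def)
  next
    fix x assume "x \<in> band j"
    then obtain u v \<xi> where x: "x = (u, v, cone_point N j * exp \<xi>)" "x \<in> E" "\<xi> \<in> ?S"
      by (auto simp: band_def)
    have e: "u ^ p = v * w \<xi>" "cmod v = 1"
      using x by (auto simp: seifert_space_def one_plus_power w_def)
    have "cmod u ^ p = cmod (w \<xi>)"
      using e by (metis mult_1 norm_mult norm_power)
    then have "root p (cmod (w \<xi>)) = cmod u"
      using p_pos by (metis norm_ge_zero real_root_power_cancel)
    then have "u = cis (Arg u) * of_real (root p (cmod (w \<xi>)))"
      using rcis_cmod_Arg[of u] by (simp add: rcis_def mult.commute)
    moreover have "v = u ^ p / w \<xi>" using e nz[OF x(3)] by simp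
    ultimately have "x = m (\<xi>, Arg u)" unfolding m_def Let_def x(1) by simp
    then show "x \<in> m ` (?S \<times> UNIV)" using x(3) by blast
  qed
  ultimately show ?thesis by simp
qed

lemma sector_cover:
  assumes "e \<in> E"
  obtains j where "e \<in> sector j"
proof -
  obtain u v y where e: "e = (u, v, y)" "y \<noteq> 0" using assms by (auto simp: seifert_space_def)
  \<comment> \<open>The cone point whose angle is within pi / N of the argument of y.\<close>
  define j where "j = \<lfloor>Arg y * N / (2 * pi)\<rfloor>"
  let ?\<xi> = "Complex (ln (cmod y)) (Arg y - cone_angle j)"
  have "y = cis (Arg y) * of_real (cmod y)" using rcis_cmod_Arg[of y] by (simp add: rcis_def mult.commute)
  then have "y = cone_point N j * exp ?\<xi>"
    using e(2) by (simp add: exp_polar cone_point_cis cis_divide[symmetric] field_simps)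
  moreover have "?\<xi> \<in> strip"
  proof -
    have 1: "of_int j \<le> Arg y * N / (2 * pi)" "Arg y * N / (2 * pi) < of_int j + 1"
      unfolding j_def by linarith+
    have "of_int j * (2 * pi / N) \<le> Arg y" "Arg y < (of_int j + 1) * (2 * pi / N)"
      using 1 N_pos pi_gt_zero by (simp_all add: field_simps)
    moreover have "cone_angle j = of_int j * (2 * pi / N) + pi / N"
      using N_pos by (simp add: cone_angle_def field_simps)
    moreover have "(of_int j + 1) * (2 * pi / N) = of_int j * (2 * pi / N) + 2 * (pi / N)"
      by (simp add: algebra_simps add_divide_distrib)
    ultimately have "\<bar>Arg y - cone_angle j\<bar> \<le> pi / N" by linarith
    also have "\<dots> < 3 * pi / (2 * N)" using N_pos by (simp add: field_simps)
    finally show ?thesis by (simp add: strip_def)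
  qed
  ultimately have "e \<in> sector j" using assms e by (auto simp: sector_def)
  then show ?thesis by (rule that)
qed

text \<open>Every sector is connected and meets the base section, whose range is connected.\<close>

lemma seifert_path_connected: "path_connected E"
proof -
  let ?b = "base_section p N"
  have "path_connected (range ?b)"
    by (rule path_connected_continuous_image[OF base_section_continuous]) simp
  then have b: "path_component E (?b x) (?b y)" for x y
    unfolding path_connected_component
    by (intro path_component_of_subset[of "range ?b" E]) (use base_section_in in blast)+
  have "path_component E e (?b 0)" if e: "e \<in> E" for e
  proof -
    obtain j where j: "e \<in> sector j" using e by (rule sector_cover)
    then have "path_component (sector j) e (?b (gap_angle j))"
      using sector_path_connected gap_in_sector by (auto simp: path_connected_component)
    then have "path_component E e (?b (gap_angle j))"
      using sector_subset path_component_of_subset by blast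
    then show ?thesis using b by (rule path_component_trans)
  qed
  then show ?thesis
    unfolding path_connected_component by (meson path_component_sym path_component_trans)
qed

text \<open>In units of pi / N the strips have half-width 3/2 and consecutive centres are at
  distance 2, so after a shift of k by a multiple of \<open>N\<close> the indices differ by at most
  1. The shift depends on \<open>e\<close>: for N = 2 the same two sectors meet along two
  bands.\<close>

lemma sector_overlap:
  assumes "e \<in> sector j" "e \<in> sector k"
  obtains m where "j = k + m * int N"
    | m where "j = k + m * int N + 1" "e \<in> band (k + m * int N)"
    | m where "k + m * int N = j + 1" "e \<in> band j"
proof -
  obtain u v \<xi> where \<xi>: "e = (u, v, cone_point N j * exp \<xi>)" "\<xi> \<in> strip" "e \<in> E"
    using assms(1) by (auto simp: sector_def)
  obtain \<eta> where \<eta>: "cone_point N k * exp \<eta> = cone_point N j * exp \<xi>" "\<eta> \<in> strip"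
    using assms(2) \<xi>(1) by (auto simp: sector_def)
  have "exp (\<xi> + \<i> * cone_angle j) = exp (\<eta> + \<i> * cone_angle k)"
    using \<eta>(1) by (simp add: exp_add cone_point_cis cis_conv_exp mult.commute)
  then obtain n :: int where "\<xi> + \<i> * cone_angle j = \<eta> + \<i> * cone_angle k + (of_int (2 * n) * pi) * \<i>"
    unfolding exp_eq by blast
  then have n: "Im \<xi> + cone_angle j = Im \<eta> + cone_angle k + 2 * of_int n * pi"
    by (simp add: complex_eq_iff)
  \<comment> \<open>The ambiguity of the logarithm is absorbed by the index: n full turns shift k by
    n N.\<close>
  define k' where "k' = k + n * int N"
  define a where "a = pi / N"
  have a: "a > 0" using N_pos by (simp add: a_def)
  have s: "\<bar>Im \<xi>\<bar> < 3 * a / 2" "\<bar>Im \<eta>\<bar> < 3 * a / 2"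
    using \<xi>(2) \<eta>(2) by (simp_all add: strip_def a_def)
  have "cone_angle k' = cone_angle k + 2 * of_int n * pi"
    unfolding k'_def cone_angle_add by simp
  moreover have "cone_angle j - cone_angle k' = 2 * a * of_int (j - k')"
    using N_pos by (simp add: cone_angle_def a_def field_simps)
  ultimately have d: "Im \<eta> - Im \<xi> = 2 * a * of_int (j - k')" using n by linarith
  define l where "l = real_of_int (j - k')"
  have "\<bar>2 * a * l\<bar> < 3 * a" using s d unfolding l_def by linarith
  moreover have "\<bar>2 * a * l\<bar> = a * (2 * \<bar>l\<bar>)" using a by (simp add: abs_mult)
  ultimately have "a * (2 * \<bar>l\<bar>) < a * 3" by (simp only: mult.commute[of 3 a])
  then have "2 * \<bar>l\<bar> < 3" using a by (simp only: mult_less_cancel_left_pos)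
  then have "\<bar>l\<bar> < 2" by simp
  then have "\<bar>j - k'\<bar> < 2" unfolding l_def by linarith
  then have "j - k' = 0 \<or> j - k' = 1 \<or> j - k' = -1" by linarith
  then show ?thesis
  proof (elim disjE)
    assume "j - k' = 0"
    then show ?thesis using that(1)[of n] by (simp add: k'_def)
  next
    assume jk: "j - k' = 1"
    then have "Im \<eta> = Im \<xi> + 2 * a" using d by simp
    then have "a / 2 < Im \<eta>" "Im \<eta> < 3 * a / 2" using s by linarith+
    moreover have "cone_point N j * exp \<xi> = cone_point N k' * exp \<eta>"
      using \<eta>(1) by (simp add: k'_def cone_point_add)
    ultimately have "e \<in> band k'"
      using \<xi>(1,3) unfolding band_def a_def by (auto simp: field_simps intro!: exI[of _ \<eta>])
    then show ?thesis using that(2)[of n] jk by (simp add: k'_def)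
  next
    assume jk: "j - k' = -1"
    then have "Im \<xi> = Im \<eta> + 2 * a" using d by simp
    then have "a / 2 < Im \<xi>" "Im \<xi> < 3 * a / 2" using s by linarith+
    then have "e \<in> band j"
      using \<xi>(1,3) unfolding band_def a_def by (auto simp: field_simps intro!: exI[of _ \<xi>])
    then show ?thesis using that(3)[of n] jk by (simp add: k'_def)
  qed
qed

end

section \<open>Generators of first homology, and the relation between the exceptional fibres\<close>

locale seifert_relation = seifert p N + path_relation "seifert_space p N" W lam
  for p N and W :: "'g::ab_group_add set" and lam
begin

lemma core_line:
  defines "\<kappa> \<equiv> \<lambda>j x. (0, cis x, cone_point N j)"
  shows "continuous_on UNIV (\<kappa> j)" "range (\<kappa> j) \<subseteq> E" "\<kappa> j (x + 2 * pi) = \<kappa> j x"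
    "lam (\<kappa> j \<circ> linepath 0 (2 * pi)) = lam (core_loop N j)"
proof -
  show "continuous_on UNIV (\<kappa> j)" unfolding \<kappa>_def by (intro continuous_intros)
  show "range (\<kappa> j) \<subseteq> E"
    by (auto simp: \<kappa>_def seifert_space_def cone_point_power zero_power[OF p_pos])
  show "\<kappa> j (x + 2 * pi) = \<kappa> j x" by (simp add: \<kappa>_def cis_mult[symmetric])
  show "lam (\<kappa> j \<circ> linepath 0 (2 * pi)) = lam (core_loop N j)"
    by (rule lam_cong) (simp add: \<kappa>_def core_loop_def linepath_def mult.commute)
qed

text \<open>The loop is deformed into the core, its angle is lifted to the real line, and the lift
  is straightened to a segment whose length is a multiple of 2 pi.\<close>

lemma sector_loop:
  assumes core: "lam (core_loop N j) \<in> W"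
    and f: "path f" "path_image f \<subseteq> sector j" "pathfinish f = pathstart f"
  shows "lam f \<in> W"
proof -
  obtain v where v: "path v" "\<And>t. t \<in> {0..1} \<Longrightarrow> cmod (v t) = 1" "pathfinish v = pathstart v"
    "homotopic_loops (sector j) (\<lambda>t. (0, v t, cone_point N j)) f"
    using sector_loop_homotopic[OF f] by blast
  let ?k = "\<lambda>x. (0, cis x, cone_point N j)"
  have "continuous_on {0..1} v" using v(1) by (simp add: path_def)
  moreover have "v t \<noteq> 0" if "t \<in> {0..1}" for t using v(2)[OF that] by auto
  ultimately obtain q where q: "continuous_on {0..1} q" "\<And>t. t \<in> {0..1} \<Longrightarrow> v t = exp (q t)"
    using continuous_logarithm_on_contractible[of "{0..1}" v] convex_imp_contractible by (metis convex_real_interval(5))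
  define \<tau> where "\<tau> = (\<lambda>t. Im (q t))"
  have \<tau>: "path \<tau>" unfolding \<tau>_def path_def by (intro continuous_intros q)
  have v\<tau>: "v t = cis (\<tau> t)" if "t \<in> {0..1}" for t
  proof -
    have "v t = of_real (exp (Re (q t))) * cis (\<tau> t)" using q(2)[OF that] by (simp add: exp_polar \<tau>_def)
    moreover have "exp (Re (q t)) = 1" using v(2)[OF that] q(2)[OF that] by simp
    ultimately show ?thesis by simp
  qed
  have "cis (\<tau> 1) = cis (\<tau> 0)"
    using v(3) v\<tau>[of 0] v\<tau>[of 1] by (simp add: pathfinish_def pathstart_def)
  then obtain k :: int where k: "\<tau> 1 = \<tau> 0 + 2 * pi * of_int k"
    using sin_cos_eq_iff[of "\<tau> 1" "\<tau> 0"] by (auto simp: complex_eq_iff)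
  have "lam (?k \<circ> \<tau>) - lam (?k \<circ> linepath (pathstart \<tau>) (pathfinish \<tau>)) \<in> W"
    by (rule lam_convex_path[OF convex_UNIV core_line(1,2)]) (use \<tau> in auto)
  moreover have "lam (?k \<circ> linepath (\<tau> 0) (\<tau> 0 + of_int k * (2 * pi))) \<in> W"
    by (rule lam_periodic[OF core_line(1,2)]) (use core core_line(3,4) in auto)
  ultimately have "lam (?k \<circ> \<tau>) \<in> W"
    using W_sub_left k by (simp add: pathstart_def pathfinish_def mult.commute mult.left_commute)
  moreover have "lam (?k \<circ> \<tau>) = lam (\<lambda>t. (0, v t, cone_point N j))"
    by (rule lam_cong) (simp add: v\<tau>)
  moreover have "lam (\<lambda>t. (0, v t, cone_point N j)) - lam f \<in> W"
    by (rule lam_homotopic_loops[OF homotopic_loops_subset[OF v(4) sector_subset]])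
  ultimately show ?thesis using W_sub_left by auto
qed

text \<open>By the hypothesis on the cores, a path inside a sector depends modulo \<open>W\<close>
  on its ends only. The hypothesis on the arc makes the resulting potential independent of the
  number of turns around y = 0, so it is globally defined modulo \<open>W\<close>, and it does not
  change along a closed path.\<close>

lemma loops_in_W:
  assumes arc: "lam (base_section p N \<circ> linepath 0 (2 * pi)) \<in> W"
    and core: "\<And>j. lam (core_loop N j) \<in> W"
    and f: "path f" "path_image f \<subseteq> E" "pathfinish f = pathstart f"
  shows "lam f \<in> W"
proof -
  let ?b = "base_section p N"
  define A where "A = (\<lambda>x y. lam (?b \<circ> linepath x y))"
  have bE: "range ?b \<subseteq> E" using base_section_in by auto
  have A: "A x y + A y z - A x z \<in> W" for x y z
    unfolding A_def by (rule lam_affine[OF convex_UNIV base_section_continuous bE]) auto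
  have Ap: "A x (x + of_int k * (2 * pi)) \<in> W" for x k
    unfolding A_def by (rule lam_periodic[OF base_section_continuous bE base_section_periodic arc])
  define P where "P = (\<lambda>j e. SOME g. path g \<and> path_image g \<subseteq> sector j \<and> pathstart g = ?b (gap_angle j) \<and> pathfinish g = e)"
  have P: "path (P j e)" "path_image (P j e) \<subseteq> sector j" "pathstart (P j e) = ?b (gap_angle j)" "pathfinish (P j e) = e"
    if e: "e \<in> sector j" for j e
  proof -
    have "\<exists>g. path g \<and> path_image g \<subseteq> sector j \<and> pathstart g = ?b (gap_angle j) \<and> pathfinish g = e"
      using sector_path_connected[of j] e gap_in_sector[of j] by (auto simp: path_connected_def)
    from someI_ex[OF this] show "path (P j e)" "path_image (P j e) \<subseteq> sector j"
      "pathstart (P j e) = ?b (gap_angle j)" "pathfinish (P j e) = e"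
      unfolding P_def by blast+
  qed
  have ends: "lam f - lam g \<in> W"
    if "path f" "path_image f \<subseteq> sector j" "path g" "path_image g \<subseteq> sector j"
      "pathstart f = pathstart g" "pathfinish f = pathfinish g" for f g j
    by (rule lam_same_ends[OF sector_subset[of j] _ that]) (rule sector_loop[OF core])
  \<comment> \<open>A potential for \<open>lam\<close> modulo \<open>W\<close>: travel along the base section to the gap after \<open>cone_point N j\<close>,
    then inside \<open>sector j\<close>.\<close>
  define T where "T = (\<lambda>j e. A 0 (gap_angle j) + lam (P j e))"
  \<comment> \<open>Here the closed base section enters: shifting the index by m N adds m full turns
    of it.\<close>
  have T1: "T j e - T (j + m * int N) e \<in> W" if e: "e \<in> sector j" for j m e
  proof -
    let ?k = "j + m * int N"
    have e': "e \<in> sector ?k" using e by (simp add: sector_add)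
    have bb: "?b (gap_angle ?k) = ?b (gap_angle j)"
    proof -
      have "cis (gap_angle ?k) = cis (gap_angle j)"
        using cis_multiple_2pi[of "of_int m"] by (simp add: gap_angle_add cis_mult[symmetric] mult.commute mult.left_commute)
      then show ?thesis by (simp add: base_section_def)
    qed
    have 1: "lam (P j e) - lam (P ?k e) \<in> W"
      by (rule ends[where j = j]) (use P[OF e] P[OF e'] bb in \<open>auto simp: sector_add\<close>)
    have 2: "A 0 (gap_angle j) + A (gap_angle j) (gap_angle ?k) - A 0 (gap_angle ?k) \<in> W" by (rule A)
    have 3: "A (gap_angle j) (gap_angle ?k) \<in> W"
      using Ap[of "gap_angle j" m] by (simp add: gap_angle_add)
    from W_add[OF 1 W_diff[OF 2 3]] show ?thesis by (simp add: T_def algebra_simps)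
  qed
  \<comment> \<open>One path Q to e inside the band serves both sectors; for sector j + 1 it is
    preceded by the arc R between the two gaps.\<close>
  have T2: "T j e - T (j + 1) e \<in> W" if e: "e \<in> band j" for j e
  proof -
    have es: "e \<in> sector j" "e \<in> sector (j + 1)" using e band_subset by auto
    obtain Q where Q: "path Q" "path_image Q \<subseteq> band j" "pathstart Q = ?b (gap_angle j)" "pathfinish Q = e"
      using band_path_connected[of j] e gap_in_band[of j] unfolding path_connected_def by blast
    have 1: "lam (P j e) - lam Q \<in> W"
      by (rule ends[where j = j]) (use P[OF es(1)] Q band_subset(1)[of j] in auto)
    define R where "R = ?b \<circ> linepath (gap_angle (j + 1)) (gap_angle j)"
    have R: "path R" "path_image R \<subseteq> sector (j + 1)" "pathstart R = ?b (gap_angle (j + 1))" "pathfinish R = ?b (gap_angle j)"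
    proof -
      show "path R" unfolding R_def
        by (intro path_continuous_image continuous_on_subset[OF base_section_continuous]) auto
      have "path_image R = ?b ` closed_segment (gap_angle (j + 1)) (gap_angle j)"
        unfolding R_def path_image_compose by simp
      then show "path_image R \<subseteq> sector (j + 1)"
        by (simp only: image_subset_iff) (intro ballI arc_in_sector)
      show "pathstart R = ?b (gap_angle (j + 1))" "pathfinish R = ?b (gap_angle j)"
        by (simp_all add: R_def pathstart_compose pathfinish_compose)
    qed
    have 2: "lam (P (j + 1) e) - lam (R +++ Q) \<in> W"
      by (rule ends[where j = "j + 1"])
        (use P[OF es(2)] Q R band_subset(2)[of j] in \<open>auto simp: path_image_join\<close>)
    have 3: "lam R + lam Q - lam (R +++ Q) \<in> W"
    proof (rule lam_join)
      show "path_image R \<subseteq> E" using R(2) sector_subset by (rule subset_trans)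
      show "path_image Q \<subseteq> E"
        using subset_trans[OF Q(2) band_subset(1)] sector_subset by (rule subset_trans)
    qed (use Q R in simp_all)
    have 4: "A 0 (gap_angle (j + 1)) + lam R - A 0 (gap_angle j) \<in> W"
      using A[of 0 "gap_angle (j + 1)" "gap_angle j"] by (simp add: A_def R_def)
    have "(lam (P j e) - lam Q) - ((lam (P (j + 1) e) - lam (R +++ Q)) - (lam R + lam Q - lam (R +++ Q)))
       - (A 0 (gap_angle (j + 1)) + lam R - A 0 (gap_angle j)) \<in> W"
      by (rule W_diff[OF W_diff[OF 1 W_diff[OF 2 3]] 4])
    then show ?thesis by (simp add: T_def algebra_simps)
  qed
  have T: "T j e - T k e \<in> W" if jk: "e \<in> sector j" "e \<in> sector k" for j k e
    using jk
  proof (cases rule: sector_overlap)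
    case (1 m)
    show ?thesis unfolding 1 by (rule W_sym[OF T1[OF jk(2)]])
  next
    case (2 m)
    show ?thesis unfolding 2(1) by (rule W_trans[OF W_sym[OF T2[OF 2(2)]] W_sym[OF T1[OF jk(2)]]])
  next
    case (3 m)
    have "T j e - T (k + m * int N) e \<in> W" unfolding 3(1) by (rule T2[OF 3(2)])
    then show ?thesis by (rule W_trans[OF _ W_sym[OF T1[OF jk(2)]]])
  qed
  \<comment> \<open>Any sector containing e will do, as another choice changes the value by an
    element of \<open>W\<close>.\<close>
  define \<theta> where "\<theta> = (\<lambda>e. T (SOME j. e \<in> sector j) e)"
  have \<theta>: "\<theta> e - T j e \<in> W" if "e \<in> sector j" for e j
    unfolding \<theta>_def by (rule T[OF someI that]) (rule that)
  have "lam f - \<theta> (pathfinish f) + \<theta> (pathstart f) \<in> W"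
  proof (rule lam_exact_local[OF _ f(1,2)])
    fix e assume "e \<in> E"
    then obtain j where j: "e \<in> sector j" by (rule sector_cover)
    have "lam g - \<theta> (pathfinish g) + \<theta> (pathstart g) \<in> W" if g: "path g" "path_image g \<subseteq> sector j" for g
    proof -
      have s: "pathstart g \<in> sector j" "pathfinish g \<in> sector j" using g by auto
      have 1: "lam (P j (pathstart g)) + lam g - lam (P j (pathstart g) +++ g) \<in> W"
      proof (rule lam_join)
        show "path_image (P j (pathstart g)) \<subseteq> E" using P(2)[OF s(1)] sector_subset by (rule subset_trans)
        show "path_image g \<subseteq> E" using g(2) sector_subset by (rule subset_trans)
      qed (use P[OF s(1)] g in simp_all)
      have 2: "lam (P j (pathstart g) +++ g) - lam (P j (pathfinish g)) \<in> W"
        by (rule ends[where j = j]) (use P[OF s(1)] P[OF s(2)] g in \<open>auto simp: path_image_join\<close>)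
      have "(lam (P j (pathstart g)) + lam g - lam (P j (pathstart g) +++ g)) +
          (lam (P j (pathstart g) +++ g) - lam (P j (pathfinish g)))
          + (\<theta> (pathstart g) - T j (pathstart g)) - (\<theta> (pathfinish g) - T j (pathfinish g)) \<in> W"
        by (rule W_diff[OF W_add[OF W_add[OF 1 2] \<theta>[OF s(1)]] \<theta>[OF s(2)]])
      then show ?thesis by (simp add: T_def algebra_simps)
    qed
    then show "\<exists>U. openin (top_of_set E) U \<and> e \<in> U \<and>
      (\<forall>f. path f \<and> path_image f \<subseteq> U \<longrightarrow> lam f - \<theta> (pathfinish f) + \<theta> (pathstart f) \<in> W)"
      using sector_openin[of j] j by blast
  qed
  then show ?thesis using f(3) by simp
qed

text \<open>The multiple is written as a sum of equal terms, since the values lie in an arbitrary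
  abelian group.\<close>

lemma core_multiple:
  "lam ((\<lambda>x. (0, cis x, cone_point N j)) \<circ> linepath 0 (of_nat n * (2 * pi))) - (\<Sum>i<n. lam (core_loop N j)) \<in> W"
proof (induction n)
  case 0
  have "lam ((\<lambda>x. (0, cis x, cone_point N j)) \<circ> linepath 0 0) \<in> W"
    by (rule lam_affine_const[OF convex_UNIV core_line(1,2) UNIV_I])
  then show ?case by (simp add: o_def)
next
  case (Suc n)
  let ?k = "\<lambda>x. (0, cis x, cone_point N j)"
  let ?x = "of_nat n * (2 * pi)"
  have "lam (?k \<circ> linepath 0 ?x) + lam (?k \<circ> linepath ?x (?x + 2 * pi)) - lam (?k \<circ> linepath 0 (?x + 2 * pi)) \<in> W"
    by (rule lam_affine[OF convex_UNIV core_line(1,2)]) auto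
  moreover have "lam (?k \<circ> linepath ?x (?x + 2 * pi)) = lam (core_loop N j)"
  proof (rule lam_cong)
    fix t :: real
    have "linepath ?x (?x + 2 * pi) t = 2 * pi * of_nat n + 2 * pi * t"
      by (simp add: linepath_def algebra_simps)
    then show "(?k \<circ> linepath ?x (?x + 2 * pi)) t = core_loop N j t"
      using cis_multiple_2pi[of "of_nat n"] by (simp add: core_loop_def cis_mult[symmetric])
  qed
  ultimately have 1: "lam (?k \<circ> linepath 0 ?x) + lam (core_loop N j) - lam (?k \<circ> linepath 0 (?x + 2 * pi)) \<in> W"
    by (simp only:)
  have e: "of_nat (Suc n) * (2 * pi) = ?x + 2 * pi" by (simp add: algebra_simps)
  have g: "A - S - (A + c - B) = B - (S + c)" for A S c B :: 'g by (simp add: algebra_simps)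
  show ?case
    unfolding e sum.lessThan_Suc using W_diff[OF Suc 1] unfolding g .
qed

text \<open>Applying the circle action to a path between two cores gives a free homotopy of orbits.
  The orbit of a point with u = 0 runs p times along its core.\<close>

lemma core_multiples_homologous:
  "(\<Sum>i<p. lam (core_loop N j)) - (\<Sum>i<p. lam (core_loop N k)) \<in> W"
proof -
  define h where "h = (\<lambda>(u, v, y) t. (cis (2 * pi * t) * u, cis (2 * pi * p * t) * v, y :: complex))"
  have hE: "h e t \<in> E" if "e \<in> E" for e t
  proof -
    have "cis (2 * pi * t) ^ p = cis (2 * pi * p * t)"
      unfolding Complex.DeMoivre by (simp add: mult_ac)
    then show ?thesis
      using that by (auto simp: h_def seifert_space_def power_mult_distrib norm_mult)
  qed
  have c: "(0, 1, cone_point N j) \<in> E" for j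
    by (simp add: seifert_space_def cone_point_power zero_power[OF p_pos])
  obtain g where g: "path g" "path_image g \<subseteq> E" "pathstart g = (0, 1, cone_point N j)" "pathfinish g = (0, 1, cone_point N k)"
    using seifert_path_connected c unfolding path_connected_def by blast
  have "homotopic_loops E (h (0, 1, cone_point N j)) (h (0, 1, cone_point N k))"
    unfolding homotopic_loops
  proof (intro exI[of _ "\<lambda>(s, t). h (g s) t"] conjI)
    have cg: "continuous_on {0..1} g" using g by (simp add: path_def)
    show "continuous_on ({0..1} \<times> {0..1}) (\<lambda>(s, t). h (g s) t)"
      unfolding h_def case_prod_unfold
      by (intro continuous_intros continuous_on_compose2[OF cg]) auto
    show "(\<lambda>(s, t). h (g s) t) \<in> {0..1} \<times> {0..1} \<rightarrow> E"
    proof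
      fix x assume "x \<in> {0..1::real} \<times> {0..1::real}"
      then obtain a b where "x = (a, b)" "g a \<in> E" using g(2) by (auto simp: path_image_def)
      then show "(\<lambda>(s, t). h (g s) t) x \<in> E" using hE[of "g a" b] by simp
    qed
    show "\<forall>t\<in>{0..1}. pathfinish ((\<lambda>(s, t). h (g s) t) \<circ> Pair t) = pathstart ((\<lambda>(s, t). h (g s) t) \<circ> Pair t)"
      using cis_multiple_2pi[of "of_nat p"]
      by (simp add: pathfinish_def pathstart_def h_def case_prod_unfold)
  qed (use g in \<open>auto simp: pathstart_def pathfinish_def\<close>)
  then have "lam (h (0, 1, cone_point N j)) - lam (h (0, 1, cone_point N k)) \<in> W"
    by (rule lam_homotopic_loops)
  moreover have "h (0, 1, cone_point N j) = (\<lambda>x. (0, cis x, cone_point N j)) \<circ> linepath 0 (of_nat p * (2 * pi))" for j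
    by (auto simp: h_def linepath_def fun_eq_iff mult_ac)
  ultimately have "lam ((\<lambda>x. (0, cis x, cone_point N j)) \<circ> linepath 0 (of_nat p * (2 * pi)))
     - lam ((\<lambda>x. (0, cis x, cone_point N k)) \<circ> linepath 0 (of_nat p * (2 * pi))) \<in> W" by simp
  then show ?thesis
    using W_trans[OF W_trans[OF W_sym[OF core_multiple[of j p]]] core_multiple[of k p]] by blast
qed

end

section \<open>Pull-backs of z |-> z^N, and the p-fold covering of a punctured quotient
  singularity\<close>

section \<open>Coverings defined by roots\<close>

text \<open>Through the pair (q, Y), with inverse \<open>k\<close>, the space \<open>E\<close> is
  the pull-back along \<open>d\<close> of the covering z |-> z^N of the punctured plane. Evenly
  covered sets and their sheets are pulled back with it.\<close>

lemma covering_space_power_pullback: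
  fixes q :: "'a::topological_space \<Rightarrow> 'b::topological_space"
  assumes N: "N > 0"
    and q: "continuous_on E q" and Y: "continuous_on E Y"
    and d: "continuous_on S d" "\<And>x. x \<in> S \<Longrightarrow> d x \<noteq> (0::complex)"
    and k: "continuous_on {(x, y). x \<in> S \<and> y ^ N = d x} k"
    and fwd: "\<And>e. e \<in> E \<Longrightarrow> q e \<in> S \<and> Y e ^ N = d (q e) \<and> k (q e, Y e) = e"
    and bwd: "\<And>x y. x \<in> S \<Longrightarrow> y ^ N = d x \<Longrightarrow> k (x, y) \<in> E \<and> q (k (x, y)) = x \<and> Y (k (x, y)) = y"
  shows "covering_space E q S"
  unfolding covering_space_def
proof (intro conjI ballI)
  show "continuous_on E q" by (rule q)
  show "q ` E = S"
  proof
    show "q ` E \<subseteq> S" using fwd by blast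
    show "S \<subseteq> q ` E"
    proof
      fix x assume x: "x \<in> S"
      have "exp (Ln (d x) / N) ^ N = d x"
        using N d(2)[OF x] by (simp flip: exp_of_nat_mult)
      from bwd[OF x this] show "x \<in> q ` E" by (metis image_eqI)
    qed
  qed
  fix x assume x: "x \<in> S"
  have "d x \<in> - {0}" using d(2)[OF x] by simp
  then obtain T v where T: "d x \<in> T" "openin (top_of_set (- {0})) T"
    and v: "\<Union>v = - {0} \<inter> (\<lambda>z. z ^ N) -` T" "\<And>u. u \<in> v \<Longrightarrow> openin (top_of_set (- {0})) u" "disjoint v"
      "\<And>u. u \<in> v \<Longrightarrow> \<exists>r. homeomorphism u T (\<lambda>z. z ^ N) r"
    using covering_space_power_punctured_plane[OF N] unfolding covering_space_def by metis
  have T0: "T \<subseteq> - {0}" using T(2) openin_imp_subset by blast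
  have To: "open T" using T(2) by (rule openin_open_trans) auto
  have uo: "open u" if "u \<in> v" for u using v(2)[OF that] by (rule openin_open_trans) auto
  show "\<exists>T. x \<in> T \<and> openin (top_of_set S) T \<and>
      (\<exists>v. \<Union>v = E \<inter> q -` T \<and> (\<forall>u\<in>v. openin (top_of_set E) u) \<and> disjoint v \<and>
         (\<forall>u\<in>v. \<exists>r. homeomorphism u T q r))"
  proof (intro exI[of _ "S \<inter> d -` T"] conjI exI[of _ "(\<lambda>u. E \<inter> Y -` u) ` v"] ballI)
    show "x \<in> S \<inter> d -` T" using x T by simp
    show "openin (top_of_set S) (S \<inter> d -` T)"
      by (rule continuous_openin_preimage_gen[OF d(1) To])
    show "\<Union> ((\<lambda>u. E \<inter> Y -` u) ` v) = E \<inter> q -` (S \<inter> d -` T)"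
    proof -
      have "\<Union> ((\<lambda>u. E \<inter> Y -` u) ` v) = E \<inter> Y -` \<Union>v" by blast
      also have "\<dots> = E \<inter> q -` (S \<inter> d -` T)"
      proof -
        have "Y e \<in> \<Union>v \<longleftrightarrow> d (q e) \<in> T" if "e \<in> E" for e
          using fwd[OF that] T0 N unfolding v(1) by (cases "Y e = 0") (auto simp: zero_power)
        then show ?thesis using fwd by auto
      qed
      finally show ?thesis .
    qed
    show "disjoint ((\<lambda>u. E \<inter> Y -` u) ` v)"
      using v(3) unfolding disjoint_def by (auto simp: disjoint_iff) metis+
    fix w assume "w \<in> (\<lambda>u. E \<inter> Y -` u) ` v"
    then obtain u where u: "u \<in> v" "w = E \<inter> Y -` u" by blast
    show "openin (top_of_set E) w"
      unfolding u(2) by (rule continuous_openin_preimage_gen[OF Y uo[OF u(1)]])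
    obtain r where r: "homeomorphism u T (\<lambda>z. z ^ N) r" using v(4)[OF u(1)] by blast
    have rT: "r t \<in> u" "r t ^ N = t" if "t \<in> T" for t
      using r that by (auto simp: homeomorphism_def)
    have ru: "r (y ^ N) = y" "y ^ N \<in> T" if "y \<in> u" for y
      using r that by (auto simp: homeomorphism_def)
    show "\<exists>r. homeomorphism w (S \<inter> d -` T) q r"
    proof (intro exI[of _ "\<lambda>x. k (x, r (d x))"] homeomorphismI)
      show "continuous_on w q" using q by (rule continuous_on_subset) (simp add: u(2))
      have "continuous_on (S \<inter> d -` T) (\<lambda>x. r (d x))"
        by (rule continuous_on_compose2[of T r])
          (use r d(1) in \<open>auto simp: homeomorphism_def intro: continuous_on_subset\<close>)
      then have "continuous_on (S \<inter> d -` T) (\<lambda>x. (x, r (d x)))"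
        by (intro continuous_intros)
      then show "continuous_on (S \<inter> d -` T) (\<lambda>x. k (x, r (d x)))"
        by (rule continuous_on_compose2[OF k]) (use rT in auto)
      show "q ` w \<subseteq> S \<inter> d -` T"
      proof
        fix z assume "z \<in> q ` w"
        then obtain e where e: "z = q e" "e \<in> E" "Y e \<in> u" by (auto simp: u(2))
        have "q e \<in> S" "Y e ^ N = d (q e)" using fwd[OF e(2)] by blast+
        then show "z \<in> S \<inter> d -` T" using ru(2)[OF e(3)] e(1) by simp
      qed
      show "(\<lambda>x. k (x, r (d x))) ` (S \<inter> d -` T) \<subseteq> w"
      proof
        fix z assume "z \<in> (\<lambda>x. k (x, r (d x))) ` (S \<inter> d -` T)"
        then obtain x where x: "z = k (x, r (d x))" "x \<in> S" "d x \<in> T" by auto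
        then show "z \<in> w" using bwd[OF x(2) rT(2)[OF x(3)]] rT(1)[OF x(3)] by (simp add: u(2))
      qed
      show "k (q e, r (d (q e))) = e" if "e \<in> w" for e
      proof -
        have e: "e \<in> E" "Y e \<in> u" using that by (auto simp: u(2))
        have "Y e ^ N = d (q e)" "k (q e, Y e) = e" using fwd[OF e(1)] by blast+
        then show ?thesis using ru(1)[OF e(2)] by simp
      qed
      show "q (k (x, r (d x))) = x" if "x \<in> S \<inter> d -` T" for x
        using that bwd rT by auto
    qed
  qed
qed

lemma covering_space_locally:
  assumes q: "continuous_on E q" "q \<in> E \<rightarrow> S"
    and loc: "\<And>x. x \<in> S \<Longrightarrow> \<exists>U. x \<in> U \<and> openin (top_of_set S) U \<and> covering_space (E \<inter> q -` U) q U"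
  shows "covering_space E q S"
  unfolding covering_space_def
proof (intro conjI ballI)
  show "continuous_on E q" by (rule q)
  have "S \<subseteq> q ` E"
  proof
    fix x assume "x \<in> S"
    then obtain U where "x \<in> U" "covering_space (E \<inter> q -` U) q U" using loc by blast
    then show "x \<in> q ` E" unfolding covering_space_def by blast
  qed
  then show "q ` E = S" using q(2) by auto
  fix x assume "x \<in> S"
  then obtain U where U: "x \<in> U" "openin (top_of_set S) U" "covering_space (E \<inter> q -` U) q U"
    using loc by blast
  then obtain T v where T: "x \<in> T" "openin (top_of_set U) T" and v: "\<Union>v = E \<inter> q -` U \<inter> q -` T"
     "\<And>u. u \<in> v \<Longrightarrow> openin (top_of_set (E \<inter> q -` U)) u" "disjoint v"
     "\<And>u. u \<in> v \<Longrightarrow> \<exists>r. homeomorphism u T q r"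
    unfolding covering_space_def by metis
  have TU: "T \<subseteq> U" using T(2) by (rule openin_imp_subset)
  have "openin (top_of_set E) (E \<inter> q -` U)"
    by (rule continuous_openin_preimage[OF q U(2)])
  then have oE: "openin (top_of_set E) u" if "u \<in> v" for u
    by (rule openin_trans[OF v(2)[OF that]])
  have oT: "openin (top_of_set S) T" using T(2) U(2) by (rule openin_trans)
  have uv: "\<Union>v = E \<inter> q -` T" using v(1) TU by blast
  show "\<exists>T. x \<in> T \<and> openin (top_of_set S) T \<and>
      (\<exists>v. \<Union>v = E \<inter> q -` T \<and> (\<forall>u\<in>v. openin (top_of_set E) u) \<and> disjoint v \<and>
         (\<forall>u\<in>v. \<exists>r. homeomorphism u T q r))"
    by (intro exI[of _ T] conjI exI[of _ v] ballI) (use T(1) oT uv oE v(3,4) in simp_all)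
qed

text \<open>The surface with an A_{p-1} singularity, without the singular point: the quotient of C^2
  - 0 by the p-th roots of unity, acting on the two coordinates by inverse characters.\<close>

definition quotient_surface :: "nat \<Rightarrow> (complex \<times> complex \<times> complex) set" where
  "quotient_surface p = {(a, u, d). a * d = u ^ p \<and> (a \<noteq> 0 \<or> d \<noteq> 0)}"

definition quotient_proj :: "nat \<Rightarrow> complex \<times> complex \<Rightarrow> complex \<times> complex \<times> complex" where
  "quotient_proj p = (\<lambda>(r, t). (r ^ p, r * t, t ^ p))"

text \<open>The deck transformations of \<open>quotient_proj\<close>. Integer exponents turn
  composition into addition.\<close>

definition root_action :: "nat \<Rightarrow> int \<Rightarrow> complex \<times> complex \<Rightarrow> complex \<times> complex" where
  "root_action p m = (\<lambda>(r, t). (cis (2 * pi * m / p) * r, cis (- (2 * pi * m / p)) * t))"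

text \<open>Where the first coordinate a is not 0, r is a p-th root of it and t = u / r is
  determined; where the last one is not 0, the roles are exchanged. The two open sets cover the
  surface.\<close>

lemma quotient_covering:
  assumes p: "p > 0"
  shows "covering_space (- {(0, 0)}) (quotient_proj p) (quotient_surface p)"
proof (rule covering_space_locally)
  show cq: "continuous_on (- {(0, 0)}) (quotient_proj p)"
    unfolding quotient_proj_def case_prod_unfold by (intro continuous_intros)
  show "quotient_proj p \<in> - {(0, 0)} \<rightarrow> quotient_surface p"
    using p by (auto simp: quotient_proj_def quotient_surface_def power_mult_distrib)
  fix x assume x: "x \<in> quotient_surface p"
  let ?U1 = "quotient_surface p \<inter> {x. fst x \<noteq> 0}"
  let ?U2 = "quotient_surface p \<inter> {x. snd (snd x) \<noteq> 0}"
  have o1: "openin (top_of_set (quotient_surface p)) ?U1"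
    by (intro openin_open_Int open_Collect_neq continuous_intros)
  have o2: "openin (top_of_set (quotient_surface p)) ?U2"
    by (intro openin_open_Int open_Collect_neq continuous_intros)
  have c1: "covering_space (- {(0, 0)} \<inter> quotient_proj p -` ?U1) (quotient_proj p) ?U1"
  proof (rule covering_space_power_pullback[OF p, where Y = fst and d = fst
        and k = "\<lambda>x. (snd x, fst (snd (fst x)) / snd x)"])
    show "continuous_on (- {(0, 0)} \<inter> quotient_proj p -` ?U1) (quotient_proj p)"
      using cq by (rule continuous_on_subset) blast
    show "continuous_on {(x, y). x \<in> ?U1 \<and> y ^ p = fst x} (\<lambda>x. (snd x, fst (snd (fst x)) / snd x))"
      unfolding case_prod_unfold using p by (intro continuous_intros) (auto simp: power_0_left)
    show "quotient_proj p e \<in> ?U1 \<and> fst e ^ p = fst (quotient_proj p e) \<and>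
        (snd (quotient_proj p e, fst e), fst (snd (fst (quotient_proj p e, fst e))) / snd (quotient_proj p e, fst e)) = e"
      if "e \<in> - {(0, 0)} \<inter> quotient_proj p -` ?U1" for e
      using that p by (auto simp: quotient_proj_def split: prod.splits)
    show "(snd (x, y), fst (snd (fst (x, y))) / snd (x, y)) \<in> - {(0, 0)} \<inter> quotient_proj p -` ?U1 \<and>
       quotient_proj p (snd (x, y), fst (snd (fst (x, y))) / snd (x, y)) = x \<and>
       fst (snd (x, y), fst (snd (fst (x, y))) / snd (x, y)) = y"
      if xy: "x \<in> ?U1" "y ^ p = fst x" for x y
    proof -
      obtain a u d where x: "x = (a, u, d)" "a \<noteq> 0" "a * d = u ^ p" "y ^ p = a" "x \<in> quotient_surface p"
        using xy by (cases x) (auto simp: quotient_surface_def)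
      have y: "y \<noteq> 0" using x p by auto
      have "(u / y) ^ p = d" using x y by (simp add: power_divide field_simps)
      then have "quotient_proj p (y, u / y) = x" using x y by (simp add: quotient_proj_def)
      then show ?thesis using x y by simp
    qed
  qed (auto intro!: continuous_intros)
  have c2: "covering_space (- {(0, 0)} \<inter> quotient_proj p -` ?U2) (quotient_proj p) ?U2"
  proof (rule covering_space_power_pullback[OF p, where Y = snd and d = "\<lambda>x. snd (snd x)"
        and k = "\<lambda>x. (fst (snd (fst x)) / snd x, snd x)"])
    show "continuous_on (- {(0, 0)} \<inter> quotient_proj p -` ?U2) (quotient_proj p)"
      using cq by (rule continuous_on_subset) blast
    show "continuous_on {(x, y). x \<in> ?U2 \<and> y ^ p = snd (snd x)} (\<lambda>x. (fst (snd (fst x)) / snd x, snd x))"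
      unfolding case_prod_unfold using p by (intro continuous_intros) (auto simp: power_0_left)
    show "quotient_proj p e \<in> ?U2 \<and> snd e ^ p = snd (snd (quotient_proj p e)) \<and>
        (fst (snd (fst (quotient_proj p e, snd e))) / snd (quotient_proj p e, snd e), snd (quotient_proj p e, snd e)) = e"
      if "e \<in> - {(0, 0)} \<inter> quotient_proj p -` ?U2" for e
      using that p by (auto simp: quotient_proj_def split: prod.splits)
    show "(fst (snd (fst (x, y))) / snd (x, y), snd (x, y)) \<in> - {(0, 0)} \<inter> quotient_proj p -` ?U2 \<and>
       quotient_proj p (fst (snd (fst (x, y))) / snd (x, y), snd (x, y)) = x \<and>
       snd (fst (snd (fst (x, y))) / snd (x, y), snd (x, y)) = y"
      if xy: "x \<in> ?U2" "y ^ p = snd (snd x)" for x y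
    proof -
      obtain a u d where x: "x = (a, u, d)" "d \<noteq> 0" "a * d = u ^ p" "y ^ p = d" "x \<in> quotient_surface p"
        using xy by (cases x) (auto simp: quotient_surface_def)
      have y: "y \<noteq> 0" using x p by auto
      have "(u / y) ^ p = a" using x y by (simp add: power_divide field_simps)
      then have "quotient_proj p (u / y, y) = x" using x y by (simp add: quotient_proj_def)
      then show ?thesis using x y by simp
    qed
  qed (auto intro!: continuous_intros)
  show "\<exists>U. x \<in> U \<and> openin (top_of_set (quotient_surface p)) U \<and>
      covering_space (- {(0, 0)} \<inter> quotient_proj p -` U) (quotient_proj p) U"
  proof (cases "fst x = 0")
    case True
    then have "x \<in> ?U2" using x by (auto simp: quotient_surface_def)
    then show ?thesis using o2 c2 by (intro exI[of _ ?U2] conjI)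
  next
    case False
    then have "x \<in> ?U1" using x by auto
    then show ?thesis using o1 c1 by (intro exI[of _ ?U1] conjI)
  qed
qed

lemma root_action_0: "root_action p 0 = (\<lambda>x. x)"
  by (auto simp: root_action_def)

lemma root_action_add: "root_action p m (root_action p n x) = root_action p (m + n) x"
  by (auto simp: root_action_def case_prod_unfold cis_mult add_divide_distrib ring_distribs add.commute
      simp flip: mult.assoc)

lemma root_action_proj:
  assumes "p > 0"
  shows "quotient_proj p (root_action p m x) = quotient_proj p x"
proof -
  have "cis (2 * pi * m / p) ^ p = 1" "cis (- (2 * pi * m / p)) ^ p = 1"
    using assms cis_multiple_2pi[of "of_int m"] cis_multiple_2pi[of "- of_int m"]
    by (simp_all add: Complex.DeMoivre)
  moreover have "cis (2 * pi * m / p) * a * (cis (- (2 * pi * m / p)) * b) = a * b" for a b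
  proof -
    have "cis (2 * pi * m / p) * cis (- (2 * pi * m / p)) = 1" by (simp add: cis_mult)
    then show ?thesis by (metis (no_types, opaque_lifting) mult.assoc mult.left_commute mult_1)
  qed
  ultimately show ?thesis
    by (simp add: quotient_proj_def root_action_def case_prod_unfold power_mult_distrib)
qed

lemma root_of_unity_cis:
  assumes "p > 0" "z ^ p = 1"
  obtains m :: int where "z = cis (2 * pi * m / p)"
proof -
  have "z \<in> (\<lambda>k. cis (2 * pi * real k / real p)) ` {..<p}"
    using Complex.bij_betw_roots_unity[OF assms(1)] assms(2) by (auto simp: bij_betw_def)
  then obtain k where "z = cis (2 * pi * real k / real p)" by auto
  then have "z = cis (2 * pi * real_of_int (int k) / p)" by simp
  then show ?thesis by (rule that)
qed

text \<open>A nonzero coordinate determines the root of unity, and the product r t fixes the other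
  coordinate. If r = 0, the root is read off from t and the exponent changes sign.\<close>

lemma root_action_transitive:
  assumes p: "p > 0" and eq: "quotient_proj p x = quotient_proj p x'" and nz: "x \<noteq> (0, 0)"
  obtains m where "x' = root_action p m x"
proof -
  obtain r t r' t' where x: "x = (r, t)" "x' = (r', t')" by fastforce
  have e: "r' ^ p = r ^ p" "r' * t' = r * t" "t' ^ p = t ^ p"
    using eq by (auto simp: quotient_proj_def x)
  show ?thesis
  proof (cases "r = 0")
    case False
    then have r': "r' \<noteq> 0" using e(1) p by (metis power_eq_0_iff zero_power)
    have "(r' / r) ^ p = 1" using e(1) False by (simp add: power_divide)
    then obtain m :: int where m: "r' / r = cis (2 * pi * m / p)" using root_of_unity_cis[OF p] by blast
    then have "r' = cis (2 * pi * m / p) * r" using False by (simp add: field_simps)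
    moreover have "t' = cis (- (2 * pi * m / p)) * t"
    proof -
      have "t' = t / (r' / r)" using e(2) False r' by (simp add: field_simps)
      then show ?thesis unfolding m by (simp add: cis_divide divide_inverse mult.commute)
    qed
    ultimately have "x' = root_action p m x" by (simp add: x root_action_def)
    then show ?thesis by (rule that)
  next
    case True
    then have t: "t \<noteq> 0" "r' = 0" using nz e(1) p by (auto simp: x power_0_left)
    have "(t' / t) ^ p = 1" using e(3) t by (simp add: power_divide)
    then obtain m :: int where m: "t' / t = cis (2 * pi * m / p)" using root_of_unity_cis[OF p] by blast
    then have "t' = cis (2 * pi * m / p) * t" using t by (simp add: field_simps)
    then have "x' = root_action p (- m) x" using True t by (simp add: x root_action_def)
    then show ?thesis by (rule that)
  qed
qed

lemma root_action_fixed: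
  assumes p: "p > 0" and nz: "x \<noteq> (0, 0)" and fixed: "root_action p m x = x"
  shows "int p dvd m"
proof -
  obtain r t where x: "x = (r, t)" by fastforce
  have "cis (2 * pi * m / p) = 1"
  proof (cases "r = 0")
    case False
    then show ?thesis using fixed by (simp add: x root_action_def)
  next
    case True
    then have "cis (- (2 * pi * m / p)) = 1" using nz fixed by (auto simp: x root_action_def)
    then have "inverse (cis (2 * pi * m / p)) = 1" by simp
    then show ?thesis by (metis inverse_1 inverse_inverse_eq)
  qed
  then have "cos (2 * pi * m / p) = 1" by (metis cis.sel(1) one_complex.sel(1))
  then obtain k :: int where "2 * pi * m / p = of_int k * 2 * pi" using cos_one_2pi_int by auto
  then have "real_of_int m = of_int (k * int p)" using p by (simp add: field_simps)
  then have "m = k * int p" by (simp only: of_int_eq_iff)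
  then show ?thesis by simp
qed

text \<open>
  A set-theoretic trivialisation of the covering: on each fibre, \<open>root_index\<close> is determined
  modulo \<open>p\<close> and counts the translates of a chosen point.
\<close>

definition root_index :: "nat \<Rightarrow> complex \<times> complex \<Rightarrow> int" where
  "root_index p x =
     (SOME m. x = root_action p m (SOME x'. x' \<noteq> (0, 0) \<and> quotient_proj p x' = quotient_proj p x))"

text \<open>The chosen point of a fibre depends on the projection only, so it is the same for x and
  its translates. As the action is free modulo p, the index is well defined as a residue.\<close>

lemma root_index_action:
  assumes p: "p > 0" and nz: "x \<noteq> (0, 0)"
  shows "[root_index p (root_action p m x) = root_index p x + m] (mod int p)"
proof -
  define b where "b = (SOME x'. x' \<noteq> (0, 0) \<and> quotient_proj p x' = quotient_proj p x)"
  have b: "b \<noteq> (0, 0)" "quotient_proj p b = quotient_proj p x"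
    using someI[of "\<lambda>x'. x' \<noteq> (0, 0) \<and> quotient_proj p x' = quotient_proj p x" x] nz
    unfolding b_def by auto
  have i: "y = root_action p (root_index p y) b" if "quotient_proj p y = quotient_proj p x" for y
  proof -
    have "\<exists>m. y = root_action p m b"
      using root_action_transitive[OF p _ b(1), of y] b(2) that by metis
    then show ?thesis unfolding root_index_def that b_def[symmetric] by (rule someI_ex)
  qed
  have x: "x = root_action p (root_index p x) b" by (rule i) simp
  have "root_action p m x = root_action p (root_index p (root_action p m x)) b"
    by (rule i) (simp add: root_action_proj[OF p])
  moreover have "root_action p m x = root_action p (m + root_index p x) b"
    by (subst x) (rule root_action_add)
  ultimately have "root_action p (- (m + root_index p x) + root_index p (root_action p m x)) b = b"
    by (metis add.left_inverse root_action_0 root_action_add)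
  from root_action_fixed[OF p b(1) this]
  show ?thesis by (simp add: cong_iff_dvd_diff algebra_simps)
qed

section \<open>Monodromy as a cocycle modulo p\<close>

definition lifts :: "nat \<Rightarrow> (real \<Rightarrow> complex \<times> complex \<times> complex) \<Rightarrow> (real \<Rightarrow> complex \<times> complex) \<Rightarrow> bool" where
  "lifts p f g \<longleftrightarrow> path g \<and> path_image g \<subseteq> - {(0, 0)} \<and> (\<forall>t\<in>{0..1}. quotient_proj p (g t) = f t)"

text \<open>The ends of a lift are compared with the chosen points of their own fibres, so the value
  makes sense for paths that are not closed; other choices of these points change it by a
  coboundary. The final \<open>mod\<close> keeps it in the residue ring even when no lift
  exists.\<close>

definition monodromy :: "nat \<Rightarrow> (real \<Rightarrow> complex \<times> complex \<times> complex) \<Rightarrow> int" where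
  "monodromy p f = (let g = SOME g. lifts p f g in (root_index p (g 1) - root_index p (g 0)) mod int p)"

text \<open>Two lifts differ at their start by some \<open>root_action p m\<close>, hence everywhere
  by uniqueness of lifts. The shift by m cancels in the difference of indices.\<close>

lemma monodromy_lift:
  assumes p: "p > 0" and g: "lifts p f g"
  shows "monodromy p f = (root_index p (g 1) - root_index p (g 0)) mod int p"
proof -
  define h where "h = (SOME g. lifts p f g)"
  have h: "lifts p f h" using g unfolding h_def by (rule someI[of "lifts p f"])
  have gnz: "g t \<noteq> (0, 0)" if "t \<in> {0..1}" for t using g that unfolding lifts_def path_image_def by blast
  have "quotient_proj p (g 0) = quotient_proj p (h 0)"
    using g h by (simp add: lifts_def)
  then obtain m where m: "h 0 = root_action p m (g 0)"
    using root_action_transitive[OF p] gnz[of 0] by (metis atLeastAtMost_iff order_refl zero_le_one)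
  have cr: "continuous_on UNIV (root_action p m)"
    unfolding root_action_def case_prod_unfold by (intro continuous_intros)
  have rnz: "root_action p m x \<noteq> (0, 0)" if "x \<noteq> (0, 0)" for x
    using that by (cases x) (auto simp: root_action_def)
  have "h 1 = root_action p m (g 1)"
  proof (rule covering_space_lift_unique[OF quotient_covering[OF p], of h 0 "\<lambda>t. root_action p m (g t)" "{0..1}" "\<lambda>t. quotient_proj p (g t)"])
    show "continuous_on {0..1} (\<lambda>t. quotient_proj p (g t))"
      using g unfolding lifts_def path_def quotient_proj_def case_prod_unfold by (intro continuous_intros) auto
    show "(\<lambda>t. quotient_proj p (g t)) \<in> {0..1} \<rightarrow> quotient_surface p"
      using covering_space_imp_surjective[OF quotient_covering[OF p]] gnz by auto
    show "continuous_on {0..1} h" using h by (simp add: lifts_def path_def)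
    show "h \<in> {0..1} \<rightarrow> - {(0, 0)}" using h unfolding lifts_def path_image_def by blast
    show "continuous_on {0..1} (\<lambda>t. root_action p m (g t))"
      using g by (intro continuous_on_compose2[OF cr]) (auto simp: lifts_def path_def)
    show "(\<lambda>t. root_action p m (g t)) \<in> {0..1} \<rightarrow> - {(0, 0)}" using gnz rnz by auto
  qed (use g h m in \<open>auto simp: lifts_def root_action_proj[OF p]\<close>)
  then have "[root_index p (h 1) - root_index p (h 0) = (root_index p (g 1) + m) - (root_index p (g 0) + m)] (mod int p)"
    unfolding m \<open>h 1 = _\<close>
    by (intro cong_diff root_index_action[OF p] gnz) auto
  then show ?thesis
    unfolding monodromy_def Let_def h_def[symmetric] by (simp add: cong_def)
qed

lemma monodromy_cong:
  assumes "\<And>t. t \<in> {0..1} \<Longrightarrow> f t = f' t"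
  shows "monodromy p f = monodromy p f'"
proof -
  have "lifts p f = lifts p f'" using assms by (auto simp: lifts_def fun_eq_iff)
  then show ?thesis by (simp add: monodromy_def)
qed

lemma triangle_convex: "convex triangle"
proof -
  have e: "triangle = {x. (1, 0) \<bullet> x \<ge> 0} \<inter> {x. (0, 1) \<bullet> x \<ge> 0} \<inter> {x. (1, 1) \<bullet> x \<le> 1}"
    by (auto simp: triangle_def inner_prod_def)
  show ?thesis
    unfolding e by (intro convex_Int convex_halfspace_ge convex_halfspace_le)
qed

text \<open>The triangle is simply connected, so a single lift restricts to lifts of all three
  sides, and the differences of indices telescope.\<close>

lemma monodromy_triangle:
  assumes p: "p > 0" and \<tau>: "continuous_on triangle \<tau>" "\<tau> ` triangle \<subseteq> quotient_surface p"
  shows "[monodromy p (\<lambda>t. \<tau> (1 - t, t)) - monodromy p (\<lambda>t. \<tau> (0, t)) + monodromy p (\<lambda>t. \<tau> (t, 0)) = 0] (mod int p)"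
proof -
  obtain T where T: "continuous_on triangle T" "T \<in> triangle \<rightarrow> - {(0, 0)}"
    "\<And>x. x \<in> triangle \<Longrightarrow> quotient_proj p (T x) = \<tau> x"
  proof (rule covering_space_lift[OF quotient_covering[OF p]])
    show "simply_connected triangle" "locally path_connected triangle"
      using triangle_convex by (simp_all add: convex_imp_simply_connected convex_imp_locally_path_connected)
    show "continuous_on triangle \<tau>" "\<tau> \<in> triangle \<rightarrow> quotient_surface p" using \<tau> by auto
  qed blast
  have l: "lifts p (\<lambda>t. \<tau> (a t)) (\<lambda>t. T (a t))"
    if "continuous_on {0..1} a" "\<And>t. t \<in> {0..1} \<Longrightarrow> a t \<in> triangle" for a :: "real \<Rightarrow> real \<times> real"
  proof -
    have "continuous_on {0..1} (\<lambda>t. T (a t))"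
      by (rule continuous_on_compose2[OF T(1) that(1)]) (use that(2) in auto)
    then show ?thesis using T that(2) by (auto simp: lifts_def path_def path_image_def)
  qed
  have m: "[monodromy p (\<lambda>t. \<tau> (a t)) = root_index p (T (a 1)) - root_index p (T (a 0))] (mod int p)"
    if "continuous_on {0..1} a" "\<And>t. t \<in> {0..1} \<Longrightarrow> a t \<in> triangle" for a :: "real \<Rightarrow> real \<times> real"
    using monodromy_lift[OF p l[OF that(1) that(2)]] by (simp add: cong_def)
  have 1: "[monodromy p (\<lambda>t. \<tau> (1 - t, t)) = root_index p (T (1 - 1, 1)) - root_index p (T (1 - 0, 0))] (mod int p)"
    by (rule m) (auto simp: triangle_def intro!: continuous_intros)
  have 2: "[monodromy p (\<lambda>t. \<tau> (0, t)) = root_index p (T (0, 1)) - root_index p (T (0, 0))] (mod int p)"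
    by (rule m) (auto simp: triangle_def intro!: continuous_intros)
  have 3: "[monodromy p (\<lambda>t. \<tau> (t, 0)) = root_index p (T (1, 0)) - root_index p (T (0, 0))] (mod int p)"
    by (rule m) (auto simp: triangle_def intro!: continuous_intros)
  show ?thesis using cong_add[OF cong_diff[OF 1 2] 3] by simp
qed

section \<open>Cohomology classes that detect the exceptional fibres\<close>

context seifert
begin

text \<open>The sum is the polynomial (y^N + 1) / (y - y_j), written out so that it makes sense at
  the cone point too. The first and the last coordinate then have product u^p.\<close>

definition branch_map :: "int \<Rightarrow> complex \<times> complex \<times> complex \<Rightarrow> complex \<times> complex \<times> complex" where
  "branch_map j = (\<lambda>(u, v, y). (y - cone_point N j, u,
     v * (\<Sum>i<N. cone_point N j ^ (N - Suc i) * y ^ i)))"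

lemma branch_factor: "(y - cone_point N j) * (\<Sum>i<N. cone_point N j ^ (N - Suc i) * y ^ i) = 1 + y ^ N"
  using power_diff_sumr2[of y N "cone_point N j"] by (simp add: cone_point_power add.commute)

text \<open>All terms equal y_j^(N-1), so the sum is N y_j^(N-1): the root y_j is simple. This keeps
  \<open>branch_map\<close> away from the removed singular point.\<close>

lemma branch_factor_cone: "(\<Sum>i<N. cone_point N j ^ (N - Suc i) * cone_point N j ^ i) \<noteq> 0"
proof -
  have "(\<Sum>i<N. cone_point N j ^ (N - Suc i) * cone_point N j ^ i) = (\<Sum>i<N. cone_point N j ^ (N - 1))"
    by (rule sum.cong) (auto simp flip: power_add)
  then show ?thesis using N_ge by simp
qed

lemma branch_map_in: "e \<in> E \<Longrightarrow> branch_map j e \<in> quotient_surface p"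
proof -
  assume "e \<in> E"
  then obtain u v y where e: "e = (u, v, y)" "cmod v = 1" "u ^ p = v * (1 + y ^ N)"
    by (auto simp: seifert_space_def)
  have "v \<noteq> 0" using e by auto
  then show ?thesis
    using e branch_factor[of y j] branch_factor_cone[of j]
    by (auto simp: branch_map_def quotient_surface_def mult_ac)
qed

lemma branch_map_continuous: "continuous_on S (branch_map j)"
  unfolding branch_map_def case_prod_unfold by (intro continuous_intros)

lemma cone_point_inj:
  assumes "0 \<le> j" "j < int N" "0 \<le> k" "k < int N" "cone_point N j = cone_point N k"
  shows "j = k"
proof -
  have "cis (cone_angle j - cone_angle k) = 1"
    using assms(5) by (simp add: cone_point_cis flip: cis_divide)
  then have "cos (cone_angle j - cone_angle k) = 1" by (metis cis.sel(1) one_complex.sel(1))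
  then obtain l :: int where "cone_angle j - cone_angle k = of_int l * 2 * pi" using cos_one_2pi_int by auto
  moreover have "cone_angle j - cone_angle k = 2 * pi * of_int (j - k) / N"
    by (simp add: cone_angle_def diff_divide_distrib[symmetric] algebra_simps)
  ultimately have "2 * pi * of_int (j - k) / N = of_int l * 2 * pi" by simp
  then have "of_int (j - k) * (2 * pi) = of_int l * N * (2 * pi)" using N_pos by (simp add: field_simps)
  then have "real_of_int (j - k) = of_int (l * int N)" using pi_gt_zero by (simp only: mult_cancel_right) simp
  then have d: "j - k = l * int N" by (simp only: of_int_eq_iff)
  then have "\<bar>l * int N\<bar> < int N" using assms by linarith
  then have "l = 0" using N_ge by (simp add: abs_mult)
  then show ?thesis using d by simp
qed

text \<open>On its own core the first coordinate is 0 and the last one turns once around 0, so its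
  p-th root turns by 1/p of a circle, which is \<open>root_action p (-1)\<close>. On the other cores
  the last coordinate is 0 and the first is a nonzero constant, so a constant path is a
  lift.\<close>

lemma monodromy_core:
  assumes "0 \<le> j" "j < int N" "0 \<le> k" "k < int N"
  shows "monodromy p (branch_map j \<circ> core_loop N k) = (if j = k then -1 else 0) mod int p"
proof (cases "j = k")
  case True
  define c where "c = (\<Sum>i<N. cone_point N j ^ (N - Suc i) * cone_point N j ^ i)"
  define t0 where "t0 = exp (Ln c / p)"
  have c: "c \<noteq> 0" unfolding c_def by (rule branch_factor_cone)
  have t0: "t0 \<noteq> 0" "t0 ^ p = c" using c p_pos by (simp_all add: t0_def flip: exp_of_nat_mult)
  let ?g = "\<lambda>t. (0, cis (2 * pi * t / p) * t0)"
  have "lifts p (branch_map j \<circ> core_loop N k) ?g"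
    unfolding lifts_def
  proof (intro conjI ballI)
    show "path ?g" unfolding path_def by (intro continuous_intros) (use p_pos in auto)
    show "path_image ?g \<subseteq> - {(0, 0)}" using t0 by (auto simp: path_image_def)
    fix t :: real
    have "(cis (2 * pi * t / p) * t0) ^ p = cis (2 * pi * t) * c"
      using p_pos t0 by (simp add: power_mult_distrib Complex.DeMoivre)
    then show "quotient_proj p (?g t) = (branch_map j \<circ> core_loop N k) t"
      using True p_pos by (simp add: quotient_proj_def branch_map_def core_loop_def c_def zero_power)
  qed
  then have "monodromy p (branch_map j \<circ> core_loop N k) = (root_index p (?g 1) - root_index p (?g 0)) mod int p"
    by (rule monodromy_lift[OF p_pos])
  moreover have "?g 1 = root_action p (-1) (?g 0)" by (simp add: root_action_def)
  then have "[root_index p (?g 1) = root_index p (?g 0) + (-1)] (mod int p)"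
    using root_index_action[OF p_pos, of "?g 0" "-1"] t0 by simp
  then have "[root_index p (?g 1) - root_index p (?g 0) = -1] (mod int p)"
    using cong_diff[of _ _ _ "root_index p (?g 0)" "root_index p (?g 0)"] by fastforce
  ultimately show ?thesis using True by (simp add: cong_def)
next
  case False
  define a where "a = cone_point N k - cone_point N j"
  define r0 where "r0 = exp (Ln a / p)"
  have a: "a \<noteq> 0" using cone_point_inj assms False unfolding a_def by force
  have r0: "r0 \<noteq> 0" "r0 ^ p = a" using a p_pos by (simp_all add: r0_def flip: exp_of_nat_mult)
  have z: "(\<Sum>i<N. cone_point N j ^ (N - Suc i) * cone_point N k ^ i) = 0"
    using branch_factor[of "cone_point N k" j] a unfolding a_def by (simp add: cone_point_power)
  have "lifts p (branch_map j \<circ> core_loop N k) (\<lambda>t. (r0, 0))"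
    using r0 p_pos z
    by (auto simp: lifts_def path_def path_image_def quotient_proj_def branch_map_def core_loop_def a_def zero_power)
  from monodromy_lift[OF p_pos this] show ?thesis using False by simp
qed

end

section \<open>Bounds for the first homology of the covers over a field\<close>

section \<open>First homology of the covers\<close>

lemma (in seifert) core_loop_mod: "core_loop N (j mod int N) = core_loop N j"
proof -
  have "j = j mod int N + (j div int N) * int N" by simp
  then have "cone_point N j = cone_point N (j mod int N)" by (metis cone_point_add)
  then show ?thesis by (simp add: core_loop_def fun_eq_iff)
qed

lemma (in seifert) core_loop_loop:
  "path (core_loop N j)" "path_image (core_loop N j) \<subseteq> E" "pathfinish (core_loop N j) = pathstart (core_loop N j)"
proof -
  show "path (core_loop N j)"
    unfolding core_loop_def path_def by (intro continuous_intros)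
  show "path_image (core_loop N j) \<subseteq> E"
    by (auto simp: path_image_def core_loop_def seifert_space_def cone_point_power zero_power[OF p_pos])
  show "pathfinish (core_loop N j) = pathstart (core_loop N j)"
    by (simp add: core_loop_def pathfinish_def pathstart_def)
qed

lemma (in seifert) arc_loop:
  defines "f \<equiv> base_section p N \<circ> linepath 0 (2 * pi)"
  shows "path f" "path_image f \<subseteq> E" "pathfinish f = pathstart f"
proof -
  show "path f" unfolding f_def
    by (intro path_continuous_image continuous_on_subset[OF base_section_continuous]) auto
  show "path_image f \<subseteq> E" unfolding f_def path_image_compose using base_section_in by blast
  show "pathfinish f = pathstart f"
    using base_section_periodic[of 0] by (simp add: f_def pathstart_compose pathfinish_compose)
qed

context field
begin

definition loop_chain :: "(real \<Rightarrow> 'e) \<Rightarrow> ((nat \<Rightarrow> real) \<Rightarrow> 'e) \<Rightarrow> 'a" where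
  "loop_chain f = frag_chain (frag_of (path_simplex f))"

lemma loop_chain_cycle:
  assumes "path f" "path_image f \<subseteq> E" "pathfinish f = pathstart f"
  shows "loop_chain f \<in> cycles R 1 (top_of_set E)"
proof -
  have "chain_bd R 1 (loop_chain f) = (\<lambda>t. \<zero>)"
    using chain_boundary_path_simplex[of f] assms(3) by (simp add: loop_chain_def chain_bd_of)
  moreover have "loop_chain f \<in> carrier (chain_module R 1 (top_of_set E))"
    unfolding loop_chain_def by (rule frag_chain_of_closed[OF singular_path_simplex[OF assms(1,2)]])
  ultimately show ?thesis by (simp add: cycles_def)
qed

lemma frag_chain_multiple: "frag_chain (\<Sum>i<n. c) t = [(n::nat)] \<cdot> \<one> \<otimes> frag_chain c t"
proof (induction n)
  case 0
  then show ?case by (simp add: add_pow_def)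
next
  case (Suc n)
  have "[Suc n] \<cdot> \<one> = [n] \<cdot> \<one> \<oplus> \<one>" by (simp add: add_pow_def)
  moreover have "[n] \<cdot> \<one> \<in> carrier R" by simp
  ultimately show ?case using Suc by (simp add: frag_chain_add l_distr)
qed

lemma seifert_cycles_subset:
  fixes p N :: nat
  assumes pN: "p > 0" "N \<ge> 2"
    and W: "chain_subspace 1 (top_of_set (seifert_space p N)) W"
      "boundaries R 1 (top_of_set (seifert_space p N)) \<subseteq> W"
    and arc: "loop_chain (base_section p N \<circ> linepath 0 (2 * pi)) \<in> W"
    and core: "\<And>j. loop_chain (core_loop N j) \<in> W"
  shows "cycles R 1 (top_of_set (seifert_space p N)) \<subseteq> W"
proof -
  interpret seifert p N by unfold_locales (use pN in auto)
  interpret path_relation E "{c. frag_chain c \<in> W}" "\<lambda>f. frag_of (path_simplex f)"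
    by (rule path_relation_chains[OF W])
  interpret seifert_relation p N "{c. frag_chain c \<in> W}" "\<lambda>f. frag_of (path_simplex f)" ..
  show ?thesis
  proof (rule cycles_subset_if_loops[OF seifert_path_connected _ W])
    show "E \<noteq> {}" using base_section_in by blast
    show "frag_chain (frag_of (path_simplex f)) \<in> W"
      if "path f" "path_image f \<subseteq> E" "pathfinish f = pathstart f" for f
      using loops_in_W[OF _ _ that] arc core by (simp add: loop_chain_def)
  qed
qed

text \<open>The cores repeat with period \<open>N\<close>; with the base section there are at most N
  + 1 generators.\<close>

lemma seifert_homology_le:
  fixes p N :: nat
  assumes pN: "p > 0" "N \<ge> 2"
  shows "vectorspace.fin_dim R (homology R 1 (top_of_set (seifert_space p N)))"
    "homology_dim R 1 (top_of_set (seifert_space p N)) \<le> N + 1"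
proof -
  interpret seifert p N by unfold_locales (use pN in auto)
  let ?a = "loop_chain (base_section p N \<circ> linepath 0 (2 * pi))"
  let ?S = "insert ?a ((\<lambda>j. loop_chain (core_loop N j)) ` {0..<int N})"
  have fin: "finite ?S" by simp
  have S: "?S \<subseteq> cycles R 1 (top_of_set E)"
    using loop_chain_cycle[OF arc_loop] loop_chain_cycle[OF core_loop_loop] by blast
  have span: "cycles R 1 (top_of_set E) \<subseteq> W"
    if W: "chain_subspace 1 (top_of_set E) W" "boundaries R 1 (top_of_set E) \<subseteq> W" "?S \<subseteq> W" for W
  proof (rule seifert_cycles_subset[OF pN W(1,2)])
    show "?a \<in> W" using W(3) by blast
    show "loop_chain (core_loop N j) \<in> W" for j
    proof -
      have "j mod int N \<in> {0..<int N}" using N_ge by simp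
      then have "loop_chain (core_loop N (j mod int N)) \<in> W" using W(3) by blast
      then show ?thesis by (simp only: core_loop_mod)
    qed
  qed
  show "vectorspace.fin_dim R (homology R 1 (top_of_set E))"
    by (rule homology_dim_le(1)[OF fin S span])
  have "homology_dim R 1 (top_of_set E) \<le> card ?S"
    by (rule homology_dim_le(2)[OF fin S span])
  also have "card ?S \<le> Suc (card ((\<lambda>j. loop_chain (core_loop N j)) ` {0..<int N}))"
    by (simp add: card_insert_if)
  also have "\<dots> \<le> N + 1" using card_image_le[of "{0..<int N}" "\<lambda>j. loop_chain (core_loop N j)"] by simp
  finally show "homology_dim R 1 (top_of_set E) \<le> N + 1" .
qed

text \<open>With p invertible, the relation between p c_j and p c_0 puts every c_j into any subspace
  that contains the boundaries and c_0.\<close>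

lemma seifert_homology_le_2:
  fixes p N :: nat
  assumes pN: "p > 0" "N \<ge> 2" and char: "[p] \<cdot> \<one> \<noteq> \<zero>"
  shows "homology_dim R 1 (top_of_set (seifert_space p N)) \<le> 2"
proof -
  interpret seifert p N by unfold_locales (use pN in auto)
  let ?a = "loop_chain (base_section p N \<circ> linepath 0 (2 * pi))"
  let ?S = "{?a, loop_chain (core_loop N 0)}"
  have fin: "finite ?S" by simp
  have S: "?S \<subseteq> cycles R 1 (top_of_set E)"
    using loop_chain_cycle[OF arc_loop] loop_chain_cycle[OF core_loop_loop] by blast
  have span: "cycles R 1 (top_of_set E) \<subseteq> W"
    if W: "chain_subspace 1 (top_of_set E) W" "boundaries R 1 (top_of_set E) \<subseteq> W" "?S \<subseteq> W" for W
  proof (rule seifert_cycles_subset[OF pN W(1,2)])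
    show "?a \<in> W" using W(3) by blast
    interpret path_relation E "{c. frag_chain c \<in> W}" "\<lambda>f. frag_of (path_simplex f)"
      by (rule path_relation_chains[OF W(1,2)])
    interpret seifert_relation p N "{c. frag_chain c \<in> W}" "\<lambda>f. frag_of (path_simplex f)" ..
    have Wsm: "(\<lambda>s. r \<otimes> c s) \<in> W" if "r \<in> carrier R" "c \<in> W" for r c
      using W(1) that unfolding chain_subspace_def by blast
    have m: "frag_chain (\<Sum>i<p. frag_of (path_simplex (core_loop N j))) =
        (\<lambda>t. [p] \<cdot> \<one> \<otimes> loop_chain (core_loop N j) t)" for j
      by (simp add: frag_chain_multiple loop_chain_def fun_eq_iff)
    have "loop_chain (core_loop N 0) \<in> W" using W(3) by blast
    from Wsm[OF _ this, of "[p] \<cdot> \<one>"]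
    have "(\<Sum>i<p. frag_of (path_simplex (core_loop N 0))) \<in> {c. frag_chain c \<in> W}"
      unfolding mem_Collect_eq m by simp
    then have "(\<Sum>i<p. frag_of (path_simplex (core_loop N j))) \<in> {c. frag_chain c \<in> W}" for j
      using W_sub_left[OF core_multiples_homologous[of j 0]] by blast
    then have pW: "(\<lambda>t. [p] \<cdot> \<one> \<otimes> loop_chain (core_loop N j) t) \<in> W" for j
      unfolding mem_Collect_eq m .
    have pR: "[p] \<cdot> \<one> \<in> carrier R" by simp
    have inv: "inv ([p] \<cdot> \<one>) \<in> carrier R" "inv ([p] \<cdot> \<one>) \<otimes> ([p] \<cdot> \<one>) = \<one>"
      using char pR by (auto simp: field_Units)
    show "loop_chain (core_loop N j) \<in> W" for j
    proof -
      have "(\<lambda>t. inv ([p] \<cdot> \<one>) \<otimes> ([p] \<cdot> \<one> \<otimes> loop_chain (core_loop N j) t)) = loop_chain (core_loop N j)"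
        using inv pR by (simp add: m_assoc[symmetric] loop_chain_def)
      then show ?thesis using Wsm[OF inv(1) pW[of j]] by simp
    qed
  qed
  have "homology_dim R 1 (top_of_set E) \<le> card ?S"
    by (rule homology_dim_le(2)[OF fin S span])
  also have "\<dots> \<le> 2" by (simp add: card_insert_if)
  finally show ?thesis .
qed

end

text \<open>The cocycles pulled back by \<open>branch_map j\<close> pair with the cores in minus the
  identity matrix, so the \<open>N\<close> cores are independent modulo p.\<close>

lemma seifert_homology_mod_p:
  fixes p N :: nat
  assumes p: "prime p" and N: "N \<ge> 2"
  shows "N \<le> homology_dim (residue_ring (int p)) 1 (top_of_set (seifert_space p N))"
    "homology_dim (residue_ring (int p)) 1 (top_of_set (seifert_space p N)) \<le> N + 1"
proof -
  have p_pos: "p > 0" using p by (rule prime_gt_0_nat)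
  interpret seifert p N by unfold_locales (use p_pos N in auto)
  define K where "K = residue_ring (int p)"
  interpret RP: residues_prime p K by unfold_locales (simp_all add: p K_def)
  show "homology_dim (residue_ring (int p)) 1 (top_of_set E) \<le> N + 1"
    using RP.seifert_homology_le(2)[OF p_pos N] by (simp add: K_def)
  \<comment> \<open>Composition with \<open>simplex_point1\<close> turns a 1-simplex back into a
    path; outside the singular simplices of \<open>E\<close> the cochain is 0 by default.\<close>
  define \<delta> where "\<delta> = (\<lambda>j s. if singular_simplex 1 (top_of_set E) s
     then monodromy p (branch_map j \<circ> (s \<circ> simplex_point1)) else 0)"
  have \<delta>path: "\<delta> j (path_simplex f) = monodromy p (branch_map j \<circ> f)"
    if "path f" "path_image f \<subseteq> E" for j f
  proof -
    have "monodromy p (branch_map j \<circ> (path_simplex f \<circ> simplex_point1)) = monodromy p (branch_map j \<circ> f)"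
    proof (rule monodromy_cong)
      fix t :: real assume "t \<in> {0..1}"
      then have "path_simplex f (simplex_point1 t) = f (simplex_point1 t 1)"
        using simplex_point1_in by (simp add: path_simplex_def)
      then show "(branch_map j \<circ> (path_simplex f \<circ> simplex_point1)) t = (branch_map j \<circ> f) t"
        by (simp add: simplex_point1_def)
    qed
    then show ?thesis using singular_path_simplex[OF that] by (simp add: \<delta>_def)
  qed
  have mR: "monodromy p f \<in> carrier K" for f
    using p_pos by (simp add: monodromy_def Let_def RP.res_carrier_eq)
  have \<delta>R: "\<delta> j s \<in> carrier K" for j s
    using mR p_pos by (auto simp: \<delta>_def RP.res_carrier_eq)
  have cocycle: "RP.chain_pair (\<delta> j) (RP.frag_chain (chain_boundary (Suc 1) (frag_of s))) = \<zero>\<^bsub>K\<^esub>"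
    if s: "singular_simplex (Suc 1) (top_of_set E) s" for j s
  proof -
    obtain \<tau> where \<tau>: "continuous_on triangle \<tau>" "\<tau> ` triangle \<subseteq> E" "s = triangle_simplex \<tau>"
      using singular_simplex2E[of E s] s by (auto simp: numeral_2_eq_2)
    have e: "\<delta> j (path_simplex (\<lambda>t. \<tau> (a t))) = monodromy p (\<lambda>t. branch_map j (\<tau> (a t)))"
      if "continuous_on {0..1} a" "\<And>t. t \<in> {0..1} \<Longrightarrow> a t \<in> triangle" for a :: "real \<Rightarrow> real \<times> real"
    proof -
      have "continuous_on {0..1} (\<lambda>t. \<tau> (a t))"
        by (rule continuous_on_compose2[OF \<tau>(1) that(1)]) (use that(2) in auto)
      then have "\<delta> j (path_simplex (\<lambda>t. \<tau> (a t))) = monodromy p (branch_map j \<circ> (\<lambda>t. \<tau> (a t)))"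
        by (intro \<delta>path) (use \<tau>(2) that(2) in \<open>auto simp: path_def path_image_def\<close>)
      then show ?thesis by (simp add: o_def)
    qed
    have e1: "\<delta> j (path_simplex (\<lambda>t. \<tau> (1 - t, t))) = monodromy p (\<lambda>t. (branch_map j \<circ> \<tau>) (1 - t, t))"
      unfolding o_def by (rule e) (auto simp: triangle_def intro!: continuous_intros)
    have e2: "\<delta> j (path_simplex (\<lambda>t. \<tau> (0, t))) = monodromy p (\<lambda>t. (branch_map j \<circ> \<tau>) (0, t))"
      unfolding o_def by (rule e) (auto simp: triangle_def intro!: continuous_intros)
    have e3: "\<delta> j (path_simplex (\<lambda>t. \<tau> (t, 0))) = monodromy p (\<lambda>t. (branch_map j \<circ> \<tau>) (t, 0))"
      unfolding o_def by (rule e) (auto simp: triangle_def intro!: continuous_intros)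
    have "[monodromy p (\<lambda>t. (branch_map j \<circ> \<tau>) (1 - t, t)) - monodromy p (\<lambda>t. (branch_map j \<circ> \<tau>) (0, t))
        + monodromy p (\<lambda>t. (branch_map j \<circ> \<tau>) (t, 0)) = 0] (mod int p)"
    proof (rule monodromy_triangle[OF p_pos])
      show "continuous_on triangle (branch_map j \<circ> \<tau>)"
        by (intro continuous_on_compose \<tau>(1) branch_map_continuous)
      show "(branch_map j \<circ> \<tau>) ` triangle \<subseteq> quotient_surface p"
        using \<tau>(2) branch_map_in by (auto simp: image_subset_iff)
    qed
    then have c: "[\<delta> j (path_simplex (\<lambda>t. \<tau> (1 - t, t))) - \<delta> j (path_simplex (\<lambda>t. \<tau> (0, t)))
        + \<delta> j (path_simplex (\<lambda>t. \<tau> (t, 0))) = 0] (mod int p)"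
      unfolding e1 e2 e3 .
    have "RP.chain_pair (\<delta> j) (RP.frag_chain (chain_boundary (Suc 1) (frag_of s))) =
       \<delta> j (path_simplex (\<lambda>t. \<tau> (1 - t, t))) \<ominus>\<^bsub>K\<^esub> \<delta> j (path_simplex (\<lambda>t. \<tau> (0, t)))
        \<oplus>\<^bsub>K\<^esub> \<delta> j (path_simplex (\<lambda>t. \<tau> (t, 0)))"
      using chain_boundary_triangle_simplex[of \<tau>] \<delta>R
      by (simp add: \<tau>(3) numeral_2_eq_2 RP.chain_pair_frag_add RP.chain_pair_frag_diff RP.chain_pair_of)
    also have "\<dots> = (\<delta> j (path_simplex (\<lambda>t. \<tau> (1 - t, t))) - \<delta> j (path_simplex (\<lambda>t. \<tau> (0, t)))
        + \<delta> j (path_simplex (\<lambda>t. \<tau> (t, 0)))) mod int p"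
      by (simp add: a_minus_def RP.res_add_eq RP.res_neg_eq mod_simps)
    also have "\<dots> = \<zero>\<^bsub>K\<^esub>" using c by (simp add: cong_def RP.res_zero_eq)
    finally show ?thesis .
  qed
  have pair: "RP.chain_pair (\<delta> j) (RP.loop_chain (core_loop N k)) = (if j = k then -1 else 0) mod int p"
    if "j \<in> {0..<int N}" "k \<in> {0..<int N}" for j k
    using monodromy_core[of j k] that \<delta>R
    by (simp add: RP.loop_chain_def RP.chain_pair_of \<delta>path[OF core_loop_loop(1,2)])
  have "card {0..<int N} \<le> homology_dim K 1 (top_of_set E)"
  proof (rule RP.homology_dim_ge[where \<delta> = \<delta> and b = "\<lambda>k. RP.loop_chain (core_loop N k)"])
    show "vectorspace.fin_dim K (homology K 1 (top_of_set E))"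
      by (rule RP.seifert_homology_le(1)[OF p_pos N])
    show "RP.loop_chain (core_loop N k) \<in> cycles K 1 (top_of_set E)" for k
      by (rule RP.loop_chain_cycle[OF core_loop_loop])
    show "RP.chain_pair (\<delta> j) (RP.loop_chain (core_loop N k)) = \<zero>\<^bsub>K\<^esub>"
      if "j \<in> {0..<int N}" "k \<in> {0..<int N}" "j \<noteq> k" for j k
      using pair[OF that(1,2)] that(3) by (simp add: RP.res_zero_eq)
    show "RP.chain_pair (\<delta> j) (RP.loop_chain (core_loop N j)) \<noteq> \<zero>\<^bsub>K\<^esub>" if "j \<in> {0..<int N}" for j
      using pair[OF that that] prime_gt_1_nat[OF p] by (simp add: RP.res_zero_eq zmod_minus1)
  qed (use \<delta>R cocycle in auto)
  then show "N \<le> homology_dim (residue_ring (int p)) 1 (top_of_set E)" by (simp add: K_def)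
qed

lemma rat_field_field: "field rat_field"
proof -
  have s: "carrier rat_field = UNIV" "monoid.mult rat_field = (*)" "one rat_field = 1"
    "zero rat_field = 0" "add rat_field = (+)"
    by (simp_all add: rat_field_def)
  have "cring rat_field"
  proof (rule cringI)
    show "abelian_group rat_field"
      by (rule abelian_groupI) (auto simp: s add.commute intro: exI[of _ "- x" for x])
    show "comm_monoid rat_field"
      by (rule comm_monoidI) (auto simp: s)
  qed (auto simp: s distrib_right)
  then show ?thesis
  proof (rule cring.cring_fieldI)
    show "Units rat_field = carrier rat_field - {\<zero>\<^bsub>rat_field\<^esub>}"
    proof -
      have "\<exists>y. y * x = 1 \<and> x * y = 1" if "x \<noteq> 0" for x :: rat
        using that by (intro exI[of _ "inverse x"]) auto
      then show ?thesis unfolding Units_def s by auto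
    qed
  qed
qed

lemma seifert_homology_rat:
  fixes p N :: nat
  assumes "p > 0" "N \<ge> 2"
  shows "homology_dim rat_field 1 (top_of_set (seifert_space p N)) \<le> 2"
proof -
  interpret field rat_field by (rule rat_field_field)
  have "[(n::nat)] \<cdot>\<^bsub>rat_field\<^esub> \<one>\<^bsub>rat_field\<^esub> = of_nat n" for n
    by (induction n) (simp_all add: add_pow_def rat_field_def)
  then have "[p] \<cdot>\<^bsub>rat_field\<^esub> \<one>\<^bsub>rat_field\<^esub> \<noteq> \<zero>\<^bsub>rat_field\<^esub>"
    using assms by (simp add: rat_field_def)
  then show ?thesis using seifert_homology_le_2 assms by blast
qed

section \<open>Winding numbers as a homomorphism from the fundamental group to the integers\<close>

section \<open>Fundamental groups and cyclic covers\<close>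

lemma mem_path_class: "g \<in> path_class S f \<longleftrightarrow> homotopic_paths S f g"
  by (simp add: path_class_def)

lemma path_class_eq:
  assumes "homotopic_paths S f g"
  shows "path_class S f = path_class S g"
  using assms homotopic_paths_sym homotopic_paths_trans unfolding path_class_def by blast

lemma path_class_self:
  "path f \<Longrightarrow> path_image f \<subseteq> S \<Longrightarrow> f \<in> path_class S f"
  by (simp add: mem_path_class)

definition loops_at :: "'a::topological_space set \<Rightarrow> 'a \<Rightarrow> (real \<Rightarrow> 'a) set" where
  "loops_at S a = {f. path f \<and> path_image f \<subseteq> S \<and> pathstart f = a \<and> pathfinish f = a}"

lemma carrier_fundamental_group: "carrier (fundamental_group S a) = path_class S ` loops_at S a"
  by (auto simp: fundamental_group_def loops_at_def)

text \<open>The product is a union over all representatives. Joins of homotopic loops are homotopic,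
  so every term of the union is the same class.\<close>

lemma fundamental_group_mult:
  assumes f: "f \<in> loops_at S a" and g: "g \<in> loops_at S a"
  shows "path_class S f \<otimes>\<^bsub>fundamental_group S a\<^esub> path_class S g = path_class S (f +++ g)"
proof -
  have "path_class S (f' +++ g') = path_class S (f +++ g)"
    if "f' \<in> path_class S f" "g' \<in> path_class S g" for f' g'
  proof -
    have "homotopic_paths S (f +++ g) (f' +++ g')"
      using that f g by (intro homotopic_paths_join) (auto simp: mem_path_class loops_at_def)
    then show ?thesis by (rule path_class_eq[symmetric])
  qed
  moreover have "f \<in> path_class S f" "g \<in> path_class S g"
    using f g by (auto simp: loops_at_def path_class_self)
  ultimately have "(\<Union>f'\<in>path_class S f. \<Union>g'\<in>path_class S g. path_class S (f' +++ g')) = path_class S (f +++ g)"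
    by blast
  then show ?thesis by (simp add: fundamental_group_def)
qed

lemma loops_at_join: "f \<in> loops_at S a \<Longrightarrow> g \<in> loops_at S a \<Longrightarrow> f +++ g \<in> loops_at S a"
  by (auto simp: loops_at_def path_image_join)

lemma loops_at_reversepath: "f \<in> loops_at S a \<Longrightarrow> reversepath f \<in> loops_at S a"
  by (auto simp: loops_at_def)

lemma loops_at_const: "a \<in> S \<Longrightarrow> linepath a a \<in> loops_at S a"
  by (auto simp: loops_at_def)

lemma group_fundamental_group:
  fixes S :: "'a::real_normed_vector set"
  assumes a: "a \<in> S"
  shows "group (fundamental_group S a)"
proof (rule groupI)
  let ?G = "fundamental_group S a"
  have one: "\<one>\<^bsub>?G\<^esub> = path_class S (linepath a a)"
    by (simp add: fundamental_group_def linepath_refl)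
  show "\<one>\<^bsub>?G\<^esub> \<in> carrier ?G"
    using loops_at_const[OF a] by (simp add: one carrier_fundamental_group)
  fix A assume "A \<in> carrier ?G"
  then obtain f where f: "f \<in> loops_at S a" "A = path_class S f"
    by (auto simp: carrier_fundamental_group)
  have "homotopic_paths S (linepath a a +++ f) f"
    using f by (intro homotopic_paths_lid') (auto simp: loops_at_def)
  then show "\<one>\<^bsub>?G\<^esub> \<otimes>\<^bsub>?G\<^esub> A = A"
    using f loops_at_const[OF a] by (simp add: one fundamental_group_mult path_class_eq)
  have "homotopic_paths S (reversepath f +++ f) (linepath a a)"
    using homotopic_paths_linv[of f S] f by (simp add: loops_at_def)
  then have "path_class S (reversepath f) \<otimes>\<^bsub>?G\<^esub> A = \<one>\<^bsub>?G\<^esub>"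
    using f loops_at_reversepath[OF f(1)] by (simp add: one fundamental_group_mult path_class_eq)
  then show "\<exists>B\<in>carrier ?G. B \<otimes>\<^bsub>?G\<^esub> A = \<one>\<^bsub>?G\<^esub>"
    using loops_at_reversepath[OF f(1)] by (auto simp: carrier_fundamental_group)
  fix B assume "B \<in> carrier ?G"
  then obtain g where g: "g \<in> loops_at S a" "B = path_class S g"
    by (auto simp: carrier_fundamental_group)
  show "A \<otimes>\<^bsub>?G\<^esub> B \<in> carrier ?G"
    using f g loops_at_join[OF f(1) g(1)] by (simp add: fundamental_group_mult carrier_fundamental_group)
  fix C assume "C \<in> carrier ?G"
  then obtain h where h: "h \<in> loops_at S a" "C = path_class S h"
    by (auto simp: carrier_fundamental_group)
  have "homotopic_paths S (f +++ (g +++ h)) ((f +++ g) +++ h)"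
    using f g h by (intro homotopic_paths_assoc) (auto simp: loops_at_def)
  then show "A \<otimes>\<^bsub>?G\<^esub> B \<otimes>\<^bsub>?G\<^esub> C = A \<otimes>\<^bsub>?G\<^esub> (B \<otimes>\<^bsub>?G\<^esub> C)"
    using f g h fundamental_group_mult[OF loops_at_join[OF f(1) g(1)] h(1)]
      fundamental_group_mult[OF f(1) loops_at_join[OF g(1) h(1)]]
    by (simp add: fundamental_group_mult path_class_eq)
qed

lemma pi1_map_path_class:
  fixes S :: "'b::real_normed_vector set" and h :: "'a::real_normed_vector \<Rightarrow> 'b"
  assumes h: "continuous_on E h" "h ` E \<subseteq> S" and f: "path f" "path_image f \<subseteq> E"
  shows "pi1_map S h (path_class E f) = path_class S (h \<circ> f)"
proof -
  have "path_class S (h \<circ> f') = path_class S (h \<circ> f)" if "f' \<in> path_class E f" for f'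
  proof -
    have "homotopic_paths S (h \<circ> f) (h \<circ> f')"
      using that h by (intro homotopic_paths_continuous_image[of E]) (auto simp: mem_path_class)
    then show ?thesis by (rule path_class_eq[symmetric])
  qed
  then show ?thesis
    using path_class_self[OF f] unfolding pi1_map_def by blast
qed

text \<open>The function \<open>d\<close> pulls the generator of the first cohomology of the
  punctured plane back to \<open>X\<close>; the homomorphism \<open>wind\<close> represents this
  class.\<close>

locale winding_map =
  fixes X :: "'a::real_normed_vector set" and a :: 'a and d :: "'a \<Rightarrow> complex"
  assumes a: "a \<in> X" and d: "continuous_on X d" "\<And>x. x \<in> X \<Longrightarrow> d x \<noteq> 0"
begin

text \<open>The winding number of a closed path is an integer given as a complex number; real part
  and floor extract it.\<close>

definition wind :: "(real \<Rightarrow> 'a) set \<Rightarrow> int" where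
  "wind A = \<lfloor>Re (winding_number (d \<circ> (SOME f. f \<in> A)) 0)\<rfloor>"

lemma loop_image:
  assumes "f \<in> loops_at X a"
  shows "path (d \<circ> f)" "0 \<notin> path_image (d \<circ> f)" "pathfinish (d \<circ> f) = pathstart (d \<circ> f)"
proof -
  show "path (d \<circ> f)"
    using assms d(1) by (auto simp: loops_at_def intro!: path_continuous_image continuous_on_subset[OF d(1)])
  show "0 \<notin> path_image (d \<circ> f)"
    using assms d(2) by (auto simp: loops_at_def path_image_compose)
  show "pathfinish (d \<circ> f) = pathstart (d \<circ> f)"
    using assms by (simp add: loops_at_def pathfinish_compose pathstart_compose)
qed

lemma winding_wind:
  assumes f: "f \<in> loops_at X a"
  shows "winding_number (d \<circ> f) 0 = of_int (wind (path_class X f))"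
proof -
  define g where "g = (SOME g. g \<in> path_class X f)"
  have "f \<in> path_class X f" using f by (simp add: loops_at_def path_class_self)
  then have "g \<in> path_class X f" unfolding g_def by (rule someI[where P = "\<lambda>g. g \<in> path_class X f"])
  then have "homotopic_paths X f g" by (simp add: mem_path_class)
  then have "homotopic_paths (- {0}) (d \<circ> f) (d \<circ> g)"
    by (rule homotopic_paths_continuous_image[OF _ d(1)]) (use d(2) in auto)
  then have e: "winding_number (d \<circ> f) 0 = winding_number (d \<circ> g) 0"
    by (rule winding_number_homotopic_paths)
  have "winding_number (d \<circ> f) 0 \<in> \<int>"
    using loop_image[OF f] by (intro integer_winding_number) auto
  then obtain n where "winding_number (d \<circ> f) 0 = of_int n" by (auto elim: Ints_cases)
  then show ?thesis using e unfolding wind_def g_def[symmetric] by simp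
qed

lemma wind_mult:
  assumes "A \<in> carrier (fundamental_group X a)" "B \<in> carrier (fundamental_group X a)"
  shows "wind (A \<otimes>\<^bsub>fundamental_group X a\<^esub> B) = wind A + wind B"
proof -
  obtain f g where fg: "f \<in> loops_at X a" "A = path_class X f" "g \<in> loops_at X a" "B = path_class X g"
    using assms by (auto simp: carrier_fundamental_group)
  have "of_int (wind (path_class X (f +++ g))) = winding_number ((d \<circ> f) +++ (d \<circ> g)) 0"
    using winding_wind[OF loops_at_join[OF fg(1,3)]] by (simp add: path_compose_join)
  also have "\<dots> = winding_number (d \<circ> f) 0 + winding_number (d \<circ> g) 0"
    using loop_image[OF fg(1)] loop_image[OF fg(3)] fg(1,3)
    by (intro winding_number_join) (auto simp: loops_at_def pathfinish_compose pathstart_compose)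
  also have "\<dots> = of_int (wind A + wind B)"
    using winding_wind fg by simp
  finally show ?thesis
    using fg by (simp add: fundamental_group_mult flip: of_int_add)
qed

text \<open>\<open>wind\<close> modulo \<open>N\<close> maps onto the cyclic group, as the powers of
  \<open>A\<close> reach every residue. The index of its kernel follows from the first isomorphism
  theorem.\<close>

lemma wind_index:
  assumes one: "A \<in> carrier (fundamental_group X a)" "wind A = 1" and N: "N > 0"
  shows "card (rcosets\<^bsub>fundamental_group X a\<^esub> {g \<in> carrier (fundamental_group X a). int N dvd wind g}) = N"
proof -
  let ?G = "fundamental_group X a"
  let ?H = "integer_mod_group N"
  define h where "h = (\<lambda>g. wind g mod int N)"
  interpret G: group ?G by (rule group_fundamental_group[OF a])
  have "h \<in> hom ?G ?H"
    using N by (auto simp: hom_def h_def carrier_integer_mod_group wind_mult mod_simps integer_mod_group_def)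
  then interpret group_hom ?G ?H h
    by (intro group_hom.intro group_hom_axioms.intro G.group_axioms group_integer_mod_group)
  have pow: "wind (A [^]\<^bsub>?G\<^esub> n) = int n" for n :: nat
  proof (induction n)
    case 0
    have "wind \<one>\<^bsub>?G\<^esub> = 0" using wind_mult[of "\<one>\<^bsub>?G\<^esub>" "\<one>\<^bsub>?G\<^esub>"] by simp
    then show ?case by simp
  next
    case (Suc n)
    then show ?case using one wind_mult[of "A [^]\<^bsub>?G\<^esub> n" A] by simp
  qed
  have surj: "h ` carrier ?G = carrier ?H"
  proof
    show "carrier ?H \<subseteq> h ` carrier ?G"
    proof
      fix m assume "m \<in> carrier ?H"
      then have m: "0 \<le> m" "m < int N" using N by (auto simp: carrier_integer_mod_group)
      then have "h (A [^]\<^bsub>?G\<^esub> nat m) = m" unfolding h_def pow by simp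
      then show "m \<in> h ` carrier ?G" using one(1) G.nat_pow_closed by (metis image_eqI)
    qed
    show "h ` carrier ?G \<subseteq> carrier ?H"
      using N by (auto simp: h_def carrier_integer_mod_group)
  qed
  have "kernel ?G ?H h = {g \<in> carrier ?G. int N dvd wind g}"
    by (auto simp: kernel_def h_def dvd_eq_mod_eq_0)
  moreover have "card (carrier (?G Mod kernel ?G ?H h)) = card (carrier ?H)"
    using FactGroup_iso_set[OF surj] by (auto simp: iso_def intro: bij_betw_same_card)
  ultimately show ?thesis
    using N by (simp add: FactGroup_def carrier_integer_mod_group)
qed

end

section \<open>The cover on which a function acquires an N-th root: deck group and subgroup\<close>

section \<open>The cyclic covers\<close>

text \<open>Points of \<open>E\<close> correspond to pairs of a point x and an N-th root of d x, and
  \<open>k\<close> inverts this correspondence. An abstract \<open>E\<close> leaves room for the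
  concrete Seifert space.\<close>

locale root_cover = winding_map X a d
  for X :: "'a::real_normed_vector set" and a :: 'a and d :: "'a \<Rightarrow> complex" +
  fixes N :: nat and E :: "'b::real_normed_vector set" and q :: "'b \<Rightarrow> 'a" and Y :: "'b \<Rightarrow> complex"
    and k :: "'a \<times> complex \<Rightarrow> 'b"
  assumes N: "N > 0"
    and q: "continuous_on E q" and Y: "continuous_on E Y"
    and k: "continuous_on {(x, y). x \<in> X \<and> y ^ N = d x} k"
    and to_pair: "\<And>e. e \<in> E \<Longrightarrow> q e \<in> X \<and> Y e ^ N = d (q e) \<and> k (q e, Y e) = e"
    and of_pair: "\<And>x y. x \<in> X \<Longrightarrow> y ^ N = d x \<Longrightarrow> k (x, y) \<in> E \<and> q (k (x, y)) = x \<and> Y (k (x, y)) = y"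
begin

lemma covering: "covering_space E q X"
  by (rule covering_space_power_pullback[OF N q Y d k to_pair of_pair])

lemma Y_nonzero: "e \<in> E \<Longrightarrow> Y e \<noteq> 0"
  using to_pair[of e] d(2)[of "q e"] N by (auto simp: zero_power)

definition rotation :: "complex \<Rightarrow> 'b \<Rightarrow> 'b" where
  "rotation c = restrict (\<lambda>e. k (q e, c * Y e)) E"

lemma rotation:
  assumes "c ^ N = 1" "e \<in> E"
  shows "rotation c e \<in> E" "q (rotation c e) = q e" "Y (rotation c e) = c * Y e"
proof -
  have "(c * Y e) ^ N = d (q e)" using assms to_pair[OF assms(2)] by (simp add: power_mult_distrib)
  from of_pair[OF _ this] to_pair[OF assms(2)] assms(2)
  show "rotation c e \<in> E" "q (rotation c e) = q e" "Y (rotation c e) = c * Y e"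
    by (auto simp: rotation_def)
qed

lemma eq_if_same: "e \<in> E \<Longrightarrow> e' \<in> E \<Longrightarrow> q e = q e' \<Longrightarrow> Y e = Y e' \<Longrightarrow> e = e'"
  using to_pair by metis

lemma rotation_continuous:
  assumes "c ^ N = 1"
  shows "continuous_on E (rotation c)"
proof -
  have "continuous_on E (\<lambda>e. (q e, c * Y e))" by (intro continuous_intros q Y)
  then have "continuous_on E (\<lambda>e. k (q e, c * Y e))"
    by (rule continuous_on_compose2[OF k])
      (use to_pair assms in \<open>auto simp: power_mult_distrib\<close>)
  then show ?thesis by (simp add: rotation_def cong: continuous_on_cong)
qed

lemma rotation_inverse:
  assumes "c ^ N = 1" "e \<in> E"
  shows "rotation (inverse c) (rotation c e) = e"
proof -
  have c: "c \<noteq> 0" using assms N by (auto simp: zero_power)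
  have i: "inverse c ^ N = 1" using assms(1) by (simp add: power_inverse)
  note r = rotation[OF assms]
  note r' = rotation[OF i r(1)]
  show ?thesis by (rule eq_if_same) (use r r' assms(2) c in auto)
qed

lemma rotation_deck:
  assumes "c ^ N = 1"
  shows "rotation c \<in> carrier (deck_group E q)"
proof -
  have c: "c \<noteq> 0" using assms N by (auto simp: zero_power)
  have i: "inverse c ^ N = 1" using assms by (simp add: power_inverse)
  have "homeomorphism E E (rotation c) (rotation (inverse c))"
  proof (rule homeomorphismI)
    show "rotation c (rotation (inverse c) e) = e" if "e \<in> E" for e
      using rotation_inverse[OF i that] by simp
  qed (use rotation_continuous[OF assms] rotation_continuous[OF i] rotation[OF assms] rotation[OF i]
      rotation_inverse[OF assms] in auto)
  then show ?thesis
    using rotation[OF assms] by (auto simp: deck_group_def rotation_def)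
qed

text \<open>The quotient of Y after f by Y is continuous with values in the N-th roots of unity,
  hence constant on a connected space.\<close>

lemma deck_rotation:
  assumes E: "connected E" "E \<noteq> {}" and f: "f \<in> carrier (deck_group E q)"
  obtains c where "c ^ N = 1" "f = rotation c"
proof -
  have fe: "f \<in> extensional E" "\<And>e. e \<in> E \<Longrightarrow> q (f e) = q e"
    using f by (auto simp: deck_group_def)
  obtain g where g: "homeomorphism E E f g" using f by (auto simp: deck_group_def)
  have fE: "f e \<in> E" if "e \<in> E" for e using g that by (auto simp: homeomorphism_def)
  have cf: "continuous_on E f" using g by (simp add: homeomorphism_def)
  define r where "r = (\<lambda>e. Y (f e) / Y e)"
  have r1: "r e ^ N = 1" if "e \<in> E" for e
    using to_pair[OF that] to_pair[OF fE[OF that]] fe(2)[OF that] d(2)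
    by (simp add: r_def power_divide)
  have "continuous_on E r"
    unfolding r_def
    by (intro continuous_intros continuous_on_compose2[OF Y cf] Y) (use fE Y_nonzero in auto)
  moreover have "finite (r ` E)"
    by (rule finite_subset[OF _ finite_nth_roots[OF N, of 1]]) (use r1 in auto)
  ultimately have "r constant_on E"
    by (rule continuous_finite_range_constant[OF E(1)])
  then obtain c where c: "\<And>e. e \<in> E \<Longrightarrow> r e = c" by (auto simp: constant_on_def)
  have c1: "c ^ N = 1" using E(2) r1 c by force
  have "f = rotation c"
  proof
    fix e show "f e = rotation c e"
    proof (cases "e \<in> E")
      case True
      have "Y (f e) = c * Y e" using c[OF True] Y_nonzero[OF True] by (simp add: r_def field_simps)
      then show ?thesis
        using rotation[OF c1 True] fE[OF True] fe(2)[OF True] by (intro eq_if_same) auto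
    next
      case False
      then show ?thesis using fe(1) by (simp add: rotation_def extensional_def)
    qed
  qed
  then show ?thesis using c1 by (rule that[rotated])
qed

lemma deck_order:
  assumes E: "connected E" "E \<noteq> {}"
  shows "order (deck_group E q) = N"
proof -
  have "bij_betw rotation {c. c ^ N = 1} (carrier (deck_group E q))"
    unfolding bij_betw_def
  proof
    obtain e where e: "e \<in> E" using E(2) by blast
    show "inj_on rotation {c. c ^ N = 1}"
    proof (rule inj_onI)
      fix c c' assume "c \<in> {c. c ^ N = 1}" "c' \<in> {c. c ^ N = 1}" "rotation c = rotation c'"
      then have *: "c ^ N = 1" "c' ^ N = 1" "Y (rotation c e) = Y (rotation c' e)" by simp_all
      then have "c * Y e = c' * Y e"
        using rotation(3)[OF *(1) e] rotation(3)[OF *(2) e] by simp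
      then show "c = c'" using Y_nonzero[OF e] by simp
    qed
    show "rotation ` {c. c ^ N = 1} = carrier (deck_group E q)"
    proof (intro equalityI subsetI)
      fix f assume "f \<in> carrier (deck_group E q)"
      then obtain c where "c ^ N = 1" "f = rotation c" by (rule deck_rotation[OF E])
      then show "f \<in> rotation ` {c. c ^ N = 1}" by simp
    next
      fix f assume "f \<in> rotation ` {c. c ^ N = 1}"
      then show "f \<in> carrier (deck_group E q)" using rotation_deck by auto
    qed
  qed
  then have "card (carrier (deck_group E q)) = card {c :: complex. c ^ N = 1}"
    by (simp add: bij_betw_same_card)
  also have "\<dots> = N" using N by (intro card_nth_roots) auto
  finally show ?thesis by (simp add: order_def)
qed

lemma is_p_cover:
  assumes E: "path_connected E" "E \<noteq> {}" and Np: "N = p ^ i"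
  shows "p_cover p E q X"
  unfolding p_cover_def
proof (intro conjI ballI impI)
  show "covering_space E q X" by (rule covering)
  show "path_connected E" by (rule E)
  show "finite {e \<in> E. q e = x}" for x
  proof (rule finite_subset)
    show "{e \<in> E. q e = x} \<subseteq> (\<lambda>y. k (x, y)) ` {y. y ^ N = d x}"
    proof
      fix e assume "e \<in> {e \<in> E. q e = x}"
      then show "e \<in> (\<lambda>y. k (x, y)) ` {y. y ^ N = d x}"
        using to_pair[of e] by (intro image_eqI[of _ _ "Y e"]) auto
    qed
    show "finite ((\<lambda>y. k (x, y)) ` {y. y ^ N = d x})"
      by (intro finite_imageI finite_nth_roots N)
  qed
  show "\<exists>f\<in>carrier (deck_group E q). f e = e'" if "e \<in> E" "e' \<in> E" "q e = q e'" for e e'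
  proof -
    have nz: "Y e \<noteq> 0" by (rule Y_nonzero[OF that(1)])
    have c: "(Y e' / Y e) ^ N = 1"
      using to_pair[OF that(1)] to_pair[OF that(2)] that(3) d(2) by (simp add: power_divide)
    have "rotation (Y e' / Y e) e = e'"
      by (rule eq_if_same) (use rotation[OF c that(1)] that nz in auto)
    then show ?thesis using rotation_deck[OF c] by blast
  qed
  show "\<exists>j. order (deck_group E q) = p ^ j"
    using deck_order[OF path_connected_imp_connected[OF E(1)] E(2)] Np by blast
qed

text \<open>Along the image of a loop in \<open>E\<close>, the winding number of \<open>d\<close> is
  \<open>N\<close> times that of \<open>Y\<close>. Conversely, if \<open>N\<close> divides the
  winding number of \<open>d\<close> along f, a continuous N-th root of \<open>d\<close> along f
  returns to its initial value and gives a closed lift of f.\<close>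

lemma corresponds:
  "corresponds_to_subgroup E q X a {g \<in> carrier (fundamental_group X a). int N dvd wind g}"
proof -
  obtain e where e: "e \<in> E" "q e = a"
    using covering_space_imp_surjective[OF covering] a by auto
  have qE: "q ` E \<subseteq> X" using to_pair by blast
  have "pi1_map X q ` carrier (fundamental_group E e) = {g \<in> carrier (fundamental_group X a). int N dvd wind g}"
  proof (intro equalityI subsetI)
    fix A assume "A \<in> pi1_map X q ` carrier (fundamental_group E e)"
    then obtain l where l: "l \<in> loops_at E e" "A = pi1_map X q (path_class E l)"
      by (auto simp: carrier_fundamental_group)
    then have A: "A = path_class X (q \<circ> l)"
      using pi1_map_path_class[OF q qE] by (simp add: loops_at_def)
    have ql: "q \<circ> l \<in> loops_at X a"
      using l(1) e qE q by (auto simp: loops_at_def path_image_compose pathstart_compose pathfinish_compose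
          intro!: path_continuous_image continuous_on_subset[OF q])
    have lE: "l t \<in> E" if "t \<in> {0..1}" for t using l(1) that by (auto simp: loops_at_def path_image_def)
    have pY: "path (Y \<circ> l)"
      using l(1) by (auto simp: loops_at_def intro!: path_continuous_image continuous_on_subset[OF Y])
    have zY: "0 \<notin> path_image (Y \<circ> l)" using lE Y_nonzero by (auto simp: path_image_def)
    obtain c where c: "path c" "pathfinish c - pathstart c = 2 * of_real pi * \<i> * winding_number (Y \<circ> l) 0"
      "\<And>t. t \<in> {0..1} \<Longrightarrow> (Y \<circ> l) t = 0 + exp (c t)"
      using winding_number_as_continuous_log[OF pY zY] by metis
    have "winding_number (Y \<circ> l) 0 \<in> \<int>"
      using pY zY l(1) by (intro integer_winding_number) (auto simp: loops_at_def pathstart_compose pathfinish_compose)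
    then obtain n where n: "winding_number (Y \<circ> l) 0 = of_int n" by (auto elim: Ints_cases)
    have pc: "path (\<lambda>t. of_nat N * c t)" using c(1) unfolding path_def by (intro continuous_intros)
    have "winding_number (d \<circ> (q \<circ> l)) 0 = winding_number (exp \<circ> (\<lambda>t. of_nat N * c t)) 0"
    proof (rule winding_number_homotopic_paths, rule homotopic_paths_eq)
      show "path (d \<circ> (q \<circ> l))" "path_image (d \<circ> (q \<circ> l)) \<subseteq> - {0}"
        using loop_image[OF ql] by auto
      show "(d \<circ> (q \<circ> l)) t = (exp \<circ> (\<lambda>t. of_nat N * c t)) t" if "t \<in> {0..1}" for t
        using to_pair[OF lE[OF that]] c(3)[OF that] by (simp add: exp_of_nat_mult)
    qed
    also have "\<dots> = (of_nat N * pathfinish c - of_nat N * pathstart c) / (2 * of_real pi * \<i>)"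
      using winding_number_compose_exp[OF pc] by (simp add: pathfinish_def pathstart_def)
    also have "\<dots> = of_nat N * (pathfinish c - pathstart c) / (2 * of_real pi * \<i>)"
      by (simp add: algebra_simps)
    also have "\<dots> = of_int (int N * n)"
    proof -
      have cancel: "of_nat N * (z * of_int n) / z = of_int (int N * n)" if "z \<noteq> 0" for z :: complex
        using that by simp
      show ?thesis unfolding c(2) n by (rule cancel) simp
    qed
    finally have "of_int (wind A) = (of_int (int N * n) :: complex)"
      using winding_wind[OF ql] A by simp
    then have "wind A = int N * n" by (simp only: of_int_eq_iff)
    then show "A \<in> {g \<in> carrier (fundamental_group X a). int N dvd wind g}"
      using A ql by (auto simp: carrier_fundamental_group)
  next
    fix A assume "A \<in> {g \<in> carrier (fundamental_group X a). int N dvd wind g}"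
    then obtain f where f1: "f \<in> loops_at X a" "A = path_class X f" "int N dvd wind A"
      by (auto simp: carrier_fundamental_group)
    then obtain m where "wind A = int N * m" by (elim dvdE)
    note f = f1(1,2) this
    note lf = loop_image[OF f(1)]
    obtain c where c: "path c" "pathfinish c - pathstart c = 2 * of_real pi * \<i> * winding_number (d \<circ> f) 0"
      "\<And>t. t \<in> {0..1} \<Longrightarrow> (d \<circ> f) t = 0 + exp (c t)"
      using winding_number_as_continuous_log[OF lf(1,2)] by metis
    have w: "pathfinish c - pathstart c = of_nat N * (2 * of_real pi * \<i> * of_int m)"
      using c(2) winding_wind[OF f(1)] f(2,3) by simp
    \<comment> \<open>The continuous N-th root of \<open>d\<close> along f that starts at Y e,
      obtained from the logarithm c.\<close>
    define y where "y = (\<lambda>t. Y e * exp ((c t - c 0) / of_nat N))"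
    define l where "l = (\<lambda>t. k (f t, y t))"
    have fX: "f t \<in> X" if "t \<in> {0..1}" for t using f(1) that by (auto simp: loops_at_def path_image_def)
    have f0: "f 0 = a" "f 1 = a" using f(1) by (auto simp: loops_at_def pathstart_def pathfinish_def)
    have yN: "y t ^ N = d (f t)" if t: "t \<in> {0..1}" for t
    proof -
      have "exp ((c t - c 0) / of_nat N) ^ N = exp (c t - c 0)"
        using N by (simp flip: exp_of_nat_mult)
      then have "y t ^ N = d a * exp (c t - c 0)"
        using to_pair[OF e(1)] e(2) by (simp add: y_def power_mult_distrib)
      also have "\<dots> = d (f t)"
        using c(3)[of 0] c(3)[OF t] f0 by (simp add: exp_diff)
      finally show ?thesis .
    qed
    \<comment> \<open>Divisibility enters here: after division by \<open>N\<close> the logarithm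
      still changes by a multiple of 2 pi i.\<close>
    have y1: "y 1 = Y e" "y 0 = Y e"
    proof -
      have "(c 1 - c 0) / of_nat N = 2 * of_real pi * \<i> * of_int m"
        using w N by (simp add: pathfinish_def pathstart_def)
      moreover have "exp (2 * of_real pi * \<i> * of_int m) = 1"
        using exp_integer_2pi[of "of_int m"] by (simp add: mult_ac)
      ultimately show "y 1 = Y e" "y 0 = Y e" by (simp_all add: y_def)
    qed
    have cy: "continuous_on {0..1} y"
      unfolding y_def using c(1) N by (intro continuous_intros) (auto simp: path_def)
    have cf: "continuous_on {0..1} f" using f(1) by (simp add: loops_at_def path_def)
    have "continuous_on {0..1} (\<lambda>t. (f t, y t))" using cf cy by (intro continuous_intros)
    then have "continuous_on {0..1} l"
      unfolding l_def by (rule continuous_on_compose2[OF k]) (use fX yN in auto)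
    moreover have lE: "l t \<in> E" "q (l t) = f t" if "t \<in> {0..1}" for t
      using of_pair[OF fX[OF that] yN[OF that]] by (simp_all add: l_def)
    moreover have "l 0 = e" "l 1 = e"
      using to_pair[OF e(1)] e(2) f0 y1 by (simp_all add: l_def)
    ultimately have l: "l \<in> loops_at E e"
      by (auto simp: loops_at_def path_def path_image_def pathstart_def pathfinish_def)
    have "homotopic_paths X f (q \<circ> l)"
      by (rule homotopic_paths_eq) (use f(1) lE(2) in \<open>auto simp: loops_at_def\<close>)
    then have "homotopic_paths X (q \<circ> l) f" by (simp only: homotopic_paths_sym_eq)
    then have "pi1_map X q (path_class E l) = A"
      using l pi1_map_path_class[OF q qE, of l] path_class_eq f(2) by (simp add: loops_at_def)
    then show "A \<in> pi1_map X q ` carrier (fundamental_group E e)"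
      using l by (auto simp: carrier_fundamental_group)
  qed
  then show ?thesis using e unfolding corresponds_to_subgroup_def by blast
qed

end

section \<open>A unipotent representation and its congruence subgroups\<close>

section \<open>Unipotent matrices over the \<open>p\<close>-adic integers\<close>

text \<open>What the finite sums in matrix products require.\<close>

lemma padic_abelian_monoid:
  assumes p: "p > 0"
  shows "abelian_monoid (padic_int p)"
proof (rule abelian_monoidI)
  have dv: "int p ^ i dvd int p ^ Suc i" for i by simp
  fix x y assume xy: "x \<in> carrier (padic_int p)" "y \<in> carrier (padic_int p)"
  show "x \<oplus>\<^bsub>padic_int p\<^esub> y \<in> carrier (padic_int p)"
  proof -
    have "((x (Suc i) + y (Suc i)) mod int p ^ Suc i) mod int p ^ i = (x i + y i) mod int p ^ i" for i
    proof -
      have "x (Suc i) mod int p ^ i = x i" "y (Suc i) mod int p ^ i = y i"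
        using xy by (simp_all add: padic_int_def)
      then show ?thesis by (metis dv mod_add_eq mod_mod_cancel)
    qed
    then show ?thesis using p by (simp add: padic_int_def)
  qed
  show "x \<oplus>\<^bsub>padic_int p\<^esub> y = y \<oplus>\<^bsub>padic_int p\<^esub> x"
    by (simp add: padic_int_def add.commute)
next
  show "\<zero>\<^bsub>padic_int p\<^esub> \<in> carrier (padic_int p)" using p by (simp add: padic_int_def)
next
  fix x y z
  show "x \<oplus>\<^bsub>padic_int p\<^esub> y \<oplus>\<^bsub>padic_int p\<^esub> z = x \<oplus>\<^bsub>padic_int p\<^esub> (y \<oplus>\<^bsub>padic_int p\<^esub> z)"
    by (simp add: padic_int_def mod_simps add.assoc)
next
  fix x assume "x \<in> carrier (padic_int p)"
  then show "\<zero>\<^bsub>padic_int p\<^esub> \<oplus>\<^bsub>padic_int p\<^esub> x = x"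
    by (auto simp: padic_int_def)
qed

definition padic_of_int :: "nat \<Rightarrow> int \<Rightarrow> nat \<Rightarrow> int" where
  "padic_of_int p k = (\<lambda>i. k mod int p ^ i)"

lemma padic_of_int:
  assumes "p > 0"
  shows "padic_of_int p k \<in> carrier (padic_int p)"
    "padic_of_int p k \<oplus>\<^bsub>padic_int p\<^esub> padic_of_int p l = padic_of_int p (k + l)"
    "padic_of_int p k \<otimes>\<^bsub>padic_int p\<^esub> padic_of_int p l = padic_of_int p (k * l)"
    "\<one>\<^bsub>padic_int p\<^esub> = padic_of_int p 1" "\<zero>\<^bsub>padic_int p\<^esub> = padic_of_int p 0"
proof -
  have "(k mod int p ^ Suc i) mod int p ^ i = k mod int p ^ i" for i
    by (rule mod_mod_cancel) simp
  then show "padic_of_int p k \<in> carrier (padic_int p)"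
    using assms by (simp add: padic_int_def padic_of_int_def)
qed (simp_all add: padic_int_def padic_of_int_def mod_simps)

text \<open>Addition of k becomes matrix multiplication, so a homomorphism to the integers yields a
  representation.\<close>

definition unipotent :: "nat \<Rightarrow> int \<Rightarrow> nat \<times> nat \<Rightarrow> nat \<Rightarrow> int" where
  "unipotent p k = (\<lambda>(i, j)\<in>{..<2} \<times> {..<2}. padic_of_int p (if i = j then 1 else if i = 0 then k else 0))"

lemma unipotent_mult:
  assumes p: "p > 0"
  shows "unipotent p k \<otimes>\<^bsub>matrix_monoid 2 (padic_int p)\<^esub> unipotent p l = unipotent p (k + l)"
proof -
  interpret abelian_monoid "padic_int p" by (rule padic_abelian_monoid[OF p])
  have "(\<Oplus>\<^bsub>padic_int p\<^esub>m\<in>{..<2}. unipotent p k (i, m) \<otimes>\<^bsub>padic_int p\<^esub> unipotent p l (m, j)) = unipotent p (k + l) (i, j)"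
    if ij: "i < 2" "j < 2" for i j
  proof -
    have c: "unipotent p k (i, m) \<otimes>\<^bsub>padic_int p\<^esub> unipotent p l (m, j) \<in> carrier (padic_int p)" if "m < 2" for m
      using ij that padic_of_int[OF p] by (simp add: unipotent_def)
    have s: "{..<2} = insert 0 {1::nat}" by auto
    have "(\<Oplus>\<^bsub>padic_int p\<^esub>m\<in>{..<2}. unipotent p k (i, m) \<otimes>\<^bsub>padic_int p\<^esub> unipotent p l (m, j)) =
       unipotent p k (i, 0) \<otimes>\<^bsub>padic_int p\<^esub> unipotent p l (0, j) \<oplus>\<^bsub>padic_int p\<^esub>
       unipotent p k (i, 1) \<otimes>\<^bsub>padic_int p\<^esub> unipotent p l (1, j)"
      unfolding s using c[of 0] c[of 1] by (subst finsum_insert) auto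
    also have "\<dots> = unipotent p (k + l) (i, j)"
    proof -
      have "i = 0 \<or> i = 1" "j = 0 \<or> j = 1" using ij by auto
      then show ?thesis using padic_of_int[OF p] by (auto simp: unipotent_def add.commute)
    qed
    finally show ?thesis .
  qed
  then show ?thesis
    by (auto simp: matrix_monoid_def unipotent_def restrict_def fun_eq_iff)
qed

lemma unipotent_carrier: "p > 0 \<Longrightarrow> unipotent p k \<in> carrier (matrix_monoid 2 (padic_int p))"
  using padic_of_int(1) by (auto simp: matrix_monoid_def unipotent_def)

lemma unipotent_one: "p > 0 \<Longrightarrow> unipotent p 0 = \<one>\<^bsub>matrix_monoid 2 (padic_int p)\<^esub>"
  using padic_of_int(4,5) by (auto simp: matrix_monoid_def unipotent_def restrict_def fun_eq_iff)

lemma unipotent_GL: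
  assumes p: "p > 0"
  shows "unipotent p k \<in> carrier (GL 2 (padic_int p))"
proof -
  have "unipotent p (- k) \<otimes>\<^bsub>matrix_monoid 2 (padic_int p)\<^esub> unipotent p k = \<one>\<^bsub>matrix_monoid 2 (padic_int p)\<^esub>"
    "unipotent p k \<otimes>\<^bsub>matrix_monoid 2 (padic_int p)\<^esub> unipotent p (- k) = \<one>\<^bsub>matrix_monoid 2 (padic_int p)\<^esub>"
    by (simp_all add: unipotent_mult[OF p] unipotent_one[OF p])
  then show ?thesis
    using unipotent_carrier[OF p] by (auto simp: GL_def units_of_def Units_def)
qed

text \<open>Since p^i > 1, the residue of 1 is 1 and the diagonal agrees with the unit matrix; the
  corner entry k decides.\<close>

lemma unipotent_reduce:
  assumes p: "p > 1" and i: "i \<ge> 1"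
  shows "reduce_mat 2 i (unipotent p k) = \<one>\<^bsub>GL 2 (residue_ring (int p ^ i))\<^esub> \<longleftrightarrow> int (p ^ i) dvd k"
proof -
  have "int p ^ i > 1" using p i by (simp add: one_less_power)
  then have e: "reduce_mat 2 i (unipotent p k) =
    (\<lambda>(r, s)\<in>{..<2} \<times> {..<2}. if r = s then 1 else if r = 0 then k mod int p ^ i else 0)"
    by (auto simp: reduce_mat_def unipotent_def padic_of_int_def restrict_def fun_eq_iff)
  have o: "\<one>\<^bsub>GL 2 (residue_ring (int p ^ i))\<^esub> = (\<lambda>(r, s)\<in>{..<2} \<times> {..<2}. if r = s then 1 else 0)"
  proof -
    have "one (residue_ring m) = 1" "zero (residue_ring m) = 0" for m
      by (simp_all add: residue_ring_def)
    then show ?thesis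
      by (simp add: GL_def units_of_def matrix_monoid_def cong: if_cong)
  qed
  show ?thesis
  proof
    assume "reduce_mat 2 i (unipotent p k) = \<one>\<^bsub>GL 2 (residue_ring (int p ^ i))\<^esub>"
    then have "reduce_mat 2 i (unipotent p k) (0, 1) = \<one>\<^bsub>GL 2 (residue_ring (int p ^ i))\<^esub> (0, 1)" by simp
    then show "int (p ^ i) dvd k" unfolding e o by (simp add: dvd_eq_mod_eq_0)
  next
    assume "int (p ^ i) dvd k"
    then have "k mod int p ^ i = 0" by (simp add: dvd_eq_mod_eq_0)
    then show "reduce_mat 2 i (unipotent p k) = \<one>\<^bsub>GL 2 (residue_ring (int p ^ i))\<^esub>"
      unfolding e o by (simp add: fun_eq_iff restrict_def)
  qed
qed

lemma unipotent_hom: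
  assumes p: "p > 0"
    and w: "\<And>A B. A \<in> carrier \<Gamma> \<Longrightarrow> B \<in> carrier \<Gamma> \<Longrightarrow> w (A \<otimes>\<^bsub>\<Gamma>\<^esub> B) = w A + w B"
  shows "(\<lambda>A. unipotent p (w A)) \<in> hom \<Gamma> (GL 2 (padic_int p))"
  using unipotent_GL[OF p] unipotent_mult[OF p] w by (auto simp: hom_def GL_def units_of_def)

text \<open>The image lies in the topological space and hence in its own closure, so for its
  elements membership in the kernel comes down to the corner entry modulo p^i.\<close>

lemma congruence_subgroup_unipotent:
  assumes p: "p > 1" and i: "i \<ge> 1"
  shows "congruence_subgroup 2 p \<Gamma> (\<lambda>A. unipotent p (w A)) i = {g \<in> carrier \<Gamma>. int (p ^ i) dvd w g}"
proof -
  let ?\<phi> = "\<lambda>A. unipotent p (w A)"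
  have "?\<phi> ` carrier \<Gamma> \<subseteq> topspace (GL_padic_topology 2 p)"
  proof
    fix x assume "x \<in> ?\<phi> ` carrier \<Gamma>"
    then obtain k where k: "x = unipotent p k" by blast
    have "unipotent p k \<in> ({..<2} \<times> {..<2}) \<rightarrow>\<^sub>E carrier (padic_int p)"
      using unipotent_carrier[of p k] p by (simp add: matrix_monoid_def)
    moreover have "unipotent p k \<in> carrier (GL 2 (padic_int p))"
      by (rule unipotent_GL) (use p in simp)
    ultimately show "x \<in> topspace (GL_padic_topology 2 p)"
      by (simp add: k GL_padic_topology_def padic_topology_def)
  qed
  then have "?\<phi> ` carrier \<Gamma> \<subseteq> GL_padic_topology 2 p closure_of (?\<phi> ` carrier \<Gamma>)"
    by (rule closure_of_subset)
  then show ?thesis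
    using unipotent_reduce[OF p i]
    by (auto simp: congruence_subgroup_def kernel_def image_closure_def)
qed

section \<open>The torus link, coordinates on its complement, and the identification of its
  covers\<close>

section \<open>The link\<close>

definition axis_knot :: "real \<Rightarrow> complex \<times> complex" where
  "axis_knot t = (cis (2 * pi * t), 0)"

text \<open>A (1, p) curve on the Clifford torus |z| = |w| = 1 / sqrt 2.\<close>

definition torus_curve :: "nat \<Rightarrow> real \<Rightarrow> complex \<times> complex" where
  "torus_curve p t = (cis (2 * pi * t) / sqrt 2, cis (2 * pi * p * t) / sqrt 2)"

lemma mem_S3: "(z, w) \<in> S3 \<longleftrightarrow> (cmod z)\<^sup>2 + (cmod w)\<^sup>2 = 1"
  by (simp add: S3_def norm_Pair real_sqrt_eq_1_iff)

lemma cis_derivative: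
  "((\<lambda>t. (\<i> * of_real c) ^ k * cis (c * t)) has_vector_derivative (\<i> * of_real c) ^ Suc k * cis (c * t)) (at t)"
proof -
  have "((\<lambda>t. (\<i> * of_real c) ^ k * exp (\<i> * of_real c * of_real t)) has_vector_derivative
      (\<i> * of_real c) ^ k * (exp (\<i> * of_real c * of_real t) * (\<i> * of_real c))) (at t)"
    by (rule has_vector_derivative_real_field) (auto intro!: derivative_eq_intros)
  then show ?thesis by (simp add: cis_conv_exp mult_ac)
qed

text \<open>The first component alone separates parameters and has nonzero derivative, so the axis
  (with B = 0) and the torus knot are covered at once. Each derivation multiplies a component by a
  constant, which gives the explicit sequence D.\<close>

lemma smooth_knot_cis:
  fixes c :: "nat" and A B :: complex
  assumes A: "A \<noteq> 0"
  shows "smooth_knot_param (\<lambda>t. (A * cis (2 * pi * t), B * cis (2 * pi * real c * t)))"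
    (is "smooth_knot_param ?g")
proof -
  define D where "D = (\<lambda>k t. (A * ((\<i> * of_real (2 * pi)) ^ k * cis (2 * pi * t)),
     B * ((\<i> * of_real (2 * pi * real c)) ^ k * cis (2 * pi * real c * t))))"
  have D: "(D k has_vector_derivative D (Suc k) t) (at t)" for k t
    unfolding D_def
    by (intro has_vector_derivative_Pair has_vector_derivative_mult_right cis_derivative)
  have D0: "D 0 = ?g" by (auto simp: D_def)
  have "smooth_curve ?g"
    unfolding smooth_curve_def using D D0 by blast
  moreover have "?g (t + 1) = ?g t" for t
  proof -
    have "cis (2 * pi * real c * (t + 1)) = cis (2 * pi * real c * t) * cis (2 * pi * of_nat c)"
      by (simp add: cis_mult algebra_simps)
    moreover have "cis (2 * pi * (t + 1)) = cis (2 * pi * t) * cis (2 * pi)"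
      by (simp add: cis_mult algebra_simps)
    ultimately show ?thesis by (simp add: cis_multiple_2pi)
  qed
  moreover have "inj_on ?g {0..<1}"
  proof (rule inj_onI)
    fix s t :: real assume st: "s \<in> {0..<1}" "t \<in> {0..<1}" "?g s = ?g t"
    then have "cis (2 * pi * s) = cis (2 * pi * t)" using A by simp
    then have "cis (2 * pi * s - 2 * pi * t) = 1" by (simp flip: cis_divide)
    then have "cos (2 * pi * s - 2 * pi * t) = 1" by (metis cis.sel(1) one_complex.sel(1))
    then obtain n :: int where "2 * pi * s - 2 * pi * t = of_int n * 2 * pi" using cos_one_2pi_int by auto
    then have "(s - t) * (2 * pi) = of_int n * (2 * pi)" by (simp add: algebra_simps)
    then have n: "s - t = of_int n" using pi_gt_zero by (simp only: mult_cancel_right) simp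
    then have "\<bar>real_of_int n\<bar> < 1" using st by auto
    then have "n = 0" by linarith
    then show "s = t" using n by simp
  qed
  moreover have "vector_derivative ?g (at t) \<noteq> 0" for t
  proof -
    have "vector_derivative ?g (at t) = D 1 t"
      using D[of 0 t] unfolding D0 by (simp add: vector_derivative_at)
    then show ?thesis using A by (simp add: D_def zero_prod_def)
  qed
  ultimately show ?thesis unfolding smooth_knot_param_def by blast
qed

definition torus_link :: "nat \<Rightarrow> (complex \<times> complex) set" where
  "torus_link p = range axis_knot \<union> range (torus_curve p)"

lemma torus_link_is_link: "is_link (torus_link p)"
proof -
  define \<gamma> where "\<gamma> = (\<lambda>k :: nat. if k = 0 then axis_knot else torus_curve p)"
  have a: "smooth_knot_param axis_knot"
    using smooth_knot_cis[of 1 0 0] by (simp add: axis_knot_def[abs_def])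
  have t: "smooth_knot_param (torus_curve p)"
    using smooth_knot_cis[of "1 / sqrt 2" "1 / sqrt 2" p] by (simp add: torus_curve_def[abs_def])
  have "range axis_knot \<subseteq> S3" by (auto simp: axis_knot_def mem_S3)
  moreover have "range (torus_curve p) \<subseteq> S3"
    by (auto simp: torus_curve_def mem_S3 norm_divide power_divide)
  moreover have "range axis_knot \<inter> range (torus_curve p) = {}"
    by (auto simp: axis_knot_def torus_curve_def)
  moreover have "torus_link p = (\<Union>k<2. range (\<gamma> k))"
  proof -
    have "{..<2} = {0, 1::nat}" by auto
    then show ?thesis by (simp add: torus_link_def \<gamma>_def)
  qed
  ultimately show ?thesis
    unfolding is_link_def using a t
    by (intro exI[of _ 2] exI[of _ \<gamma>]) (auto simp: \<gamma>_def)
qed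

definition torus_complement :: "nat \<Rightarrow> (complex \<times> complex) set" where
  "torus_complement p = S3 - torus_link p"

text \<open>This is u^p / v - 1 for u = z / |w| and v = w / |w|. At w = 0 division by zero makes it
  -1, so the axis has to be excluded by a separate condition.\<close>

definition branch_fun :: "nat \<Rightarrow> complex \<times> complex \<Rightarrow> complex" where
  "branch_fun p = (\<lambda>(z, w). (z / of_real (cmod w)) ^ p / (w / of_real (cmod w)) - 1)"

lemma mem_torus_complement:
  assumes p: "p > 0"
  shows "(z, w) \<in> torus_complement p \<longleftrightarrow> (z, w) \<in> S3 \<and> w \<noteq> 0 \<and> branch_fun p (z, w) \<noteq> 0"
proof -
  have polar: "\<exists>t. x = cis (2 * pi * t)" if "cmod x = 1" for x
  proof
    show "x = cis (2 * pi * (Arg x / (2 * pi)))"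
      using that rcis_cmod_Arg[of x] by (simp add: rcis_def)
  qed
  have axis: "(z, w) \<in> range axis_knot \<longleftrightarrow> w = 0" if "(z, w) \<in> S3"
  proof
    assume "w = 0"
    then have "cmod z = 1" using that by (simp add: mem_S3 power2_eq_1_iff) (metis norm_ge_zero neg_0_le_iff_le not_one_le_zero)
    then show "(z, w) \<in> range axis_knot" using polar[of z] \<open>w = 0\<close> by (auto simp: axis_knot_def)
  qed (auto simp: axis_knot_def)
  have torus: "(z, w) \<in> range (torus_curve p) \<longleftrightarrow> branch_fun p (z, w) = 0" if "(z, w) \<in> S3" "w \<noteq> 0"
  proof
    assume "(z, w) \<in> range (torus_curve p)"
    then obtain t where t: "z = cis (2 * pi * t) / sqrt 2" "w = cis (2 * pi * p * t) / sqrt 2"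
      by (auto simp: torus_curve_def)
    have "z / cmod w = cis (2 * pi * t)" "w / cmod w = cis (2 * pi * p * t)"
      unfolding t by (simp_all add: norm_divide)
    moreover have "cis (2 * pi * t) ^ p = cis (2 * pi * p * t)"
      by (simp add: Complex.DeMoivre mult_ac)
    moreover have "branch_fun p (z, w) = (z / cmod w) ^ p / (w / cmod w) - 1"
      by (simp only: branch_fun_def prod.case)
    ultimately show "branch_fun p (z, w) = 0" by simp
  next
    assume "branch_fun p (z, w) = 0"
    then have "(z / cmod w) ^ p / (w / cmod w) - 1 = 0" unfolding branch_fun_def prod.case .
    moreover have "w / cmod w \<noteq> 0" using that(2) by simp
    moreover have "A / B - 1 = 0 \<Longrightarrow> B \<noteq> 0 \<Longrightarrow> A = B" for A B :: complex by simp
    ultimately have e: "(z / cmod w) ^ p = w / cmod w" by blast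
    have "cmod (w / cmod w) = 1" using that(2) by (simp add: norm_divide)
    then have "cmod (z / cmod w) ^ p = 1" by (metis e norm_power)
    \<comment> \<open>A zero has |u| = 1, so both coordinates have modulus 1 / sqrt 2 and the point
      lies on the Clifford torus.\<close>
    then have u: "cmod (z / cmod w) = 1" using p by (metis norm_ge_zero power_eq_1_iff abs_norm_cancel not_gr_zero power_eq_imp_eq_base power_one zero_le_one)
    then have zw: "cmod z = cmod w" using that(2) by (simp add: norm_divide)
    then have "2 * (cmod w)\<^sup>2 = 1" using that(1) by (simp add: mem_S3)
    then have "(cmod w)\<^sup>2 = (1 / sqrt 2)\<^sup>2" by (simp add: power_divide)
    then have w: "cmod w = 1 / sqrt 2" by (rule power2_eq_imp_eq) auto
    obtain t where t: "z / cmod w = cis (2 * pi * t)" using polar[OF u] by blast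
    then have "z = cis (2 * pi * t) / sqrt 2" by (simp add: w field_simps)
    moreover have "w / cmod w = cis (2 * pi * p * t)"
      unfolding e[symmetric] t by (simp add: Complex.DeMoivre mult_ac)
    then have "w = cis (2 * pi * p * t) / sqrt 2" by (simp add: w field_simps)
    ultimately show "(z, w) \<in> range (torus_curve p)" by (auto simp: torus_curve_def)
  qed
  show ?thesis
    using axis torus unfolding torus_complement_def torus_link_def by blast
qed

lemma branch_fun_continuous: "p > 0 \<Longrightarrow> continuous_on (torus_complement p) (branch_fun p)"
  unfolding branch_fun_def case_prod_unfold
  by (intro continuous_intros) (auto simp: mem_torus_complement)

text \<open>The inverse of (z, w) |-> (z / |w|, w / |w|). As |v| = 1, the denominator is the norm of
  (u, v), and dividing by it returns to the sphere.\<close>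

definition sphere_proj :: "complex \<times> complex \<Rightarrow> complex \<times> complex" where
  "sphere_proj = (\<lambda>(u, v). (u / of_real (sqrt (1 + (cmod u)\<^sup>2)), v / of_real (sqrt (1 + (cmod u)\<^sup>2))))"

lemma sphere_proj:
  assumes p: "p > 0" and v: "cmod v = 1" and d: "u ^ p / v \<noteq> 1"
  shows "sphere_proj (u, v) \<in> torus_complement p" "branch_fun p (sphere_proj (u, v)) = u ^ p / v - 1"
proof -
  define s where "s = sqrt (1 + (cmod u)\<^sup>2)"
  have s: "s > 0" "s\<^sup>2 = 1 + (cmod u)\<^sup>2" by (simp_all add: s_def add_pos_nonneg)
  have q: "sphere_proj (u, v) = (u / s, v / s)" by (simp add: sphere_proj_def s_def)
  have w: "cmod (v / s) = 1 / s" using s v by (simp add: norm_divide)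
  have S: "sphere_proj (u, v) \<in> S3"
  proof -
    have "(cmod (u / s))\<^sup>2 + (cmod (v / s))\<^sup>2 = ((cmod u)\<^sup>2 + 1) / s\<^sup>2"
      using v by (simp add: norm_divide power_divide add_divide_distrib)
    also have "\<dots> = s\<^sup>2 / s\<^sup>2" by (simp only: s(2) add.commute)
    also have "\<dots> = 1" using s(1) by simp
    finally show ?thesis unfolding q mem_S3 .
  qed
  have "(u / s) / cmod (v / s) = u" "(v / s) / cmod (v / s) = v"
    unfolding w using s(1) by simp_all
  then show b: "branch_fun p (sphere_proj (u, v)) = u ^ p / v - 1"
    unfolding q branch_fun_def prod.case by (simp only:)
  have "v / s \<noteq> 0" using v s by auto
  then show "sphere_proj (u, v) \<in> torus_complement p"
    using S b d unfolding q mem_torus_complement[OF p] by auto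
qed

definition cover_proj :: "complex \<times> complex \<times> complex \<Rightarrow> complex \<times> complex" where
  "cover_proj = (\<lambda>(u, v, y). sphere_proj (u, v))"

definition cover_inv :: "(complex \<times> complex) \<times> complex \<Rightarrow> complex \<times> complex \<times> complex" where
  "cover_inv = (\<lambda>((z, w), y). (z / of_real (cmod w), w / of_real (cmod w), y))"

text \<open>Chosen so that \<open>branch_fun\<close> runs once around the circle of radius 1/2; it
  is the image of the base section for N = 1.\<close>

definition base_loop :: "nat \<Rightarrow> real \<Rightarrow> complex \<times> complex" where
  "base_loop p t = sphere_proj (exp (Ln (1 + cis (2 * pi * t) / 2) / p), 1)"

lemma base_loop:
  assumes p: "p > 0"
  shows "path (base_loop p)" "path_image (base_loop p) \<subseteq> torus_complement p"
    "pathfinish (base_loop p) = pathstart (base_loop p)"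
    "branch_fun p (base_loop p t) = cis (2 * pi * t) / 2"
proof -
  have re: "Re (1 + cis x / 2) > 0" for x
  proof -
    have "Re (1 + cis x / 2) = 1 + cos x / 2" by simp
    then show ?thesis using cos_ge_minus_one[of x] by linarith
  qed
  then have nz: "1 + cis x / 2 \<noteq> 0" for x by (metis less_irrefl zero_complex.sel(1))
  have pw: "exp (Ln (1 + cis x / 2) / p) ^ p = 1 + cis x / 2" for x
    using p nz[of x] by (simp flip: exp_of_nat_mult)
  have d: "exp (Ln (1 + cis x / 2) / p) ^ p / 1 \<noteq> 1" for x unfolding pw by simp
  show "branch_fun p (base_loop p t) = cis (2 * pi * t) / 2"
    unfolding base_loop_def by (subst sphere_proj(2)[OF p _ d]) (simp_all add: pw)
  show "path_image (base_loop p) \<subseteq> torus_complement p"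
    using sphere_proj(1)[OF p _ d] by (auto simp: path_image_def base_loop_def)
  have "1 + cis x / 2 \<notin> \<real>\<^sub>\<le>\<^sub>0" for x
    using re[of x] by (auto simp only: complex_nonpos_Reals_iff)
  then have c: "continuous_on UNIV (\<lambda>t. exp (Ln (1 + cis (2 * pi * t) / 2) / p))"
    using p by (intro continuous_intros) auto
  have nz': "1 + (cmod u)\<^sup>2 \<noteq> 0" for u :: complex
    using zero_le_power2[of "cmod u"] by linarith
  have "continuous_on UNIV sphere_proj"
    unfolding sphere_proj_def case_prod_unfold by (intro continuous_intros) (auto simp: nz')
  then have "continuous_on UNIV (base_loop p)"
    unfolding base_loop_def by (rule continuous_on_compose2) (use c in \<open>auto intro!: continuous_intros\<close>)
  then show "path (base_loop p)" unfolding path_def by (rule continuous_on_subset) simp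
  show "pathfinish (base_loop p) = pathstart (base_loop p)"
    by (simp add: pathfinish_def pathstart_def base_loop_def)
qed

lemma torus_winding_map:
  assumes p: "p > 0"
  shows "winding_map (torus_complement p) (base_loop p 0) (branch_fun p)"
proof
  show "base_loop p 0 \<in> torus_complement p"
    using base_loop(2)[OF p] by (auto simp: path_image_def)
  show "continuous_on (torus_complement p) (branch_fun p)"
    by (rule branch_fun_continuous[OF p])
  show "branch_fun p x \<noteq> 0" if "x \<in> torus_complement p" for x
    using that mem_torus_complement[OF p] by (cases x) auto
qed

text \<open>In the coordinates u, v, the condition that y is an N-th root of u^p / v - 1 is the
  equation of \<open>seifert_space\<close>, and \<open>y \<noteq> 0\<close> says that the torus knot
  is avoided.\<close>

lemma torus_root_cover:
  assumes p: "p > 0" and N: "N > 0"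
  shows "root_cover (torus_complement p) (base_loop p 0) (branch_fun p) N (seifert_space p N)
    cover_proj (\<lambda>e. snd (snd e)) cover_inv"
proof (rule root_cover.intro[OF torus_winding_map[OF p]], unfold_locales)
  show "N > 0" by (rule N)
  have nz: "1 + (cmod u)\<^sup>2 \<noteq> 0" for u :: complex
    using zero_le_power2[of "cmod u"] by linarith
  show "continuous_on (seifert_space p N) cover_proj"
    unfolding cover_proj_def sphere_proj_def case_prod_unfold
    by (intro continuous_intros) (auto simp: nz)
  show "continuous_on (seifert_space p N) (\<lambda>e. snd (snd e))" by (intro continuous_intros)
  show "continuous_on {(x, y). x \<in> torus_complement p \<and> y ^ N = branch_fun p x}
     cover_inv"
    unfolding cover_inv_def case_prod_unfold
    by (intro continuous_intros) (auto simp: mem_torus_complement[OF p])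
  show "cover_proj e \<in> torus_complement p \<and> snd (snd e) ^ N = branch_fun p (cover_proj e) \<and>
      cover_inv (cover_proj e, snd (snd e)) = e" if "e \<in> seifert_space p N" for e
  proof -
    obtain u v y where e: "e = (u, v, y)" "cmod v = 1" "y \<noteq> 0" "u ^ p = v * (1 + y ^ N)"
      using \<open>e \<in> seifert_space p N\<close> by (auto simp: seifert_space_def)
    have "v \<noteq> 0" using e by auto
    then have uv: "u ^ p / v = 1 + y ^ N" using e by simp
    then have "u ^ p / v \<noteq> 1" using e N by simp
    note sp = sphere_proj[OF p e(2) this]
    define s where "s = sqrt (1 + (cmod u)\<^sup>2)"
    have s: "s > 0" by (simp add: s_def add_pos_nonneg)
    have q: "sphere_proj (u, v) = (u / s, v / s)" by (simp add: sphere_proj_def s_def)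
    have w: "cmod (v / s) = 1 / s" using s e by (simp add: norm_divide)
    have "(u / s) / cmod (v / s) = u" "(v / s) / cmod (v / s) = v"
      unfolding w using s by simp_all
    then show ?thesis using sp uv unfolding e(1) cover_proj_def by (simp add: q cover_inv_def)
  qed
  show "cover_inv (x, y) \<in> seifert_space p N \<and>
      cover_proj (cover_inv (x, y)) = x \<and>
      snd (snd (cover_inv (x, y))) = y"
    if x: "x \<in> torus_complement p" and y: "y ^ N = branch_fun p x" for x y
  proof -
    obtain z w where zw: "x = (z, w)" by fastforce
    have m: "(z, w) \<in> S3" "w \<noteq> 0" "branch_fun p (z, w) \<noteq> 0"
      using x mem_torus_complement[OF p] by (auto simp: zw)
    define r where "r = cmod w"
    have r: "r > 0" using m by (simp add: r_def)
    have v: "cmod (w / r) = 1" using r by (simp add: norm_divide) (simp add: r_def)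
    have "y \<noteq> 0" using m y N by (auto simp: zw zero_power)
    moreover have "(z / r) ^ p = (w / r) * (1 + y ^ N)"
    proof -
      have "1 + y ^ N = (z / r) ^ p / (w / r)"
        unfolding y zw branch_fun_def prod.case r_def by simp
      then show ?thesis using m(2) r by simp
    qed
    ultimately have E: "(z / r, w / r, y) \<in> seifert_space p N"
      using v by (simp add: seifert_space_def)
    \<comment> \<open>On the sphere |z|^2 + r^2 = 1, so (z / r, w / r) has norm 1 / r, and
      \<open>sphere_proj\<close> undoes the division by r.\<close>
    have "1 + (cmod (z / r))\<^sup>2 = (1 / r)\<^sup>2"
    proof -
      have "r\<^sup>2 * (1 + (cmod (z / r))\<^sup>2) = 1"
        using m(1) r by (simp add: mem_S3 norm_divide power_divide r_def[symmetric] distrib_left add.commute)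
      then show ?thesis using r by (simp add: power_divide field_simps)
    qed
    then have "sqrt (1 + (cmod (z / r))\<^sup>2) = 1 / r" using r by (simp only: real_sqrt_abs) simp
    then have "sphere_proj (z / r, w / r) = (z, w)" using r by (simp add: sphere_proj_def)
    then show ?thesis using E by (simp add: zw r_def cover_proj_def cover_inv_def)
  qed
qed

text \<open>Along \<open>base_loop\<close> the function has a logarithm that is affine in t and
  grows by 2 pi i.\<close>

lemma torus_wind_one:
  assumes p: "p > 0"
  shows "\<exists>A\<in>carrier (fundamental_group (torus_complement p) (base_loop p 0)).
     winding_map.wind (branch_fun p) A = 1"
proof -
  interpret winding_map "torus_complement p" "base_loop p 0" "branch_fun p"
    by (rule torus_winding_map[OF p])
  have l: "base_loop p \<in> loops_at (torus_complement p) (base_loop p 0)"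
    using base_loop(1-3)[OF p] by (simp add: loops_at_def pathstart_def)
  have "branch_fun p \<circ> base_loop p = exp \<circ> (\<lambda>t. \<i> * (2 * pi * t) - ln 2)"
    by (auto simp: base_loop(4)[OF p] exp_diff cis_conv_exp fun_eq_iff simp flip: exp_of_real)
  moreover have "path (\<lambda>t. \<i> * (2 * pi * t) - ln 2 :: complex)"
    unfolding path_def by (intro continuous_intros)
  ultimately have "winding_number (branch_fun p \<circ> base_loop p) 0 = 1"
    using winding_number_compose_exp by (simp add: pathfinish_def pathstart_def)
  then have "of_int (wind (path_class (torus_complement p) (base_loop p))) = (1 :: complex)"
    using winding_wind[OF l] by simp
  then have "wind (path_class (torus_complement p) (base_loop p)) = 1" by simp
  then show ?thesis using l by (auto simp: carrier_fundamental_group)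
qed

theorem proposition1p5:
  fixes p :: nat
  assumes "prime p"
  shows "\<exists>(X :: (complex \<times> complex) set) a n \<phi>
           (E :: nat \<Rightarrow> (complex \<times> complex \<times> complex) set) q (\<alpha> :: real) \<beta>.
    is_link_complement X \<and> a \<in> X \<and> n > 0 \<and>
    (let \<Gamma> = fundamental_group X a;
         \<Gamma>\<^sub>i = congruence_subgroup n p \<Gamma> \<phi>
     in \<phi> \<in> hom \<Gamma> (GL n (padic_int p)) \<and>
        (\<forall>i\<ge>1. p_cover p (E i) (q i) X \<and> corresponds_to_subgroup (E i) (q i) X a (\<Gamma>\<^sub>i i)) \<and>
        (\<lambda>i. real (homology_dim (residue_ring (int p)) 1 (top_of_set (E i)))
              / real (card (rcosets\<^bsub>\<Gamma>\<^esub> (\<Gamma>\<^sub>i i)))) \<longlonglongrightarrow> \<alpha> \<and>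
        (\<lambda>i. real (homology_dim rat_field 1 (top_of_set (E i)))
              / real (card (rcosets\<^bsub>\<Gamma>\<^esub> (\<Gamma>\<^sub>i i)))) \<longlonglongrightarrow> \<beta> \<and>
        \<alpha> \<noteq> \<beta>)"
proof -
  have p: "p > 0" "p > 1" using assms prime_gt_0_nat prime_gt_1_nat by auto
  let ?X = "torus_complement p" and ?a = "base_loop p 0"
  let ?G = "fundamental_group ?X ?a"
  interpret winding_map ?X ?a "branch_fun p" by (rule torus_winding_map[OF p(1)])
  define \<phi> where "\<phi> = (\<lambda>A. unipotent p (wind A))"
  define E where "E = (\<lambda>i. seifert_space p (p ^ i))"
  have sub: "congruence_subgroup 2 p ?G \<phi> i = {g \<in> carrier ?G. int (p ^ i) dvd wind g}" if "i \<ge> 1" for i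
    unfolding \<phi>_def by (rule congruence_subgroup_unipotent[OF p(2) that])
  have index: "card (rcosets\<^bsub>?G\<^esub> (congruence_subgroup 2 p ?G \<phi> i)) = p ^ i" if "i \<ge> 1" for i
  proof -
    obtain A where "A \<in> carrier ?G" "wind A = 1" using torus_wind_one[OF p(1)] by blast
    then show ?thesis unfolding sub[OF that] using p by (intro wind_index) auto
  qed
  \<comment> \<open>The locale \<open>seifert\<close> asks for \<open>N \<ge> 2\<close>, which holds
    from i = 1 on for every prime; the limits do not see i = 0.\<close>
  have N2: "p ^ i \<ge> 2" if "i \<ge> 1" for i
  proof -
    have "p ^ 1 \<le> p ^ i" using p that by (intro power_increasing) auto
    then show ?thesis using p by simp
  qed
  have cover: "p_cover p (E i) cover_proj ?X \<and>
      corresponds_to_subgroup (E i) cover_proj ?X ?a (congruence_subgroup 2 p ?G \<phi> i)" if i: "i \<ge> 1" for i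
  proof -
    interpret s: seifert p "p ^ i" by unfold_locales (use p N2[OF i] in auto)
    interpret c: root_cover ?X ?a "branch_fun p" "p ^ i" "E i" cover_proj "\<lambda>e. snd (snd e)"
      cover_inv
      unfolding E_def by (rule torus_root_cover) (use p in auto)
    have "path_connected (E i)" "E i \<noteq> {}"
      using s.seifert_path_connected s.base_section_in by (auto simp: E_def)
    then show ?thesis
      using c.is_p_cover[OF _ _ refl] c.corresponds unfolding sub[OF i] by blast
  qed
  have inv0: "(\<lambda>i. 1 / real (p ^ i)) \<longlonglongrightarrow> 0"
  proof -
    have "(\<lambda>i. (1 / real p) ^ i) \<longlonglongrightarrow> 0"
      using p by (intro LIMSEQ_realpow_zero) auto
    then show ?thesis by (simp add: power_divide)
  qed
  let ?fp = "\<lambda>i. real (homology_dim (residue_ring (int p)) 1 (top_of_set (E i)))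
      / real (card (rcosets\<^bsub>?G\<^esub> (congruence_subgroup 2 p ?G \<phi> i)))"
  let ?q = "\<lambda>i. real (homology_dim rat_field 1 (top_of_set (E i)))
      / real (card (rcosets\<^bsub>?G\<^esub> (congruence_subgroup 2 p ?G \<phi> i)))"
  \<comment> \<open>The bounds N and N + 1 are divided by the index N = p^i.\<close>
  have fp: "?fp \<longlonglongrightarrow> 1"
  proof (rule tendsto_sandwich)
    show "\<forall>\<^sub>F i in sequentially. 1 \<le> ?fp i"
      using eventually_ge_at_top[of 1]
    proof eventually_elim
      case (elim i)
      have "real (p ^ i) \<le> real (homology_dim (residue_ring (int p)) 1 (top_of_set (E i)))"
        using seifert_homology_mod_p(1)[OF assms N2[OF elim]] unfolding E_def of_nat_le_iff .
      then show ?case using p by (simp add: index[OF elim])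
    qed
    show "\<forall>\<^sub>F i in sequentially. ?fp i \<le> 1 + 1 / real (p ^ i)"
      using eventually_ge_at_top[of 1]
    proof eventually_elim
      case (elim i)
      have "real (homology_dim (residue_ring (int p)) 1 (top_of_set (E i))) \<le> real (p ^ i + 1)"
        using seifert_homology_mod_p(2)[OF assms N2[OF elim]] unfolding E_def of_nat_le_iff .
      then show ?case using p by (simp add: index[OF elim] field_simps)
    qed
    show "(\<lambda>i. 1 + 1 / real (p ^ i)) \<longlonglongrightarrow> 1"
      using tendsto_add[OF tendsto_const inv0, of 1] by simp
  qed simp
  \<comment> \<open>The rational dimension stays at most 2 while the index grows.\<close>
  have q: "?q \<longlonglongrightarrow> 0"
  proof (rule tendsto_sandwich)
    show "\<forall>\<^sub>F i in sequentially. 0 \<le> ?q i" by simp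
    show "\<forall>\<^sub>F i in sequentially. ?q i \<le> 2 * (1 / real (p ^ i))"
      using eventually_ge_at_top[of 1]
    proof eventually_elim
      case (elim i)
      have "real (homology_dim rat_field 1 (top_of_set (E i))) \<le> real 2"
        using seifert_homology_rat[OF p(1) N2[OF elim]] unfolding E_def of_nat_le_iff .
      then show ?case using p by (simp add: index[OF elim] divide_right_mono)
    qed
    show "(\<lambda>i. 2 * (1 / real (p ^ i))) \<longlonglongrightarrow> 0"
      using tendsto_mult[OF tendsto_const inv0, of 2] by simp
  qed simp
  have hom: "\<phi> \<in> hom ?G (GL 2 (padic_int p))"
    unfolding \<phi>_def by (rule unipotent_hom[OF p(1) wind_mult])
  have link: "is_link_complement ?X"
    using torus_link_is_link by (auto simp: is_link_complement_def torus_complement_def)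
  show ?thesis
    unfolding Let_def
    by (intro exI[of _ ?X] exI[of _ ?a] exI[of _ "2 :: nat"] exI[of _ \<phi>] exI[of _ E]
        exI[of _ "\<lambda>i. cover_proj"] exI[of _ "1 :: real"] exI[of _ "0 :: real"])
      (use link a hom cover fp q in simp)
qed

end
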